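(* Let $(A_N)_{N\ge2}$ be a sequence of coupling matrices such that $\max_{1\le i\le N}R_i\lesssim1$ and $\lim_{N\to\infty}\lambda_1(A_N)=1$, and let $\boldsymbol\sigma$ be drawn from the Ising model $\mathbb P$ with parameters $(A_N,\beta,B)$. (a) If $(\beta,B)\in\Theta_1$, then there exists a fixed $\delta>0$ (free of $N$) such that $$\log\mathbb E\left[\exp\left(\frac\delta2\sum_{i=1}^N(m_i(\boldsymbol\sigma)-t)^2\right)\right]\lesssim\lVert A_N\rVert_F^2+t^2\sum_{i=1}^N(R_i-1)^2.$$ (b) If $(\beta,B)\in\Theta_2$ and in addition $\limsup_{N\to\infty}\frac{\lambda_2(A_N)}{\lambda_1(A_N)}<1$, then there exists a fixed $\delta>0$ (free of $N$) such that $$\log\mathbb E\left[\exp\left(\frac\delta2\sum_{i=1}^N(m_i(\boldsymbol\sigma)-M(\boldsymbol\sigma))^2\right)\right]\lesssim\lVert A_N\rVert_F^2+t^2\sum_{i=1}^N(R_i-1)^2.$$ (c) If $(\beta,B)\in\Theta_3$ and in addition $\limsup_{N\to\infty}\frac{\lambda_2(A_N)}{\lambda_1(A_N)}<1$, then there exists a fixed $\delta>0$ (free of $N$) such that $$\log\mathbb E\left[\exp\left(\frac\delta2\sum_{i=1}^N(m_i(\boldsymbol\sigma)-\overline{\boldsymbol m}(\boldsymbol\sigma))^2\right)\right]\lesssim\lVert A_N\rVert_F^2+\frac1N\Big[\sum_{i=1}^N(R_i-1)^2\Big]^2+\frac1N\Big[\sum_{i=1}^N(R_i-1)\Big]^2+\log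 N,$$ where $\overline{\boldsymbol m}(\boldsymbol\sigma):=N^{-1}\sum_{i=1}^Nm_i(\boldsymbol\sigma)$.
   Context: A coupling matrix $A_N$ is a symmetric $N\times N$ matrix with non-negative entries and zeros on the diagonal. The Ising model with parameters $(A_N,\beta,B)$, $\beta>0$, $B\in\mathbb R$, is the probability mass function on $\boldsymbol\sigma=(\sigma_1,\dots,\sigma_N)\in\{-1,1\}^N$ given by $\mathbb P(\boldsymbol\sigma)=\frac1{Z_N(\beta,B)}\exp\big(\frac\beta2\boldsymbol\sigma^\top A_N\boldsymbol\sigma+B\sum_{i=1}^N\sigma_i\big)$; $\mathbb E$ is expectation under it. Put $\overline{\boldsymbol\sigma}=\frac1N\sum_{i=1}^N\sigma_i$, $m_i(\boldsymbol\sigma)=\sum_{j=1}^NA_N(i,j)\sigma_j$, $R_i=\sum_{j=1}^NA_N(i,j)$, $\lambda_1(A_N)\ge\dots\ge\lambda_N(A_N)$ the eigenvalues, $\lVert\cdot\rVert_F$ the Frobenius norm. Parameter regimes: $\Theta_{11}=\{(\beta,0):0<\beta<1\}$, $\Theta_{12}=\{(\beta,B):\beta>0,B\ne0\}$, $\Theta_1=\Theta_{11}\cup\Theta_{12}$, $\Theta_2=\{(\beta,0):\beta>1\}$, $\Theta_3=\{(1,0)\}$. Define $t$: for $(\beta,B)\in\Theta_{11}\cup\Theta_3$, $t=0$; for $(\beta,B)\in\Theta_{12}$, $t$ is the unique solution of $x=\tanh(\beta x+B)$ with the same sign as $B$; for $(\beta,B)\in\Theta_2$, $t$ is the unique strictly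 positive solution of $x=\tanh(\beta x)$. For $(\beta,B)\in\Theta_2$, $M(\boldsymbol\sigma)=t$ if $\overline{\boldsymbol\sigma}\ge0$ and $M(\boldsymbol\sigma)=-t$ otherwise. $x_N\lesssim y_N$ means there is a finite constant $C$ free of $N$ (it may depend on $\beta,B$ and on the sequence $(A_N)$) with $x_N\le Cy_N$ for all $N$. *)

theory Defs
  imports
    "HOL-Probability.Probability_Mass_Function"
    "Jordan_Normal_Form.Char_Poly"
begin

text \<open>Sites are numbered from 0, i.e. \<open>i < N\<close> replaces \<open>1 \<le> i \<le> N\<close>.\<close>

definition coupling_matrix :: "nat \<Rightarrow> real mat \<Rightarrow> bool" where
  "coupling_matrix N A \<longleftrightarrow>
     A \<in> carrier_mat N N \<and> transpose_mat A = A \<and>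
     (\<forall>i<N. \<forall>j<N. 0 \<le> A $$ (i, j)) \<and> (\<forall>i<N. A $$ (i, i) = 0)"

definition row_sum :: "nat \<Rightarrow> real mat \<Rightarrow> nat \<Rightarrow> real" where
  "row_sum N A i = (\<Sum>j<N. A $$ (i, j))"

definition frobenius_norm :: "nat \<Rightarrow> real mat \<Rightarrow> real" where
  "frobenius_norm N A = sqrt (\<Sum>i<N. \<Sum>j<N. (A $$ (i, j))\<^sup>2)"

text \<open>The \<open>k\<close>-th largest eigenvalue (\<open>k = 1, \<dots>, N\<close>), counted with algebraic multiplicity.
  The characteristic polynomial of a real symmetric \<open>N \<times> N\<close> matrix splits over the reals, so for
  such matrices the list below has length \<open>N\<close>.\<close>

definition eigenvalue_desc :: "nat \<Rightarrow> real mat \<Rightarrow> real" where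
  "eigenvalue_desc k A = rev (sorted_list_of_multiset (proots (char_poly A))) ! (k - 1)"

subsection \<open>The Ising model\<close>

text \<open>A configuration is a function that is \<open>undefined\<close> outside \<open>{..<N}\<close>, so that
  this set has exactly \<open>2 ^ N\<close> elements.\<close>

definition spin_configs :: "nat \<Rightarrow> (nat \<Rightarrow> real) set" where
  "spin_configs N = PiE {..<N} (\<lambda>_. {-1, 1})"

definition ising_weight :: "nat \<Rightarrow> real mat \<Rightarrow> real \<Rightarrow> real \<Rightarrow> (nat \<Rightarrow> real) \<Rightarrow> real" where
  "ising_weight N A \<beta> B \<sigma> =
     exp (\<beta> / 2 * (\<Sum>i<N. \<Sum>j<N. \<sigma> i * A $$ (i, j) * \<sigma> j) + B * (\<Sum>i<N. \<sigma> i))"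

definition ising_partition :: "nat \<Rightarrow> real mat \<Rightarrow> real \<Rightarrow> real \<Rightarrow> real" where
  "ising_partition N A \<beta> B = (\<Sum>\<sigma>\<in>spin_configs N. ising_weight N A \<beta> B \<sigma>)"

definition ising_pmf :: "nat \<Rightarrow> real mat \<Rightarrow> real \<Rightarrow> real \<Rightarrow> (nat \<Rightarrow> real) pmf" where
  "ising_pmf N A \<beta> B = embed_pmf (\<lambda>\<sigma>.
     if \<sigma> \<in> spin_configs N then ising_weight N A \<beta> B \<sigma> / ising_partition N A \<beta> B else 0)"

lemma finite_spin_configs: "finite (spin_configs N)"
  unfolding spin_configs_def by (intro finite_PiE) auto

lemma ising_partition_pos: "0 < ising_partition N A \<beta> B"
proof -
  have "spin_configs N \<noteq> {}"
    by (auto simp: spin_configs_def PiE_eq_empty_iff)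
  then show ?thesis
    unfolding ising_partition_def
    by (intro sum_pos finite_spin_configs) (auto simp: ising_weight_def)
qed

lemma pmf_ising:
  "pmf (ising_pmf N A \<beta> B) \<sigma> =
     (if \<sigma> \<in> spin_configs N then ising_weight N A \<beta> B \<sigma> / ising_partition N A \<beta> B else 0)"
  unfolding ising_pmf_def
proof (rule pmf_embed_pmf)
  let ?f = "\<lambda>\<sigma>. if \<sigma> \<in> spin_configs N
                 then ising_weight N A \<beta> B \<sigma> / ising_partition N A \<beta> B else 0"
  show nn: "0 \<le> ?f \<sigma>" for \<sigma>
    using ising_partition_pos[of N A \<beta> B] by (auto simp: ising_weight_def)
  have "(\<integral>\<^sup>+\<sigma>. ennreal (?f \<sigma>) \<partial>count_space UNIV) = (\<Sum>\<sigma>\<in>spin_configs N. ennreal (?f \<sigma>))"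
    by (rule nn_integral_count_space'[OF finite_spin_configs]) auto
  also have "\<dots> = ennreal (\<Sum>\<sigma>\<in>spin_configs N. ?f \<sigma>)"
    using nn by (intro sum_ennreal)
  also have "(\<Sum>\<sigma>\<in>spin_configs N. ?f \<sigma>) = 1"
    using ising_partition_pos[of N A \<beta> B]
    by (simp add: sum_divide_distrib[symmetric] ising_partition_def[symmetric])
  finally show "(\<integral>\<^sup>+\<sigma>. ennreal (?f \<sigma>) \<partial>count_space UNIV) = 1"
    by simp
qed

definition spin_mean :: "nat \<Rightarrow> (nat \<Rightarrow> real) \<Rightarrow> real" where
  "spin_mean N \<sigma> = (\<Sum>i<N. \<sigma> i) / real N"

definition local_field :: "nat \<Rightarrow> real mat \<Rightarrow> (nat \<Rightarrow> real) \<Rightarrow> nat \<Rightarrow> real" where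
  "local_field N A \<sigma> i = (\<Sum>j<N. A $$ (i, j) * \<sigma> j)"

definition mean_local_field :: "nat \<Rightarrow> real mat \<Rightarrow> (nat \<Rightarrow> real) \<Rightarrow> real" where
  "mean_local_field N A \<sigma> = (\<Sum>i<N. local_field N A \<sigma> i) / real N"

subsection \<open>Parameter regimes\<close>

definition Theta11 :: "(real \<times> real) set" where
  "Theta11 = {(\<beta>, B). 0 < \<beta> \<and> \<beta> < 1 \<and> B = 0}"

definition Theta12 :: "(real \<times> real) set" where
  "Theta12 = {(\<beta>, B). 0 < \<beta> \<and> B \<noteq> 0}"

definition Theta1 :: "(real \<times> real) set" where
  "Theta1 = Theta11 \<union> Theta12"

definition Theta2 :: "(real \<times> real) set" where
  "Theta2 = {(\<beta>, B). 1 < \<beta> \<and> B = 0}"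

definition Theta3 :: "(real \<times> real) set" where
  "Theta3 = {(1, 0)}"

text \<open>The value outside all regimes (\<open>\<beta> \<le> 0\<close>) is immaterial; it falls into the last branch.\<close>

definition mf_root :: "real \<Rightarrow> real \<Rightarrow> real" where
  "mf_root \<beta> B =
     (if (\<beta>, B) \<in> Theta11 \<union> Theta3 then 0
      else if (\<beta>, B) \<in> Theta12 then (THE x. x = tanh (\<beta> * x + B) \<and> sgn x = sgn B)
      else (THE x. 0 < x \<and> x = tanh (\<beta> * x)))"

definition signed_root :: "nat \<Rightarrow> real \<Rightarrow> real \<Rightarrow> (nat \<Rightarrow> real) \<Rightarrow> real" where
  "signed_root N \<beta> B \<sigma> = (if 0 \<le> spin_mean N \<sigma> then mf_root \<beta> B else - mf_root \<beta> B)"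

text \<open>The sequences of interest are indexed by \<open>N \<ge> 2\<close>.\<close>

definition lesssim :: "(nat \<Rightarrow> real) \<Rightarrow> (nat \<Rightarrow> real) \<Rightarrow> bool" where
  "lesssim x y \<longleftrightarrow> (\<exists>C. \<forall>N\<ge>2. x N \<le> C * y N)"

end

theory Submission
  imports Defs "HOL-Probability.Probability" "Jordan_Normal_Form.Schur_Decomposition"
    "HOL-Computational_Algebra.Fundamental_Theorem_Algebra"
begin

text \<open>With \<open>h = \<beta> t + B\<close>, expanding the Hamiltonian around the constant vector \<open>t\<close> turns the Gibbs weight into
  a product measure with mean \<open>t = tanh h\<close> times the exponential of a centered quadratic form and of a
  linear form with coefficients \<open>\<beta> t (R\<^sub>i - 1)\<close>. A spin of mean \<open>tanh h\<close> is sub-Gaussian with variance proxy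
  \<open>tanh h / h\<close>, so integrating out the spins one at a time dominates the quadratic exponential moment by
  the Gaussian one, which is finite precisely under a spectral condition. In regime (a) the condition is
  \<open>\<beta> \<lambda>\<^sub>1 tanh h / h < 1\<close>, and because the diagonal vanishes the Gaussian bound only costs \<open>\<parallel>A\<parallel>\<^sub>F\<^sup>2\<close>.

  In regimes (b) and (c) the top eigenvector, close to the constants, is critical. Flip symmetry restricts
  to nonnegative magnetization, and the square of the magnetization is linearized around grid points \<open>w\<close>
  of spacing \<open>1 / sqrt N\<close>; the remaining form has norm below 1 by the spectral gap. The sum over \<open>w\<close> of the
  weights \<open>exp (N (ln (cosh (\<beta> w)) - \<beta> w\<^sup>2 / 2))\<close> is controlled by the quadratic maximum at \<open>t\<close> in (b) and by the
  quartic one at \<open>0\<close> in (c). For small \<open>w\<close> in (b) the variance proxy \<open>tanh (\<beta> w) / (\<beta> w)\<close> is too large, and the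
  one at a point just below \<open>t\<close> is used instead. If the row sums are far from 1, the bounds are trivial.\<close>

section \<open>Sub-Gaussian quadratic forms\<close>

text \<open>The precision of the bounds comes from a cancellation. Write \<open>S\<close> for the
  sum of the \<open>R_i - 1\<close>. The upper bound of the numerator carries the factor
  \<open>exp (\<beta> * t^2 / 2 * (S - N)) * (2 * cosh h) ^ N\<close>, and Jensen's inequality gives
  exactly this factor as a lower bound of the partition function; so in (a) nothing linear in
  \<open>S\<close> survives. In (b) each grid point has its own centre \<eta> instead of
  \<open>t\<close>, and what remains is \<open>(\<eta>^2 - t^2) * S\<close>, small enough to be paid
  by the quadratic decay around \<open>t\<close>. In (c) the decay is only quartic:
  \<open>w^2 * S\<close> competes with \<open>N * w^4\<close>, and completing the square in
  \<open>w^2\<close> produces the two terms with prefactor \<open>1 / N\<close>. No decay is then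
  left for the sum over the grid, and its roughly \<open>sqrt N\<close> points produce the term
  \<open>log N\<close>.

  Additive constants have to be absorbed by the right-hand side. In (c) \<open>log N\<close> does
  this; in (b) the squared Frobenius norm does, since row sums close to 1 on average force it to be
  at least 1/4.\<close>

lemma std_normal_density_mult_exp:
  "std_normal_density g * exp (b * g) = exp (b\<^sup>2 / 2) * normal_density b 1 g"
  by (simp add: normal_density_def mult_exp_exp power2_eq_square field_simps)

lemma integrable_std_normal_density_mult_exp [simp]:
  "integrable lborel (\<lambda>g. std_normal_density g * exp (b * g))"
  unfolding std_normal_density_mult_exp by simp

lemma integral_std_normal_density_mult_exp [simp]:
  "(\<integral>g. std_normal_density g * exp (b * g) \<partial>lborel) = exp (b\<^sup>2 / 2)"
  unfolding std_normal_density_mult_exp by simp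

text \<open>Completing the square in \<open>g\<close>. Writing the product as a multiple of a normal
  density with variance \<open>1 / c\<close> gives its integrability and its integral at once;
  \<open>s * a < 1\<close> is exactly \<open>0 < c\<close>.\<close>

lemma std_normal_density_mult_exp_square:
  fixes s a \<theta> g :: real
  assumes a: "0 \<le> a" and sa: "s * a < 1"
  defines "c \<equiv> 1 - s * a"
  shows "std_normal_density g * exp (s * (\<theta> + sqrt a * g)\<^sup>2 / 2) =
    exp (s * \<theta>\<^sup>2 / (2 * c)) / sqrt c * normal_density (s * \<theta> * sqrt a / c) (1 / sqrt c) g"
proof -
  have c: "c > 0" using sa by (simp add: c_def)
  have r: "sqrt a * sqrt a = a" using a by simp
  define r where "r = sqrt a"
  have rr: "r\<^sup>2 = a" using a by (simp add: r_def)
  have eq: "- g\<^sup>2 / 2 + s * (\<theta> + r * g)\<^sup>2 / 2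
     = s * \<theta>\<^sup>2 / (2 * c) + (- (g - s * \<theta> * r / c)\<^sup>2 / (2 * (1 / sqrt c)\<^sup>2))"
  proof -
    define D where "D = (g - s * \<theta> * r / c)\<^sup>2"
    have cD: "(c * g - s * \<theta> * r)\<^sup>2 = c\<^sup>2 * D"
      using c by (simp add: D_def power2_eq_square field_simps)
    have "c * (- g\<^sup>2 + s * (\<theta> + r * g)\<^sup>2) = s * \<theta>\<^sup>2 - (c * g - s * \<theta> * r)\<^sup>2"
      unfolding c_def rr[symmetric] by (simp add: power2_eq_square algebra_simps)
    then have "- g\<^sup>2 + s * (\<theta> + r * g)\<^sup>2 = (s * \<theta>\<^sup>2 - c\<^sup>2 * D) / c"
      unfolding cD using c by (simp add: field_simps)
    also have "\<dots> = s * \<theta>\<^sup>2 / c - c * D"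
      using c by (simp add: diff_divide_distrib power2_eq_square)
    finally have "- g\<^sup>2 / 2 + s * (\<theta> + r * g)\<^sup>2 / 2 = (s * \<theta>\<^sup>2 / c) / 2 - c * D / 2"
      unfolding add_divide_distrib[symmetric] diff_divide_distrib[symmetric] by simp
    moreover have "- D / (2 * (1 / sqrt c)\<^sup>2) = - (c * D / 2)"
      using c by (simp add: power_divide)
    ultimately show ?thesis by (simp add: D_def)
  qed
  have "std_normal_density g * exp (s * (\<theta> + r * g)\<^sup>2 / 2)
      = 1 / sqrt (2 * pi) * exp (- g\<^sup>2 / 2 + s * (\<theta> + r * g)\<^sup>2 / 2)"
    by (simp add: std_normal_density_def mult_exp_exp)
  also have "\<dots> = exp (s * \<theta>\<^sup>2 / (2 * c)) / sqrt c *
     (1 / (sqrt (2 * pi) * (1 / sqrt c)) * exp (- (g - s * \<theta> * r / c)\<^sup>2 / (2 * (1 / sqrt c)\<^sup>2)))"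
    unfolding eq exp_add using c by (simp add: field_simps)
  also have "1 / (sqrt (2 * pi) * (1 / sqrt c)) * exp (- (g - s * \<theta> * r / c)\<^sup>2 / (2 * (1 / sqrt c)\<^sup>2))
     = normal_density (s * \<theta> * r / c) (1 / sqrt c) g"
    using c by (simp add: normal_density_def real_sqrt_mult real_sqrt_divide power_divide)
  finally show ?thesis by (simp add: r_def)
qed

text \<open>\<open>exp (a y\<^sup>2 / 2)\<close> is a Gaussian average of the exponentials \<open>exp (sqrt a * g * y)\<close>.\<close>

lemma subgaussian_exp_square:
  fixes \<nu> y :: "'a \<Rightarrow> real"
  assumes V: "finite V"
    and sub: "\<And>\<theta>. (\<Sum>v\<in>V. \<nu> v * exp (\<theta> * y v)) \<le> L * exp (s * \<theta>\<^sup>2 / 2)"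
    and a: "0 \<le> a" and sa: "s * a < 1"
  shows "(\<Sum>v\<in>V. \<nu> v * exp (a * (y v)\<^sup>2 / 2 + \<theta> * y v))
    \<le> L * exp (s * \<theta>\<^sup>2 / (2 * (1 - s * a))) / sqrt (1 - s * a)"
proof -
  let ?n = std_normal_density
  have eq: "?n g * (\<Sum>v\<in>V. \<nu> v * exp ((\<theta> + sqrt a * g) * y v)) =
    (\<Sum>v\<in>V. \<nu> v * exp (\<theta> * y v) * (?n g * exp ((sqrt a * y v) * g)))" for g
    by (simp add: sum_distrib_left sum_distrib_right exp_add algebra_simps)
  have "(\<Sum>v\<in>V. \<nu> v * exp (a * (y v)\<^sup>2 / 2 + \<theta> * y v))
     = (\<Sum>v\<in>V. \<nu> v * exp (\<theta> * y v) * (\<integral>g. ?n g * exp ((sqrt a * y v) * g) \<partial>lborel))"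
    unfolding integral_std_normal_density_mult_exp
    using a by (simp add: power_mult_distrib exp_add mult_ac)
  also have "\<dots> = (\<integral>g. ?n g * (\<Sum>v\<in>V. \<nu> v * exp ((\<theta> + sqrt a * g) * y v)) \<partial>lborel)"
    unfolding eq by (subst Bochner_Integration.integral_sum) auto
  \<comment> \<open>The quadratic factor has become a random tilt, so the hypothesis
    \<open>sub\<close> applies for each \<open>g\<close> separately; this is why it is demanded for
    every tilt.\<close>
  also have "\<dots> \<le> (\<integral>g. L * (?n g * exp (s * (\<theta> + sqrt a * g)\<^sup>2 / 2)) \<partial>lborel)"
  proof (rule integral_mono)
    show "integrable lborel (\<lambda>g. ?n g * (\<Sum>v\<in>V. \<nu> v * exp ((\<theta> + sqrt a * g) * y v)))"
      unfolding eq by auto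
    show "integrable lborel (\<lambda>g. L * (?n g * exp (s * (\<theta> + sqrt a * g)\<^sup>2 / 2)))"
      unfolding std_normal_density_mult_exp_square[OF a sa] using sa by simp
    show "?n g * (\<Sum>v\<in>V. \<nu> v * exp ((\<theta> + sqrt a * g) * y v))
       \<le> L * (?n g * exp (s * (\<theta> + sqrt a * g)\<^sup>2 / 2))" for g
      using mult_left_mono[OF sub[of "\<theta> + sqrt a * g"], of "?n g"]
      by (simp add: mult_ac)
  qed
  also have "\<dots> = L * exp (s * \<theta>\<^sup>2 / (2 * (1 - s * a))) / sqrt (1 - s * a)"
    unfolding std_normal_density_mult_exp_square[OF a sa] using sa by simp
  finally show ?thesis .
qed

section \<open>Integrating out independent coordinates\<close>

lemma sum_PiE_insert:
  assumes "k \<notin> I"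
  shows "(\<Sum>f\<in>PiE (insert k I) (\<lambda>_. V). F f) = (\<Sum>v\<in>V. \<Sum>g\<in>PiE I (\<lambda>_. V). F (g(k := v)))"
proof -
  have "(\<Sum>f\<in>PiE (insert k I) (\<lambda>_. V). F f)
      = (\<Sum>(v, g)\<in>V \<times> PiE I (\<lambda>_. V). F (g(k := v)))"
    unfolding PiE_insert_eq using inj_combinator[OF assms, of "\<lambda>_. V"]
    by (subst sum.reindex) (auto simp: case_prod_unfold)
  then show ?thesis by (simp add: sum.cartesian_product)
qed

text \<open>Turns the determinant factor of one Gaussian integration into an exponential linear in
  \<open>z\<close>, so that the costs of successive pivots add up in the exponent. The reason is
  \<open>1 / (1 - z) = 1 + z / (1 - z)\<close> together with
  \<open>1 + x \<le> exp x\<close>.\<close>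

lemma inverse_sqrt_one_minus_le_exp:
  fixes z :: real
  assumes "0 \<le> z" "\<epsilon> \<le> 1 - z" "0 < \<epsilon>"
  shows "1 / sqrt (1 - z) \<le> exp (z / (2 * \<epsilon>))"
proof -
  have z: "0 < 1 - z" using assms by linarith
  have "1 / (1 - z) = 1 + z / (1 - z)" using z by (simp add: field_simps)
  also have "\<dots> \<le> exp (z / (1 - z))" by (rule exp_ge_add_one_self)
  also have "\<dots> \<le> exp (z / \<epsilon>)" using assms z by (simp add: frac_le)
  finally have "sqrt (1 / (1 - z)) \<le> sqrt (exp (z / \<epsilon>))" by simp
  also have "exp (z / \<epsilon>) = (exp (z / (2 * \<epsilon>)))\<^sup>2"
    by (simp add: exp_double[symmetric])
  finally show ?thesis by (simp add: real_sqrt_divide)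
qed

lemma subgaussian_factor_nonneg:
  fixes \<nu> y :: "'a \<Rightarrow> real"
  assumes "\<And>v. v \<in> V \<Longrightarrow> 0 \<le> \<nu> v"
    and "\<And>\<theta>. (\<Sum>v\<in>V. \<nu> v * exp (\<theta> * y v)) \<le> L * exp (s * \<theta>\<^sup>2 / 2)"
  shows "0 \<le> L"
proof -
  have "0 \<le> (\<Sum>v\<in>V. \<nu> v * exp (0 * y v))" using assms(1) by (intro sum_nonneg) auto
  also have "\<dots> \<le> L" using assms(2)[of 0] by simp
  finally show ?thesis .
qed

text \<open>Maximum of a concave quadratic in each coordinate. It caps the variational form
  \<open>G\<close> as soon as the form subtracted there is at least \<open>\<epsilon>\<close> times
  the squared norm.\<close>

lemma complete_square_sum_le:
  fixes m x :: "'i \<Rightarrow> real"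
  assumes \<epsilon>: "0 < \<epsilon>"
  shows "2 * (\<Sum>i\<in>I. m i * x i) - \<epsilon> * (\<Sum>i\<in>I. (x i)\<^sup>2) \<le> (\<Sum>i\<in>I. (m i)\<^sup>2) / \<epsilon>"
proof -
  have "2 * (m i * x i) - \<epsilon> * (x i)\<^sup>2 \<le> (m i)\<^sup>2 / \<epsilon>" for i
  proof -
    have "0 \<le> (m i - \<epsilon> * x i)\<^sup>2 / \<epsilon>" using \<epsilon> by simp
    also have "\<dots> = (m i)\<^sup>2 / \<epsilon> - (2 * (m i * x i) - \<epsilon> * (x i)\<^sup>2)"
      using \<epsilon> by (simp add: power2_eq_square field_simps)
    finally show ?thesis by simp
  qed
  then have "(\<Sum>i\<in>I. 2 * (m i * x i) - \<epsilon> * (x i)\<^sup>2) \<le> (\<Sum>i\<in>I. (m i)\<^sup>2 / \<epsilon>)"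
    by (intro sum_mono)
  then show ?thesis by (simp add: sum_subtractf sum_distrib_left sum_divide_distrib)
qed

text \<open>Induction on the index set, integrating out one coordinate at a time.  The form \<open>G\<close> plays the
  role of \<open>(1 - s M)\<^sup>-\<^sup>1\<close>, kept in the variational form
  \<open>G \<theta> \<theta> = max\<^sub>x (2 \<theta> x - x (1 - s M) x)\<close>, so that no determinants or inverses are needed; the pivot
  of the new coordinate is \<open>1 - s a\<close>.\<close>

lemma subgaussian_quadratic_form_step:
  fixes \<nu> y :: "'a \<Rightarrow> real" and M :: "'i \<Rightarrow> 'i \<Rightarrow> real"
  assumes I: "finite I" and V: "finite V" and \<nu>: "\<forall>v\<in>V. 0 \<le> \<nu> v"
    and sub: "\<And>\<theta>. (\<Sum>v\<in>V. \<nu> v * exp (\<theta> * y v)) \<le> L * exp (s * \<theta>\<^sup>2 / 2)"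
    and s: "0 \<le> s" and \<epsilon>: "0 < \<epsilon>"
    and sym: "\<forall>i\<in>I. \<forall>j\<in>I. M i j = M j i" and diag: "\<forall>i\<in>I. 0 \<le> M i i"
    and pos: "\<And>x. \<epsilon> * (\<Sum>i\<in>I. (x i)\<^sup>2)
      \<le> (\<Sum>i\<in>I. (x i)\<^sup>2) - s * (\<Sum>i\<in>I. \<Sum>j\<in>I. M i j * x i * x j)"
  shows "\<exists>G :: ('i \<Rightarrow> real) \<Rightarrow> ('i \<Rightarrow> real) \<Rightarrow> real.
      (\<forall>\<theta> \<phi> c u. G (\<lambda>i. \<theta> i + c * u i) \<phi> = G \<theta> \<phi> + c * G u \<phi>) \<and> (\<forall>\<theta> \<phi>. G \<theta> \<phi> = G \<phi> \<theta>) \<and>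
      (\<forall>\<theta>. 0 \<le> G \<theta> \<theta>) \<and>
      (\<forall>\<theta>. \<exists>x. G \<theta> \<theta> = 2 * (\<Sum>i\<in>I. \<theta> i * x i)
         - ((\<Sum>i\<in>I. (x i)\<^sup>2) - s * (\<Sum>i\<in>I. \<Sum>j\<in>I. M i j * x i * x j))) \<and>
      (\<forall>\<theta>. (\<Sum>f\<in>PiE I (\<lambda>_. V). (\<Prod>i\<in>I. \<nu> (f i)) *
          exp ((\<Sum>i\<in>I. \<Sum>j\<in>I. M i j * y (f i) * y (f j)) / 2 + (\<Sum>i\<in>I. \<theta> i * y (f i))))
        \<le> L ^ card I
          * exp ((s * (\<Sum>i\<in>I. M i i) + s\<^sup>2 / \<epsilon> * (\<Sum>i\<in>I. \<Sum>j\<in>I. (M i j)\<^sup>2)) / (2 * \<epsilon>))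
          * exp (s * G \<theta> \<theta> / 2))"
    (is "\<exists>G. ?Q I G")
  using I sym diag pos
proof (induction I)
  case empty
  show ?case by (rule exI[of _ "\<lambda>_ _. 0"]) simp
next
  case (insert k I)
  note kI = \<open>k \<notin> I\<close> and fin = \<open>finite I\<close>
  let ?H = "\<lambda>J x. (\<Sum>i\<in>J. (x i)\<^sup>2) - s * (\<Sum>i\<in>J. \<Sum>j\<in>J. M i j * x i * x j)"
  let ?W = "\<lambda>J \<theta> f. (\<Prod>i\<in>J. \<nu> (f i)) *
          exp ((\<Sum>i\<in>J. \<Sum>j\<in>J. M i j * y (f i) * y (f j)) / 2 + (\<Sum>i\<in>J. \<theta> i * y (f i)))"
  define D where "D = (\<lambda>J. exp ((s * (\<Sum>i\<in>J. M i i)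
     + s\<^sup>2 / \<epsilon> * (\<Sum>i\<in>J. \<Sum>j\<in>J. (M i j)\<^sup>2)) / (2 * \<epsilon>)))"
  define m where "m = (\<lambda>i. M k i)"
  have L: "0 \<le> L" by (rule subgaussian_factor_nonneg[OF _ sub]) (use \<nu> in auto)
  have split: "(\<Sum>i\<in>insert k I. \<Sum>j\<in>insert k I. M i j * x i * x j) =
     M k k * (x k)\<^sup>2 + 2 * x k * (\<Sum>i\<in>I. m i * x i) + (\<Sum>i\<in>I. \<Sum>j\<in>I. M i j * x i * x j)" for x
  proof -
    have "(\<Sum>i\<in>I. M i k * x i * x k) = x k * (\<Sum>i\<in>I. m i * x i)"
      unfolding m_def sum_distrib_left
    proof (rule sum.cong[OF refl])
      fix i assume "i \<in> I"
      then have "M i k = M k i" using insert.prems(1) by blast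
      then show "M i k * x i * x k = x k * (M k i * x i)" by simp
    qed
    moreover have "(\<Sum>j\<in>I. M k j * x k * x j) = x k * (\<Sum>i\<in>I. m i * x i)"
      by (simp add: m_def sum_distrib_left mult_ac)
    moreover have "(\<Sum>i\<in>insert k I. \<Sum>j\<in>insert k I. M i j * x i * x j)
        = (M k k * x k * x k + (\<Sum>j\<in>I. M k j * x k * x j))
          + ((\<Sum>i\<in>I. M i k * x i * x k) + (\<Sum>i\<in>I. \<Sum>j\<in>I. M i j * x i * x j))"
      using kI fin by (simp add: sum.distrib)
    ultimately show ?thesis by (simp add: power2_eq_square)
  qed
  have splitH: "?H (insert k I) x = (1 - s * M k k) * (x k)\<^sup>2
      - 2 * s * x k * (\<Sum>i\<in>I. m i * x i) + ?H I x" for x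
    unfolding split using kI fin by (simp add: algebra_simps)
  \<comment> \<open>Padding a vector with 0 at \<open>k\<close> transfers positivity from
    \<open>insert k I\<close> to \<open>I\<close>.\<close>
  have posI: "\<epsilon> * (\<Sum>i\<in>I. (x i)\<^sup>2) \<le> ?H I x" for x
  proof -
    have "(\<Sum>i\<in>insert k I. ((x(k := 0)) i)\<^sup>2) = (\<Sum>i\<in>I. (x i)\<^sup>2)"
      using kI fin by (auto intro!: sum.cong)
    moreover have "?H I (x(k := 0)) = ?H I x"
      using kI by (auto intro!: arg_cong2[of _ _ _ _ "(-)"] arg_cong[of _ _ "(*) s"] sum.cong)
    ultimately show ?thesis
      using insert.prems(3)[of "x(k := 0)"] unfolding splitH by simp
  qed
  have diagI: "\<forall>i\<in>I. 0 \<le> M i i" using insert.prems(2) by auto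
  have symI: "\<forall>i\<in>I. \<forall>j\<in>I. M i j = M j i" using insert.prems(1) by auto
  have "\<exists>G. ?Q I G" by (rule insert.IH[OF symI diagI posI])
  then obtain G where G: "?Q I G" ..
  have DI0: "exp ((s * (\<Sum>i\<in>I. M i i)
     + s\<^sup>2 / \<epsilon> * (\<Sum>i\<in>I. \<Sum>j\<in>I. (M i j)\<^sup>2)) / (2 * \<epsilon>)) = D I" by (simp add: D_def)
  note lin = G[THEN conjunct1, rule_format]
    and Gsym = G[THEN conjunct2, THEN conjunct1, rule_format]
    and Gpos = G[THEN conjunct2, THEN conjunct2, THEN conjunct1, rule_format]
    and att = G[THEN conjunct2, THEN conjunct2, THEN conjunct2, THEN conjunct1, rule_format]
    and IH = G[THEN conjunct2, THEN conjunct2, THEN conjunct2, THEN conjunct2, rule_format, unfolded DI0]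
  have quad: "G (\<lambda>i. \<theta> i + c * u i) (\<lambda>i. \<theta> i + c * u i) = G \<theta> \<theta> + 2 * c * G u \<theta> + c\<^sup>2 * G u u"
    for \<theta> u c
  proof -
    let ?w = "\<lambda>i. \<theta> i + c * u i"
    have "G ?w ?w = G ?w \<theta> + c * G ?w u"
      unfolding Gsym[of ?w \<theta>] Gsym[of ?w u] by (rule lin)
    also have "\<dots> = G \<theta> \<theta> + c * G u \<theta> + c * (G u \<theta> + c * G u u)"
      unfolding lin Gsym[of \<theta> u] ..
    finally show ?thesis by (simp add: power2_eq_square algebra_simps)
  qed
  \<comment> \<open>The coefficient of \<open>(y v)\<^sup>2 / 2\<close> once the sites of
    \<open>I\<close> are integrated out: \<open>M k k\<close> is there from the start, and
    \<open>s * G m m\<close> comes back from the linear tilt \<open>y v * m i\<close>.\<close>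
  define a where "a = M k k + s * G m m"
  have a0: "0 \<le> a" unfolding a_def using insert.prems(2) Gpos s by auto
  have hom: "G (\<lambda>i. c * u i) (\<lambda>i. c * u i) = c\<^sup>2 * G u u" for c u
  proof -
    have "G (\<lambda>i. 0) \<phi> = 0" for \<phi> using lin[of "\<lambda>_. 0" 1 "\<lambda>_. 0" \<phi>] by simp
    then show ?thesis using quad[of "\<lambda>_. 0" c u] Gsym[of u "\<lambda>_. 0"] by simp
  qed
  \<comment> \<open>Schur complement: the maximizer for the tilt \<open>s * m\<close>, completed by
    1 at \<open>k\<close>, is a test vector of squared norm at least 1 on which the form over
    \<open>insert k I\<close> takes the value \<open>1 - s * a\<close>.\<close>
  have pivot: "\<epsilon> \<le> 1 - s * a"
  proof -
    obtain x where x: "G (\<lambda>i. s * m i) (\<lambda>i. s * m i) = 2 * (\<Sum>i\<in>I. s * m i * x i) - ?H I x"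
      using att[of "\<lambda>i. s * m i"] by auto
    have "(\<Sum>i\<in>I. s * m i * x i) = s * (\<Sum>i\<in>I. m i * x i)"
      by (simp add: sum_distrib_left mult_ac)
    with x hom[of s m] have xs: "?H I x = 2 * s * (\<Sum>i\<in>I. m i * x i) - s\<^sup>2 * G m m" by simp
    let ?x = "x(k := 1)"
    have 1: "(\<Sum>i\<in>I. m i * ?x i) = (\<Sum>i\<in>I. m i * x i)" using kI by (intro sum.cong) auto
    have 2: "?H I ?x = ?H I x"
      using kI by (auto intro!: arg_cong2[of _ _ _ _ "(-)"] arg_cong[of _ _ "(*) s"] sum.cong)
    have "?H (insert k I) ?x = (1 - s * M k k) * (?x k)\<^sup>2
      - 2 * s * ?x k * (\<Sum>i\<in>I. m i * x i) + ?H I x"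
      unfolding splitH 1 2 ..
    also have "\<dots> = 1 - s * a"
      unfolding xs a_def by (simp add: power2_eq_square algebra_simps)
    finally have "\<epsilon> * (\<Sum>i\<in>insert k I. (?x i)\<^sup>2) \<le> 1 - s * a"
      using insert.prems(3)[of ?x] by simp
    moreover have "1 \<le> (\<Sum>i\<in>insert k I. (?x i)\<^sup>2)"
      using kI fin by (simp add: sum_nonneg)
    then have "\<epsilon> * 1 \<le> \<epsilon> * (\<Sum>i\<in>insert k I. (?x i)\<^sup>2)"
      using \<epsilon> by (intro mult_left_mono) auto
    ultimately show ?thesis by linarith
  qed
  then have sa: "s * a < 1" using \<epsilon> by linarith
  have Gm: "G m m \<le> (\<Sum>i\<in>I. (m i)\<^sup>2) / \<epsilon>"
  proof -
    obtain x where x: "G m m = 2 * (\<Sum>i\<in>I. m i * x i) - ?H I x" using att by blast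
    have "G m m \<le> 2 * (\<Sum>i\<in>I. m i * x i) - \<epsilon> * (\<Sum>i\<in>I. (x i)\<^sup>2)"
      using x posI[of x] by linarith
    also note complete_square_sum_le[OF \<epsilon>]
    finally show ?thesis .
  qed
  define l where "l = (\<lambda>\<theta>. \<theta> k + s * G m \<theta>)"
  \<comment> \<open>Block inversion: bordering by \<open>k\<close> changes the inverse form by a
    rank-one term, the product of two values of \<open>l\<close> over the pivot.\<close>
  define G' where "G' = (\<lambda>\<theta> \<phi>. G \<theta> \<phi> + l \<theta> * l \<phi> / (1 - s * a))"
  have linl: "l (\<lambda>i. \<theta> i + c * u i) = l \<theta> + c * l u" for \<theta> c u
    unfolding l_def using lin[of \<theta> c u m] Gsym[of m] by (simp add: algebra_simps)
  have G'1: "G' (\<lambda>i. \<theta> i + c * u i) \<phi> = G' \<theta> \<phi> + c * G' u \<phi>" for \<theta> \<phi> c u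
    unfolding G'_def lin linl by (simp add: add_divide_distrib algebra_simps)
  have G'2: "G' \<theta> \<phi> = G' \<phi> \<theta>" for \<theta> \<phi>
    unfolding G'_def by (simp add: Gsym[of \<theta>] mult.commute)
  have G'3: "0 \<le> G' \<theta> \<theta>" for \<theta>
    unfolding G'_def using Gpos[of \<theta>] sa by auto
  \<comment> \<open>The maximizer takes at \<open>k\<close> the value \<open>z\<close>, which
    maximizes the remaining one-variable quadratic, and on \<open>I\<close> it is the maximizer for
    the tilt shifted by \<open>s * z * m\<close>.\<close>
  have G'4: "\<exists>x. G' \<theta> \<theta> = 2 * (\<Sum>i\<in>insert k I. \<theta> i * x i) - ?H (insert k I) x" for \<theta>
  proof -
    define z where "z = l \<theta> / (1 - s * a)"
    have zl: "z * (1 - s * a) = l \<theta>" using sa by (simp add: z_def)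
    obtain x where x: "G (\<lambda>i. \<theta> i + (s * z) * m i) (\<lambda>i. \<theta> i + (s * z) * m i)
        = 2 * (\<Sum>i\<in>I. (\<theta> i + (s * z) * m i) * x i) - ?H I x"
      using att by blast
    let ?x = "x(k := z)"
    have 1: "(\<Sum>i\<in>I. c i * ?x i) = (\<Sum>i\<in>I. c i * x i)" for c using kI by (intro sum.cong) auto
    have 2: "?H I ?x = ?H I x"
      using kI by (auto intro!: arg_cong2[of _ _ _ _ "(-)"] arg_cong[of _ _ "(*) s"] sum.cong)
    have 3: "(\<Sum>i\<in>I. (\<theta> i + (s * z) * m i) * x i)
        = (\<Sum>i\<in>I. \<theta> i * x i) + s * z * (\<Sum>i\<in>I. m i * x i)"
      by (simp add: sum.distrib sum_distrib_left algebra_simps)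
    have 4: "(\<Sum>i\<in>insert k I. \<theta> i * ?x i) = \<theta> k * z + (\<Sum>i\<in>I. \<theta> i * x i)"
      unfolding sum.insert[OF fin kI] 1 by simp
    have "2 * (\<Sum>i\<in>insert k I. \<theta> i * ?x i) - ?H (insert k I) ?x
      = 2 * \<theta> k * z - (1 - s * M k k) * z\<^sup>2 +
        (2 * ((\<Sum>i\<in>I. \<theta> i * x i) + s * z * (\<Sum>i\<in>I. m i * x i)) - ?H I x)"
      unfolding 4 splitH unfolding 2 unfolding 1 by (simp add: algebra_simps)
    also have "\<dots> = 2 * \<theta> k * z - (1 - s * M k k) * z\<^sup>2 + (G \<theta> \<theta> + 2 * (s * z) * G m \<theta> + (s * z)\<^sup>2 * G m m)"
      using x unfolding quad 3 by simp
    also have "\<dots> = G \<theta> \<theta> + 2 * z * l \<theta> - z * (z * (1 - s * a))"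
      unfolding a_def l_def by (simp add: power2_eq_square algebra_simps)
    also have "\<dots> = G' \<theta> \<theta>"
      unfolding zl G'_def by (simp add: z_def)
    finally show ?thesis by (intro exI[of _ ?x]) simp
  qed
  have DI: "D I / sqrt (1 - s * a) \<le> D (insert k I)"
  proof -
    have "1 / sqrt (1 - s * a) \<le> exp (s * a / (2 * \<epsilon>))"
      using a0 s pivot \<epsilon> by (intro inverse_sqrt_one_minus_le_exp) auto
    then have "D I / sqrt (1 - s * a) \<le> D I * exp (s * a / (2 * \<epsilon>))"
      using mult_left_mono[of "1 / sqrt (1 - s * a)" "exp (s * a / (2 * \<epsilon>))" "D I"]
      by (simp add: D_def)
    also have "\<dots> = exp ((s * (\<Sum>i\<in>I. M i i)
     + s\<^sup>2 / \<epsilon> * (\<Sum>i\<in>I. \<Sum>j\<in>I. (M i j)\<^sup>2) + s * a) / (2 * \<epsilon>))"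
      by (simp add: D_def exp_add[symmetric] add_divide_distrib)
    also have "\<dots> \<le> D (insert k I)"
    proof -
      \<comment> \<open>The new diagonal entry is charged to the trace and, through
        \<open>Gm\<close>, the new row to the Frobenius sum.\<close>
      have "s * a \<le> s * M k k + s\<^sup>2 / \<epsilon> * (\<Sum>i\<in>I. (m i)\<^sup>2)"
        using mult_left_mono[OF Gm, of "s\<^sup>2"] unfolding a_def
        by (simp add: power2_eq_square algebra_simps)
      moreover have "(\<Sum>i\<in>I. \<Sum>j\<in>I. (M i j)\<^sup>2) + (\<Sum>i\<in>I. (m i)\<^sup>2)
          \<le> (\<Sum>i\<in>insert k I. \<Sum>j\<in>insert k I. (M i j)\<^sup>2)"
        using kI fin by (simp add: m_def sum.distrib sum_nonneg)
      then have "s\<^sup>2 / \<epsilon> * ((\<Sum>i\<in>I. \<Sum>j\<in>I. (M i j)\<^sup>2) + (\<Sum>i\<in>I. (m i)\<^sup>2))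
          \<le> s\<^sup>2 / \<epsilon> * (\<Sum>i\<in>insert k I. \<Sum>j\<in>insert k I. (M i j)\<^sup>2)"
        using \<epsilon> by (intro mult_left_mono) auto
      moreover have "s * (\<Sum>i\<in>insert k I. M i i) = s * M k k + s * (\<Sum>i\<in>I. M i i)"
        using kI fin by (simp add: algebra_simps)
      ultimately show ?thesis
        unfolding D_def using \<epsilon> by (simp add: divide_le_cancel algebra_simps)
    qed
    finally show ?thesis .
  qed
  have bound: "(\<Sum>f\<in>PiE (insert k I) (\<lambda>_. V). ?W (insert k I) \<theta> f)
     \<le> L ^ card (insert k I) * D (insert k I) * exp (s * G' \<theta> \<theta> / 2)" for \<theta>
  proof -
    have W: "?W (insert k I) \<theta> (g(k := v)) =
       \<nu> v * exp (M k k * (y v)\<^sup>2 / 2 + \<theta> k * y v) * ?W I (\<lambda>i. \<theta> i + y v * m i) g" for g v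
    proof -
      let ?f = "g(k := v)"
      have 1: "(\<Prod>i\<in>I. \<nu> (?f i)) = (\<Prod>i\<in>I. \<nu> (g i))" using kI by (intro prod.cong) auto
      have 2: "(\<Sum>i\<in>I. c i * y (?f i)) = (\<Sum>i\<in>I. c i * y (g i))" for c
        using kI by (intro sum.cong) auto
      have 3: "(\<Sum>i\<in>I. \<Sum>j\<in>I. M i j * y (?f i) * y (?f j)) = (\<Sum>i\<in>I. \<Sum>j\<in>I. M i j * y (g i) * y (g j))"
        using kI by (intro sum.cong) auto
      have 4: "(\<Sum>i\<in>I. (\<theta> i + y v * m i) * y (g i))
          = (\<Sum>i\<in>I. \<theta> i * y (g i)) + y v * (\<Sum>i\<in>I. m i * y (g i))"
        by (simp add: sum.distrib sum_distrib_left algebra_simps)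
      have 5: "(\<Prod>i\<in>insert k I. \<nu> (?f i)) = \<nu> v * (\<Prod>i\<in>I. \<nu> (g i))"
        unfolding prod.insert[OF fin kI] 1 by simp
      have 6: "(\<Sum>i\<in>insert k I. \<theta> i * y (?f i)) = \<theta> k * y v + (\<Sum>i\<in>I. \<theta> i * y (g i))"
        unfolding sum.insert[OF fin kI] 2 by simp
      have 7: "(\<Sum>i\<in>insert k I. \<Sum>j\<in>insert k I. M i j * y (?f i) * y (?f j)) =
         M k k * (y v)\<^sup>2 + 2 * y v * (\<Sum>i\<in>I. m i * y (g i))
           + (\<Sum>i\<in>I. \<Sum>j\<in>I. M i j * y (g i) * y (g j))"
        unfolding split[of "\<lambda>i. y (?f i)"] unfolding 3 unfolding 2 by simp
      have "exp ((\<Sum>i\<in>insert k I. \<Sum>j\<in>insert k I. M i j * y (?f i) * y (?f j)) / 2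
           + (\<Sum>i\<in>insert k I. \<theta> i * y (?f i)))
         = exp (M k k * (y v)\<^sup>2 / 2 + \<theta> k * y v) *
           exp ((\<Sum>i\<in>I. \<Sum>j\<in>I. M i j * y (g i) * y (g j)) / 2
             + (\<Sum>i\<in>I. (\<theta> i + y v * m i) * y (g i)))"
        unfolding 6 7 4 mult_exp_exp by (simp add: add_divide_distrib)
      then show ?thesis unfolding 5 by (simp only: mult_ac)
    qed
    have "(\<Sum>f\<in>PiE (insert k I) (\<lambda>_. V). ?W (insert k I) \<theta> f)
      = (\<Sum>v\<in>V. \<nu> v * exp (M k k * (y v)\<^sup>2 / 2 + \<theta> k * y v)
           * (\<Sum>g\<in>PiE I (\<lambda>_. V). ?W I (\<lambda>i. \<theta> i + y v * m i) g))"
      unfolding sum_PiE_insert[OF kI] W sum_distrib_left ..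
    also have "\<dots> \<le> (\<Sum>v\<in>V. \<nu> v * exp (M k k * (y v)\<^sup>2 / 2 + \<theta> k * y v) *
        (L ^ card I * D I * exp (s * (G \<theta> \<theta> + 2 * y v * G m \<theta> + (y v)\<^sup>2 * G m m) / 2)))"
    proof (rule sum_mono)
      fix v assume "v \<in> V"
      then have "0 \<le> \<nu> v * exp (M k k * (y v)\<^sup>2 / 2 + \<theta> k * y v)" using \<nu> by simp
      from mult_left_mono[OF IH[of "\<lambda>i. \<theta> i + y v * m i", unfolded quad] this]
      show "\<nu> v * exp (M k k * (y v)\<^sup>2 / 2 + \<theta> k * y v)
           * (\<Sum>g\<in>PiE I (\<lambda>_. V). ?W I (\<lambda>i. \<theta> i + y v * m i) g)
        \<le> \<nu> v * exp (M k k * (y v)\<^sup>2 / 2 + \<theta> k * y v) *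
        (L ^ card I * D I * exp (s * (G \<theta> \<theta> + 2 * y v * G m \<theta> + (y v)\<^sup>2 * G m m) / 2))" .
    qed
    \<comment> \<open>What remains in \<open>v\<close> is a one-site sum with quadratic coefficient
      \<open>a\<close> and tilt \<open>l \<theta>\<close>, the setting of
      \<open>subgaussian_exp_square\<close>.\<close>
    also have "\<dots> = L ^ card I * D I * exp (s * G \<theta> \<theta> / 2) *
        (\<Sum>v\<in>V. \<nu> v * exp (a * (y v)\<^sup>2 / 2 + l \<theta> * y v))"
      unfolding sum_distrib_left
    proof (rule sum.cong[OF refl])
      fix v
      have "exp (M k k * (y v)\<^sup>2 / 2 + \<theta> k * y v) * exp (s * (G \<theta> \<theta> + 2 * y v * G m \<theta> + (y v)\<^sup>2 * G m m) / 2)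
         = exp (s * G \<theta> \<theta> / 2) * exp (a * (y v)\<^sup>2 / 2 + l \<theta> * y v)"
        unfolding exp_add[symmetric] a_def l_def by (simp add: algebra_simps add_divide_distrib)
      then show "\<nu> v * exp (M k k * (y v)\<^sup>2 / 2 + \<theta> k * y v) *
          (L ^ card I * D I * exp (s * (G \<theta> \<theta> + 2 * y v * G m \<theta> + (y v)\<^sup>2 * G m m) / 2))
        = L ^ card I * D I * exp (s * G \<theta> \<theta> / 2) * (\<nu> v * exp (a * (y v)\<^sup>2 / 2 + l \<theta> * y v))"
        by (simp add: mult_ac)
    qed
    also have "\<dots> \<le> L ^ card I * D I * exp (s * G \<theta> \<theta> / 2) *
        (L * exp (s * (l \<theta>)\<^sup>2 / (2 * (1 - s * a))) / sqrt (1 - s * a))"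
      using L by (intro mult_left_mono subgaussian_exp_square V sub a0 sa) (auto simp: D_def)
    also have "\<dots> = L ^ card (insert k I) * (D I / sqrt (1 - s * a)) * exp (s * G' \<theta> \<theta> / 2)"
    proof -
      have "exp (s * G' \<theta> \<theta> / 2) = exp (s * G \<theta> \<theta> / 2) * exp (s * (l \<theta>)\<^sup>2 / (2 * (1 - s * a)))"
        unfolding G'_def exp_add[symmetric] by (simp add: power2_eq_square algebra_simps add_divide_distrib)
      then show ?thesis using kI fin by simp
    qed
    also have "\<dots> \<le> L ^ card (insert k I) * D (insert k I) * exp (s * G' \<theta> \<theta> / 2)"
      using L DI by (intro mult_right_mono mult_left_mono) auto
    finally show ?thesis .
  qed
  show ?case
    by (intro exI[of _ G'] conjI allI G'1 G'2 G'3 G'4 bound[unfolded D_def])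
qed

text \<open>Removes the auxiliary form of the induction: positivity with margin
  \<open>\<epsilon>\<close> bounds \<open>G b b\<close> by the squared norm of \<open>b\<close> over
  \<open>\<epsilon>\<close>, so only a trace, a Frobenius sum and this norm remain.\<close>

lemma subgaussian_quadratic_form:
  fixes \<nu> y :: "'a \<Rightarrow> real" and M :: "'i \<Rightarrow> 'i \<Rightarrow> real"
  assumes I: "finite I" and V: "finite V" and \<nu>: "\<And>v. v \<in> V \<Longrightarrow> 0 \<le> \<nu> v"
    and sub: "\<And>\<theta>. (\<Sum>v\<in>V. \<nu> v * exp (\<theta> * y v)) \<le> L * exp (s * \<theta>\<^sup>2 / 2)"
    and s: "0 \<le> s" and \<epsilon>: "0 < \<epsilon>"
    and sym: "\<And>i j. i \<in> I \<Longrightarrow> j \<in> I \<Longrightarrow> M i j = M j i"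
    and diag: "\<And>i. i \<in> I \<Longrightarrow> 0 \<le> M i i"
    and pos: "\<And>x. s * (\<Sum>i\<in>I. \<Sum>j\<in>I. M i j * x i * x j) \<le> (1 - \<epsilon>) * (\<Sum>i\<in>I. (x i)\<^sup>2)"
  shows "(\<Sum>f\<in>PiE I (\<lambda>_. V). (\<Prod>i\<in>I. \<nu> (f i)) *
          exp ((\<Sum>i\<in>I. \<Sum>j\<in>I. M i j * y (f i) * y (f j)) / 2 + (\<Sum>i\<in>I. b i * y (f i))))
        \<le> L ^ card I * exp ((s * (\<Sum>i\<in>I. M i i) + s\<^sup>2 / \<epsilon> * (\<Sum>i\<in>I. \<Sum>j\<in>I. (M i j)\<^sup>2)
             + s * (\<Sum>i\<in>I. (b i)\<^sup>2)) / (2 * \<epsilon>))"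
    (is "?lhs \<le> _")
proof -
  have pos': "\<epsilon> * (\<Sum>i\<in>I. (x i)\<^sup>2)
      \<le> (\<Sum>i\<in>I. (x i)\<^sup>2) - s * (\<Sum>i\<in>I. \<Sum>j\<in>I. M i j * x i * x j)" for x
    using pos[of x] by (simp add: algebra_simps)
  have L: "0 \<le> L" by (rule subgaussian_factor_nonneg[OF _ sub]) (use \<nu> in auto)
  have "\<forall>v\<in>V. 0 \<le> \<nu> v" "\<forall>i\<in>I. \<forall>j\<in>I. M i j = M j i" "\<forall>i\<in>I. 0 \<le> M i i"
    using \<nu> sym diag by auto
  from subgaussian_quadratic_form_step[OF I V this(1) sub s \<epsilon> this(2,3) pos'] show ?thesis
  proof (elim exE conjE)
    fix G :: "('i \<Rightarrow> real) \<Rightarrow> ('i \<Rightarrow> real) \<Rightarrow> real"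
    assume att: "\<forall>\<theta>. \<exists>x. G \<theta> \<theta> = 2 * (\<Sum>i\<in>I. \<theta> i * x i)
         - ((\<Sum>i\<in>I. (x i)\<^sup>2) - s * (\<Sum>i\<in>I. \<Sum>j\<in>I. M i j * x i * x j))"
      and bd: "\<forall>\<theta>. (\<Sum>f\<in>PiE I (\<lambda>_. V). (\<Prod>i\<in>I. \<nu> (f i)) *
          exp ((\<Sum>i\<in>I. \<Sum>j\<in>I. M i j * y (f i) * y (f j)) / 2 + (\<Sum>i\<in>I. \<theta> i * y (f i))))
        \<le> L ^ card I
          * exp ((s * (\<Sum>i\<in>I. M i i) + s\<^sup>2 / \<epsilon> * (\<Sum>i\<in>I. \<Sum>j\<in>I. (M i j)\<^sup>2)) / (2 * \<epsilon>))
          * exp (s * G \<theta> \<theta> / 2)"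
  obtain x where x: "G b b = 2 * (\<Sum>i\<in>I. b i * x i)
         - ((\<Sum>i\<in>I. (x i)\<^sup>2) - s * (\<Sum>i\<in>I. \<Sum>j\<in>I. M i j * x i * x j))"
    using att[rule_format, of b] ..
  have "G b b \<le> 2 * (\<Sum>i\<in>I. b i * x i) - \<epsilon> * (\<Sum>i\<in>I. (x i)\<^sup>2)"
    using x pos'[of x] by linarith
  also note complete_square_sum_le[OF \<epsilon>]
  finally have Gb: "G b b \<le> (\<Sum>i\<in>I. (b i)\<^sup>2) / \<epsilon>" .
  have "s * G b b / 2 \<le> s * (\<Sum>i\<in>I. (b i)\<^sup>2) / (2 * \<epsilon>)"
    using mult_left_mono[OF Gb s] by simp
  then have "exp (s * G b b / 2) \<le> exp (s * (\<Sum>i\<in>I. (b i)\<^sup>2) / (2 * \<epsilon>))" by simp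
  from mult_left_mono[OF this] L
  have "L ^ card I
          * exp ((s * (\<Sum>i\<in>I. M i i) + s\<^sup>2 / \<epsilon> * (\<Sum>i\<in>I. \<Sum>j\<in>I. (M i j)\<^sup>2)) / (2 * \<epsilon>))
          * exp (s * G b b / 2)
      \<le> L ^ card I
          * exp ((s * (\<Sum>i\<in>I. M i i) + s\<^sup>2 / \<epsilon> * (\<Sum>i\<in>I. \<Sum>j\<in>I. (M i j)\<^sup>2)) / (2 * \<epsilon>))
          * exp (s * (\<Sum>i\<in>I. (b i)\<^sup>2) / (2 * \<epsilon>))" by simp
  from order.trans[OF bd[rule_format, of b] this]
  show ?thesis by (simp add: exp_add[symmetric] add_divide_distrib mult.assoc)
  qed
qed

section \<open>The mean-field free energy\<close>

text \<open>The derivative is \<open>- k x / x\<^sup>2\<close>, and \<open>k\<close> is positive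
  because it vanishes at 0 and has derivative
  \<open>2 * x * tanh x * (1 - (tanh x)\<^sup>2)\<close>. Uniqueness of the mean-field roots and
  monotonicity of the variance proxy both come from this strict decrease.\<close>

lemma tanh_div_self_strict_antimono:
  fixes a b :: real
  assumes "0 < a" "a < b"
  shows "tanh b / b < tanh a / a"
proof -
  define k where "k = (\<lambda>x::real. tanh x - x * (1 - (tanh x)\<^sup>2))"
  have k: "0 < k x" if "0 < x" for x
  proof -
    have "k 0 < k x"
    proof (rule DERIV_pos_imp_increasing_open[OF that])
      fix y :: real assume y: "0 < y" "y < x"
      have "(k has_real_derivative y * (2 * tanh y * (1 - (tanh y)\<^sup>2))) (at y)"
        unfolding k_def by (auto intro!: derivative_eq_intros simp: power2_eq_square algebra_simps)
      moreover have "(tanh y)\<^sup>2 < 1"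
        using tanh_real_abs[of y] tanh_real_lt_1[of "\<bar>y\<bar>"] by (simp add: abs_square_less_1)
      ultimately show "\<exists>d. (k has_real_derivative d) (at y) \<and> 0 < d" using y by force
    next
      show "continuous_on {0..x} k" unfolding k_def by (auto intro!: continuous_intros)
    qed
    then show ?thesis by (simp add: k_def)
  qed
  show ?thesis
  proof (rule DERIV_neg_imp_decreasing_open[OF \<open>a < b\<close>, of "\<lambda>x. tanh x / x"])
    fix y assume y: "a < y" "y < b"
    then have "((\<lambda>x. tanh x / x) has_real_derivative (- k y / y\<^sup>2)) (at y)"
      unfolding k_def using assms
      by (auto intro!: derivative_eq_intros simp: power2_eq_square field_simps)
    moreover have "- k y / y\<^sup>2 < 0" using k[of y] y assms by simp
    ultimately show "\<exists>d. ((\<lambda>x. tanh x / x) has_real_derivative d) (at y) \<and> d < 0" by blast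
  next
    show "continuous_on {a..b} (\<lambda>x. tanh x / x)"
      using assms by (auto intro!: continuous_intros)
  qed
qed

lemma tanh_div_self_antimono:
  fixes a b :: real
  assumes "0 < a" "a \<le> b"
  shows "tanh b / b \<le> tanh a / a"
  using tanh_div_self_strict_antimono[of a b] assms by (cases "a = b") auto

lemma tanh_diff_le:
  fixes x y :: real
  shows "\<bar>tanh x - tanh y\<bar> \<le> \<bar>x - y\<bar>"
proof -
  have *: "tanh b - tanh a \<le> b - a" if "a \<le> b" for a b :: real
  proof -
    have "tanh b - b \<le> tanh a - a"
    proof (rule DERIV_nonpos_imp_nonincreasing[OF that])
      fix y :: real
      show "\<exists>d. ((\<lambda>x. tanh x - x) has_real_derivative d) (at y) \<and> d \<le> 0"
        by (rule exI[of _ "- (tanh y)\<^sup>2"]) (auto intro!: derivative_eq_intros)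
    qed
    then show ?thesis by simp
  qed
  show ?thesis
  proof (cases "x \<le> y")
    case True
    then show ?thesis using *[OF True] by simp
  next
    case False
    then show ?thesis using *[of y x] by simp
  qed
qed

lemma tanh_le_self:
  fixes x :: real
  assumes "0 \<le> x"
  shows "tanh x \<le> x"
  using tanh_diff_le[of x 0] assms by simp

text \<open>The slope at \<open>p\<^sup>2\<close> of \<open>2 ln (cosh \<theta>)\<close> as a concave function of \<open>\<theta>\<^sup>2\<close>.\<close>

definition tangent_slope :: "real \<Rightarrow> real" where
  "tangent_slope p = (if p = 0 then 1 else tanh p / p)"

lemma tangent_slope_mult [simp]: "tangent_slope p * p = tanh p"
  by (simp add: tangent_slope_def)

lemma tangent_slope_minus [simp]: "tangent_slope (- p) = tangent_slope p"
  by (simp add: tangent_slope_def)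

lemma tangent_slope_le_1: "0 \<le> p \<Longrightarrow> tangent_slope p \<le> 1"
  using tanh_le_self[of p] by (auto simp: tangent_slope_def)

lemma tangent_slope_pos: "0 \<le> p \<Longrightarrow> 0 < tangent_slope p"
  by (auto simp: tangent_slope_def)

lemma tangent_slope_antimono:
  assumes "0 \<le> a" "a \<le> b"
  shows "tangent_slope b \<le> tangent_slope a"
  using assms tanh_div_self_antimono[of a b] tangent_slope_le_1[of b]
  by (cases "a = 0") (auto simp: tangent_slope_def)

lemma ln_cosh_has_real_derivative [derivative_intros]:
  "((\<lambda>x. ln (cosh x)) has_real_derivative tanh x) (at (x::real))"
  by (auto intro!: derivative_eq_intros simp: tanh_def)

lemma ln_cosh_le_tangent:
  fixes \<theta> p :: real
  assumes p: "0 \<le> p"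
  shows "ln (cosh \<theta>) \<le> ln (cosh p) + tangent_slope p * (\<theta>\<^sup>2 - p\<^sup>2) / 2"
proof -
  define g where "g = (\<lambda>x. ln (cosh x) - tangent_slope p * x\<^sup>2 / 2)"
  have d: "(g has_real_derivative tanh x - tangent_slope p * x) (at x)" for x
    unfolding g_def by (auto intro!: derivative_eq_intros)
  have slope: "tanh x - tangent_slope p * x = (tangent_slope x - tangent_slope p) * x" for x
    using tangent_slope_mult[of x] by (simp add: algebra_simps)
  have "g x \<le> g p" if x: "0 \<le> x" for x
  proof (cases "x \<le> p")
    case True
    show ?thesis
    proof (rule DERIV_nonneg_imp_nondecreasing[OF True])
      fix z assume z: "x \<le> z" "z \<le> p"
      then have "0 \<le> (tangent_slope z - tangent_slope p) * z"
        using tangent_slope_antimono[of z p] x by simp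
      then show "\<exists>d. (g has_real_derivative d) (at z) \<and> 0 \<le> d"
        using d[of z] unfolding slope by blast
    qed
  next
    case False
    then have "p \<le> x" by simp
    then show ?thesis
    proof (rule DERIV_nonpos_imp_nonincreasing)
      fix z assume z: "p \<le> z" "z \<le> x"
      then have "(tangent_slope z - tangent_slope p) * z \<le> 0"
        using tangent_slope_antimono[of p z] p by (simp add: mult_nonpos_nonneg)
      then show "\<exists>d. (g has_real_derivative d) (at z) \<and> d \<le> 0"
        using d[of z] unfolding slope by blast
    qed
  qed
  from this[of "\<bar>\<theta>\<bar>"] show ?thesis
    by (simp add: g_def algebra_simps diff_divide_distrib)
qed

text \<open>Supplies the one-site hypothesis \<open>sub\<close>. The centre
  \<open>tangent_slope p * h\<close> is the one that cancels the terms linear in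
  \<open>\<theta>\<close> in the expansion of \<open>(h + \<theta>)\<^sup>2\<close>. For
  \<open>p = \<bar>h\<bar>\<close> it is the mean \<open>tanh h\<close> and the prefactor is
  \<open>2 * cosh h\<close>; for other \<open>p\<close> the prefactor is at least as large.\<close>

lemma spin_exp_sum_le:
  fixes h p \<theta> :: real
  assumes p: "0 \<le> p"
  shows "(\<Sum>v\<in>{-1, 1}. exp (h * v) * exp (\<theta> * (v - tangent_slope p * h)))
    \<le> 2 * exp (ln (cosh p) + tangent_slope p * (h\<^sup>2 - p\<^sup>2) / 2) * exp (tangent_slope p * \<theta>\<^sup>2 / 2)"
proof -
  let ?s = "tangent_slope p"
  have "(\<Sum>v\<in>{-1, 1::real}. exp (h * v) * exp (\<theta> * (v - ?s * h)))
     = 2 * (cosh (h + \<theta>) * exp (- (\<theta> * ?s * h)))"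
    by (simp add: cosh_def mult_exp_exp exp_add[symmetric] algebra_simps)
  also have "cosh (h + \<theta>) = exp (ln (cosh (h + \<theta>)))" by simp
  also have "2 * (\<dots> * exp (- (\<theta> * ?s * h))) = 2 * exp (ln (cosh (h + \<theta>)) - \<theta> * ?s * h)"
    by (simp only: mult_exp_exp diff_conv_add_uminus mult.assoc)
  also have "\<dots> \<le> 2 * exp (ln (cosh p) + ?s * ((h + \<theta>)\<^sup>2 - p\<^sup>2) / 2 - \<theta> * ?s * h)"
    using ln_cosh_le_tangent[OF p, of "h + \<theta>"] by simp
  also have "\<dots> = 2 * exp (ln (cosh p) + ?s * (h\<^sup>2 - p\<^sup>2) / 2) * exp (?s * \<theta>\<^sup>2 / 2)"
    by (simp add: mult_exp_exp power2_eq_square algebra_simps add_divide_distrib diff_divide_distrib)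
  finally show ?thesis .
qed

section \<open>Solutions of the mean-field equation\<close>

text \<open>Existence by the intermediate value theorem on [0, 1]. For uniqueness put
  \<open>u = \<beta> * x + B\<close>: at a root \<open>tanh u / u\<close> equals
  \<open>x / u\<close>, and with growing \<open>x\<close> the former strictly decreases while the
  latter increases because \<open>B > 0\<close>.\<close>

lemma mf_root_Theta12_pos:
  fixes \<beta> B :: real
  assumes \<beta>: "0 < \<beta>" and B: "0 < B"
  shows "\<exists>!x. x = tanh (\<beta> * x + B) \<and> 0 < x"
proof (rule ex_ex1I)
  have "\<exists>x\<ge>0. x \<le> 1 \<and> x - tanh (\<beta> * x + B) = 0"
  proof (rule IVT')
    show "0 - tanh (\<beta> * 0 + B) \<le> 0" using B by simp
    show "0 \<le> 1 - tanh (\<beta> * 1 + B)" using tanh_real_lt_1[of "\<beta> * 1 + B"] by simp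
    show "continuous_on {0..1} (\<lambda>x. x - tanh (\<beta> * x + B))" by (auto intro!: continuous_intros)
  qed auto
  then obtain x where x: "0 \<le> x" "x = tanh (\<beta> * x + B)" by auto
  moreover have "x \<noteq> 0" using x B by auto
  ultimately show "\<exists>x. x = tanh (\<beta> * x + B) \<and> 0 < x" by (intro exI[of _ x]) auto
next
  have less: False if "x < y" and x: "x = tanh (\<beta> * x + B)" "0 < x" and y: "y = tanh (\<beta> * y + B)" "0 < y"
    for x y
  proof -
    have "y / (\<beta> * y + B) < x / (\<beta> * x + B)"
      using tanh_div_self_strict_antimono[of "\<beta> * x + B" "\<beta> * y + B"] that \<beta> B by (auto simp: add_pos_pos)
    moreover have "x / (\<beta> * x + B) \<le> y / (\<beta> * y + B)"
      using that \<beta> B by (simp add: divide_simps add_pos_pos algebra_simps)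
    ultimately show False by simp
  qed
  show "x = y" if "x = tanh (\<beta> * x + B) \<and> 0 < x" "y = tanh (\<beta> * y + B) \<and> 0 < y" for x y
    using less[of x y] less[of y x] that by (cases x y rule: linorder_cases) auto
qed

lemma mf_root_Theta2_ex1:
  fixes \<beta> :: real
  assumes \<beta>: "1 < \<beta>"
  shows "\<exists>!x. 0 < x \<and> x = tanh (\<beta> * x)"
proof (rule ex_ex1I)
  \<comment> \<open>0 is itself a root, so the intermediate value theorem has to start at a point
    \<open>a > 0\<close> where the curve lies above the diagonal; the slope
    \<open>\<beta> - 1 > 0\<close> at 0 provides one.\<close>
  have "((\<lambda>x. tanh (\<beta> * x) - x) has_real_derivative (\<beta> - 1)) (at 0)"
    by (auto intro!: derivative_eq_intros)
  from DERIV_pos_inc_right[OF this] \<beta> obtain d where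
    d: "0 < d" "\<And>h. 0 < h \<Longrightarrow> h < d \<Longrightarrow> 0 < tanh (\<beta> * h) - h" by fastforce
  define a where "a = min (d / 2) 1"
  have a: "0 < a" "a < d" "a \<le> 1" using d by (auto simp: a_def)
  have "\<exists>x\<ge>a. x \<le> 1 \<and> x - tanh (\<beta> * x) = 0"
  proof (rule IVT')
    show "a - tanh (\<beta> * a) \<le> 0" using d(2)[of a] a by simp
    show "0 \<le> 1 - tanh (\<beta> * 1)" using tanh_real_lt_1[of "\<beta> * 1"] by simp
    show "continuous_on {a..1} (\<lambda>x. x - tanh (\<beta> * x))" by (auto intro!: continuous_intros)
  qed (use a in auto)
  then obtain x where "a \<le> x" "x - tanh (\<beta> * x) = 0" by blast
  then show "\<exists>x. 0 < x \<and> x = tanh (\<beta> * x)" using a by (intro exI[of _ x]) auto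
next
  have less: False if "x < y" and x: "0 < x" "x = tanh (\<beta> * x)" and y: "0 < y" "y = tanh (\<beta> * y)"
    for x y
  proof -
    have "tanh (\<beta> * y) / (\<beta> * y) < tanh (\<beta> * x) / (\<beta> * x)"
      using tanh_div_self_strict_antimono[of "\<beta> * x" "\<beta> * y"] that \<beta> by auto
    then have "y / (\<beta> * y) < x / (\<beta> * x)"
      unfolding x(2)[symmetric] y(2)[symmetric] .
    then show False using x y \<beta> by simp
  qed
  show "x = y" if "0 < x \<and> x = tanh (\<beta> * x)" "0 < y \<and> y = tanh (\<beta> * y)" for x y
    using less[of x y] less[of y x] that by (cases x y rule: linorder_cases) auto
qed

lemma mf_root_Theta2:
  assumes "(\<beta>, B) \<in> Theta2"
  shows "0 < mf_root \<beta> B" "mf_root \<beta> B = tanh (\<beta> * mf_root \<beta> B)"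
proof -
  have \<beta>: "1 < \<beta>" and eq: "mf_root \<beta> B = (THE x. 0 < x \<and> x = tanh (\<beta> * x))"
    using assms by (auto simp: mf_root_def Theta2_def Theta11_def Theta12_def Theta3_def)
  note tt = theI'[OF mf_root_Theta2_ex1[OF \<beta>], folded eq]
  show "0 < mf_root \<beta> B" by (rule tt[THEN conjunct1])
  show "mf_root \<beta> B = tanh (\<beta> * mf_root \<beta> B)" by (rule tt[THEN conjunct2])
qed

text \<open>The last conclusion is the spectral condition of the subcritical regime. In a nonzero
  field the root has the sign of \<open>B\<close>, so
  \<open>\<bar>h\<bar> = \<beta> * \<bar>t\<bar> + \<bar>B\<bar>\<close> exceeds
  \<open>\<beta> * \<bar>t\<bar>\<close>, while \<open>tanh \<bar>h\<bar> = \<bar>t\<bar>\<close>;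
  in zero field \<open>h = 0\<close> and the condition reads \<open>\<beta> < 1\<close>.\<close>

lemma mf_root_Theta1:
  assumes "(\<beta>, B) \<in> Theta1"
  defines "h \<equiv> \<beta> * mf_root \<beta> B + B"
  shows "0 < \<beta>" "mf_root \<beta> B = tanh h" "\<beta> * tangent_slope \<bar>h\<bar> < 1"
proof -
  let ?t = "mf_root \<beta> B"
  show \<beta>: "0 < \<beta>" using assms(1) by (auto simp: Theta1_def Theta11_def Theta12_def)
  have "?t = tanh h \<and> \<beta> * tangent_slope \<bar>h\<bar> < 1"
  proof (cases "(\<beta>, B) \<in> Theta11")
    case True
    then show ?thesis by (auto simp: mf_root_def h_def Theta11_def tangent_slope_def)
  next
    case False
    then have B: "B \<noteq> 0" using assms(1) by (auto simp: Theta1_def Theta12_def)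
    then have t: "?t = (THE x. x = tanh (\<beta> * x + B) \<and> sgn x = sgn B)"
      using \<beta> by (auto simp: mf_root_def Theta11_def Theta12_def Theta3_def)
    have "\<exists>!x. x = tanh (\<beta> * x + B) \<and> sgn x = sgn B"
    proof (cases "0 < B")
      case True
      then show ?thesis using mf_root_Theta12_pos[OF \<beta> True] by (simp add: sgn_1_pos)
    next
      case False
      then have B': "0 < - B" using B by simp
      \<comment> \<open>The reflection of \<open>x\<close> to \<open>- x\<close> turns a negative
        field into a positive one.\<close>
      have eq: "(x = tanh (\<beta> * x + B) \<and> sgn x = sgn B)
         \<longleftrightarrow> (- x = tanh (\<beta> * (- x) + - B) \<and> 0 < - x)" for x
      proof -
        have "tanh (\<beta> * (- x) + - B) = - tanh (\<beta> * x + B)"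
          using tanh_minus[of "\<beta> * x + B"] by simp
        then show ?thesis using B' by (simp add: sgn_1_neg)
      qed
      from mf_root_Theta12_pos[OF \<beta> B'] obtain z where
        z: "z = tanh (\<beta> * z + - B)" "0 < z" "\<And>z'. z' = tanh (\<beta> * z' + - B) \<and> 0 < z' \<Longrightarrow> z' = z"
        by blast
      show ?thesis
        unfolding eq
      proof (rule ex1I[of _ "- z"])
        show "- (- z) = tanh (\<beta> * (- (- z)) + - B) \<and> 0 < - (- z)"
          unfolding minus_minus using z(1,2) by blast
        show "x = - z" if "- x = tanh (\<beta> * (- x) + - B) \<and> 0 < - x" for x
          using z(3)[OF that] by simp
      qed
    qed
    note tt = theI'[OF this, folded t]
    have t1: "?t = tanh h" unfolding h_def by (rule tt[THEN conjunct1])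
    have t2: "sgn ?t = sgn B" by (rule tt[THEN conjunct2])
    have ht: "\<bar>h\<bar> = \<beta> * \<bar>?t\<bar> + \<bar>B\<bar>" "\<bar>?t\<bar> > 0"
    proof -
      have "(0 < B \<and> 0 < ?t) \<or> (B < 0 \<and> ?t < 0)"
        using t2 B by (auto simp: sgn_if split: if_splits)
      then show "\<bar>h\<bar> = \<beta> * \<bar>?t\<bar> + \<bar>B\<bar>" "\<bar>?t\<bar> > 0"
        using \<beta> mult_pos_neg[of \<beta> ?t] mult_pos_pos[of \<beta> ?t] unfolding h_def by auto
    qed
    have "0 \<le> \<beta> * \<bar>?t\<bar>" "0 < \<bar>B\<bar>" using B \<beta> by simp_all
    then have h: "0 < \<bar>h\<bar>" "\<beta> * \<bar>?t\<bar> < \<bar>h\<bar>" using ht by linarith+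
    have "\<bar>?t\<bar> = tanh \<bar>h\<bar>" unfolding t1 by simp
    then have "\<beta> * tangent_slope \<bar>h\<bar> = \<beta> * \<bar>?t\<bar> / \<bar>h\<bar>"
      using h(1) by (simp add: tangent_slope_def)
    also have "\<dots> < 1" using h by (simp only: divide_less_eq_1_pos)
    finally show ?thesis using t1 by blast
  qed
  then show "?t = tanh h" "\<beta> * tangent_slope \<bar>h\<bar> < 1" by auto
qed

section \<open>Decay of the mean-field free energy away from its maximum\<close>

text \<open>On [0, 1] the ratio \<open>tanh w / w\<close> is at least \<open>tanh 1\<close>, so the
  derivative of \<open>tanh\<close> is at most \<open>1 - k * w\<^sup>2\<close>. Two integrations
  give the factors 1/3 and 1/12.\<close>

lemma ln_cosh_quartic_bound:
  "\<exists>c>0. \<forall>w\<in>{0..1::real}. ln (cosh w) - w\<^sup>2 / 2 \<le> - c * w ^ 4"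
proof -
  define k where "k = (tanh (1::real))\<^sup>2"
  have k: "0 < k" by (simp add: k_def)
  have tanh_sq: "k * w\<^sup>2 \<le> (tanh w)\<^sup>2" if w: "0 \<le> w" "w \<le> 1" for w :: real
  proof (cases "w = 0")
    case False
    then have "tanh 1 / 1 \<le> tanh w / w" using w by (intro tanh_div_self_antimono) auto
    then have "tanh 1 * w \<le> tanh w" using False w by (simp add: field_simps)
    then have "(tanh 1 * w)\<^sup>2 \<le> (tanh w)\<^sup>2" using w by (intro power_mono) auto
    then show ?thesis by (simp add: k_def power_mult_distrib)
  qed simp
  have cubic: "tanh w - w + k * w ^ 3 / 3 \<le> 0" if w: "0 \<le> w" "w \<le> 1" for w :: real
  proof -
    have "tanh w - w + k * w ^ 3 / 3 \<le> tanh 0 - 0 + k * 0 ^ 3 / 3"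
    proof (rule DERIV_nonpos_imp_nonincreasing[OF w(1), of "\<lambda>w. tanh w - w + k * w ^ 3 / 3"])
      fix x assume x: "0 \<le> x" "x \<le> w"
      have "((\<lambda>w. tanh w - w + k * w ^ 3 / 3) has_real_derivative k * x\<^sup>2 - (tanh x)\<^sup>2) (at x)"
        by (auto intro!: derivative_eq_intros)
      then show "\<exists>d. ((\<lambda>w. tanh w - w + k * w ^ 3 / 3) has_real_derivative d) (at x) \<and> d \<le> 0"
        using tanh_sq[of x] x w by (intro exI[of _ "k * x\<^sup>2 - (tanh x)\<^sup>2"]) auto
    qed
    then show ?thesis by simp
  qed
  have "ln (cosh w) - w\<^sup>2 / 2 \<le> - (k / 12) * w ^ 4" if w: "0 \<le> w" "w \<le> 1" for w :: real
  proof -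
    have "ln (cosh w) - w\<^sup>2 / 2 + k * w ^ 4 / 12 \<le> ln (cosh 0) - 0\<^sup>2 / 2 + k * 0 ^ 4 / 12"
    proof (rule DERIV_nonpos_imp_nonincreasing[OF w(1), of "\<lambda>w. ln (cosh w) - w\<^sup>2 / 2 + k * w ^ 4 / 12"])
      fix x assume x: "0 \<le> x" "x \<le> w"
      have "((\<lambda>w. ln (cosh w) - w\<^sup>2 / 2 + k * w ^ 4 / 12) has_real_derivative
          tanh x - x + k * x ^ 3 / 3) (at x)"
        by (auto intro!: derivative_eq_intros)
      then show "\<exists>d. ((\<lambda>w. ln (cosh w) - w\<^sup>2 / 2 + k * w ^ 4 / 12) has_real_derivative d) (at x) \<and> d \<le> 0"
        using cubic[of x] x w by (intro exI[of _ "tanh x - x + k * x ^ 3 / 3"]) auto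
    qed
    then show ?thesis by simp
  qed
  then show ?thesis using k by (intro exI[of _ "k / 12"]) auto
qed

text \<open>\<open>\<iota>\<close> is the relative distance from \<open>t\<close> down to the cutoff
  \<open>q\<^sub>0\<close>, below which the contact point of the tangent is frozen. It is later tied
  to the spectral gap, since the bound \<open>\<beta> * slope w \<le> 1 / (1 - \<iota>)\<close> must
  not use up that gap.\<close>

locale ferromagnetic_root =
  fixes \<beta> t \<iota> :: real
  assumes \<beta>: "1 < \<beta>" and t: "0 < t" "t = tanh (\<beta> * t)" and \<iota>: "0 < \<iota>" "\<iota> < 1"
begin

definition q\<^sub>0 :: real where "q\<^sub>0 = (1 - \<iota>) * t"

definition slope :: "real \<Rightarrow> real" where "slope w = tangent_slope (\<beta> * max w q\<^sub>0)"

definition center :: "real \<Rightarrow> real" where "center w = slope w * (\<beta> * w)"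

text \<open>Exponent per site, without \<open>ln 2\<close>, of the contribution of the grid point
  \<open>w\<close>. From \<open>q\<^sub>0\<close> on it is the classical
  \<open>ln (cosh (\<beta> * w)) - \<beta> * w\<^sup>2 / 2\<close>; below \<open>q\<^sub>0\<close>
  the logarithm is replaced by its tangent bound at \<open>\<beta> * q\<^sub>0\<close>.\<close>

definition free_energy :: "real \<Rightarrow> real" where
  "free_energy w = ln (cosh (\<beta> * max w q\<^sub>0)) + slope w * ((\<beta> * w)\<^sup>2 - (\<beta> * max w q\<^sub>0)\<^sup>2) / 2
     - \<beta> * w\<^sup>2 / 2"

lemma q\<^sub>0: "0 < q\<^sub>0" "q\<^sub>0 < t" "t - q\<^sub>0 = \<iota> * t"
  using t(1) \<iota> by (auto simp: q\<^sub>0_def algebra_simps)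

lemma t_less_1: "t < 1"
  using tanh_real_lt_1[of "\<beta> * t"] t(2) by linarith

lemma tanh_q\<^sub>0: "q\<^sub>0 < tanh (\<beta> * q\<^sub>0)"
proof -
  have "tanh (\<beta> * t) / (\<beta> * t) < tanh (\<beta> * q\<^sub>0) / (\<beta> * q\<^sub>0)"
    using q\<^sub>0 \<beta> by (intro tanh_div_self_strict_antimono) auto
  then have "1 / \<beta> < tanh (\<beta> * q\<^sub>0) / (\<beta> * q\<^sub>0)"
    unfolding t(2)[symmetric] using t(1) by simp
  then show ?thesis using \<beta> q\<^sub>0(1) by (simp add: field_simps)
qed

lemma slope_eq: "slope w = tanh (\<beta> * max w q\<^sub>0) / (\<beta> * max w q\<^sub>0)"
proof -
  have "0 < \<beta> * max w q\<^sub>0" using q\<^sub>0(1) \<beta> by simp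
  then show ?thesis by (auto simp: slope_def tangent_slope_def)
qed

lemma slope_le: "\<beta> * slope w \<le> 1 / (1 - \<iota>)"
proof -
  have "slope w \<le> tanh (\<beta> * q\<^sub>0) / (\<beta> * q\<^sub>0)"
    unfolding slope_eq using q\<^sub>0(1) \<beta> by (intro tanh_div_self_antimono) auto
  also have "\<dots> \<le> tanh (\<beta> * t) / (\<beta> * q\<^sub>0)"
    using q\<^sub>0 \<beta> by (intro divide_right_mono) auto
  also have "tanh (\<beta> * t) = t" using t(2) by simp
  finally have "\<beta> * slope w \<le> \<beta> * (t / (\<beta> * q\<^sub>0))" using \<beta> by (intro mult_left_mono) auto
  also have "\<dots> = 1 / (1 - \<iota>)" using \<beta> t(1) by (simp add: q\<^sub>0_def)
  finally show ?thesis .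
qed

lemma center_bounds:
  assumes "0 \<le> w"
  shows "0 \<le> center w" "center w \<le> 1"
proof -
  have m: "0 < max w q\<^sub>0" using q\<^sub>0(1) by simp
  have eq: "center w = tanh (\<beta> * max w q\<^sub>0) * (w / max w q\<^sub>0)"
    unfolding center_def slope_eq using \<beta> m by simp
  show "0 \<le> center w" unfolding eq using assms \<beta> m by simp
  have "w / max w q\<^sub>0 \<le> 1" "0 \<le> w / max w q\<^sub>0" using m assms by (auto simp: divide_le_eq_1)
  moreover have "tanh (\<beta> * max w q\<^sub>0) \<le> 1" "0 \<le> tanh (\<beta> * max w q\<^sub>0)"
    using tanh_real_lt_1[of "\<beta> * max w q\<^sub>0"] \<beta> m by auto
  ultimately show "center w \<le> 1" unfolding eq by (intro mult_le_one) auto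
qed

text \<open>Above the cutoff the centre is \<open>tanh (\<beta> * w)\<close>, which has Lipschitz
  constant \<open>\<beta>\<close> and fixes \<open>t\<close>. Below it
  \<open>\<bar>w - t\<bar>\<close> is at least \<open>\<iota> * t\<close>, and as
  \<open>center w\<close> and \<open>t\<close> both lie in [0, 1] the trivial bound 1
  suffices.\<close>

lemma center_diff_le:
  assumes w: "0 \<le> w"
  shows "\<bar>center w - t\<bar> \<le> max \<beta> (1 / (\<iota> * t)) * \<bar>w - t\<bar>"
proof (cases "q\<^sub>0 \<le> w")
  case True
  then have "center w = tanh (\<beta> * w)"
    unfolding center_def slope_eq using q\<^sub>0(1) \<beta> by simp
  then have "\<bar>center w - t\<bar> = \<bar>tanh (\<beta> * w) - tanh (\<beta> * t)\<bar>" using t(2) by simp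
  also have "\<dots> \<le> \<bar>\<beta> * w - \<beta> * t\<bar>" by (rule tanh_diff_le)
  also have "\<dots> = \<beta> * \<bar>w - t\<bar>" using \<beta> by (simp add: abs_mult right_diff_distrib[symmetric])
  also have "\<dots> \<le> max \<beta> (1 / (\<iota> * t)) * \<bar>w - t\<bar>" by (intro mult_right_mono) auto
  finally show ?thesis .
next
  case False
  then have "\<iota> * t \<le> \<bar>w - t\<bar>" using q\<^sub>0 by simp
  then have "1 \<le> 1 / (\<iota> * t) * \<bar>w - t\<bar>" using \<iota> t(1) by (simp add: field_simps)
  also have "\<dots> \<le> max \<beta> (1 / (\<iota> * t)) * \<bar>w - t\<bar>" by (intro mult_right_mono) auto
  finally show ?thesis using center_bounds[OF w] t(1) t_less_1 by auto
qed

text \<open>Convexity of \<open>F\<close> replaces a second-derivative estimate at \<open>t\<close>: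
  the line through the graph points at \<open>q\<^sub>0\<close> and \<open>t\<close> lies above
  \<open>F\<close> between them and below \<open>F\<close> beyond \<open>t\<close>. Since
  \<open>\<phi>\<close> has derivative \<open>- \<beta> * F\<close>, integrating this gives the
  quadratic maximum.\<close>

lemma free_energy_le:
  "\<exists>c>0. \<forall>w\<in>{0..1}. free_energy w \<le> ln (cosh (\<beta> * t)) - \<beta> * t\<^sup>2 / 2 - c * (w - t)\<^sup>2"
proof -
  define F where "F = (\<lambda>w. w - tanh (\<beta> * w))"
  have convF: "convex_on {0..} F"
  proof (rule convex_on_realI)
    show "connected {0::real..}" by simp
    show "(F has_real_derivative 1 - \<beta> * (1 - (tanh (\<beta> * x))\<^sup>2)) (at x)" for x
      unfolding F_def by (auto intro!: derivative_eq_intros)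
    show "1 - \<beta> * (1 - (tanh (\<beta> * x))\<^sup>2) \<le> 1 - \<beta> * (1 - (tanh (\<beta> * y))\<^sup>2)"
      if "x \<in> {0..}" "y \<in> {0..}" "x \<le> y" for x y
    proof -
      have "(tanh (\<beta> * x))\<^sup>2 \<le> (tanh (\<beta> * y))\<^sup>2" using that \<beta> by (intro power_mono) auto
      then show ?thesis using \<beta> by simp
    qed
  qed
  have Ft: "F t = 0" using t(2) by (simp add: F_def)
  define f where "f = - F q\<^sub>0"
  have f: "0 < f" using tanh_q\<^sub>0 by (simp add: f_def F_def)
  define c1 where "c1 = f / (t - q\<^sub>0)"
  have c1: "0 < c1" using f q\<^sub>0 by (simp add: c1_def)
  have chord_le: "F w \<le> c1 * (w - t)" if w: "q\<^sub>0 \<le> w" "w \<le> t" for w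
  proof -
    define u where "u = (w - q\<^sub>0) / (t - q\<^sub>0)"
    have u: "0 \<le> u" "u \<le> 1" "1 - u = (t - w) / (t - q\<^sub>0)" "u * (t - q\<^sub>0) = w - q\<^sub>0"
      using w q\<^sub>0(2) by (auto simp: u_def field_simps)
    then have w_eq: "(1 - u) * q\<^sub>0 + u * t = w" by (simp add: algebra_simps)
    have "F ((1 - u) *\<^sub>R q\<^sub>0 + u *\<^sub>R t) \<le> (1 - u) * F q\<^sub>0 + u * F t"
      using q\<^sub>0(1) t(1) by (intro convex_onD[OF convF u(1,2)]) auto
    then have "F w \<le> (1 - u) * (- f)" using Ft by (simp add: f_def w_eq)
    also have "\<dots> = c1 * (w - t)"
    proof -
      have "(t - w) * (- f) = f * (w - t)" by (simp add: algebra_simps)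
      then show ?thesis unfolding u(3) c1_def by (simp only: times_divide_eq_left)
    qed
    finally show ?thesis .
  qed
  have chord_ge: "c1 * (w - t) \<le> F w" if w: "t < w" for w
  proof -
    define u where "u = (t - q\<^sub>0) / (w - q\<^sub>0)"
    have wq: "0 < w - q\<^sub>0" using w q\<^sub>0 by simp
    have u: "0 < u" "u \<le> 1" "1 - u = (w - t) / (w - q\<^sub>0)" "u * (w - q\<^sub>0) = t - q\<^sub>0"
      using w q\<^sub>0(2) wq by (auto simp: u_def field_simps)
    then have t_eq: "(1 - u) * q\<^sub>0 + u * w = t" by (simp add: algebra_simps)
    have "F ((1 - u) *\<^sub>R q\<^sub>0 + u *\<^sub>R w) \<le> (1 - u) * F q\<^sub>0 + u * F w"
      using q\<^sub>0(1) t(1) w u by (intro convex_onD[OF convF]) auto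
    then have "F t \<le> (1 - u) * F q\<^sub>0 + u * F w" by (simp add: t_eq)
    then have "(1 - u) * f \<le> u * F w" using Ft by (simp add: f_def)
    then have "(1 - u) * f / u \<le> F w" using u(1) by (simp add: field_simps)
    moreover have "(1 - u) * f / u = c1 * (w - t)"
      unfolding u(3) unfolding u_def c1_def using wq q\<^sub>0(2) by simp
    ultimately show ?thesis by simp
  qed
  define \<phi> where "\<phi> = (\<lambda>w. ln (cosh (\<beta> * w)) - \<beta> * w\<^sup>2 / 2)"
  define g where "g = (\<lambda>w. \<phi> w + \<beta> * c1 / 2 * (w - t)\<^sup>2)"
  have dg: "(g has_real_derivative \<beta> * (c1 * (w - t) - F w)) (at w)" for w
    unfolding g_def \<phi>_def F_def
    by (auto intro!: derivative_eq_intros simp: tanh_def field_simps)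
  have \<phi>_le: "\<phi> w \<le> \<phi> t - \<beta> * c1 / 2 * (w - t)\<^sup>2" if w: "q\<^sub>0 \<le> w" for w
  proof -
    have "g w \<le> g t"
    proof (cases "w \<le> t")
      case True
      show ?thesis
      proof (rule DERIV_nonneg_imp_nondecreasing[OF True])
        fix x assume "w \<le> x" "x \<le> t"
        then have "0 \<le> \<beta> * (c1 * (x - t) - F x)" using chord_le[of x] w \<beta> by simp
        then show "\<exists>d. (g has_real_derivative d) (at x) \<and> 0 \<le> d" using dg[of x] by blast
      qed
    next
      case False
      then have "t \<le> w" by simp
      then show ?thesis
      proof (rule DERIV_nonpos_imp_nonincreasing)
        fix x assume "t \<le> x" "x \<le> w"
        then have "c1 * (x - t) - F x \<le> 0" using chord_ge[of x] Ft by (cases "x = t") auto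
        then have "\<beta> * (c1 * (x - t) - F x) \<le> 0" using \<beta> by (simp add: mult_nonneg_nonpos)
        then show "\<exists>d. (g has_real_derivative d) (at x) \<and> d \<le> 0" using dg[of x] by blast
      qed
    qed
    then show ?thesis by (simp add: g_def)
  qed
  \<comment> \<open>The factor \<open>\<iota>\<^sup>2\<close> serves the points below the cutoff,
    where only the drop at \<open>q\<^sub>0\<close>, of order
    \<open>(t - q\<^sub>0)\<^sup>2 = \<iota>\<^sup>2 * t\<^sup>2\<close>, is available to cover
    \<open>(w - t)\<^sup>2 \<le> t\<^sup>2\<close>.\<close>
  define c where "c = \<beta> * c1 / 2 * \<iota>\<^sup>2"
  have c: "0 < c" using \<beta> c1 \<iota> by (simp add: c_def)
  have c_le: "c \<le> \<beta> * c1 / 2"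
  proof -
    have "\<iota>\<^sup>2 \<le> 1" using \<iota> by (simp add: power_le_one)
    then show ?thesis unfolding c_def using \<beta> c1 mult_left_mono[of "\<iota>\<^sup>2" 1 "\<beta> * c1 / 2"] by simp
  qed
  have "free_energy w \<le> \<phi> t - c * (w - t)\<^sup>2" if w: "0 \<le> w" for w
  proof (cases "q\<^sub>0 \<le> w")
    case True
    then have "free_energy w = \<phi> w" by (simp add: free_energy_def \<phi>_def)
    then show ?thesis using \<phi>_le[OF True] mult_right_mono[OF c_le, of "(w - t)\<^sup>2"] by simp
  next
    case False
    then have m: "max w q\<^sub>0 = q\<^sub>0" by simp
    \<comment> \<open>Hence the quadratic in \<open>w\<close> below the cutoff has a nonnegative
      leading coefficient and is dominated by its value at \<open>q\<^sub>0\<close>.\<close>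
    have bs: "1 \<le> \<beta> * slope w"
      unfolding slope_eq m using tanh_q\<^sub>0 q\<^sub>0(1) \<beta> by (simp add: field_simps)
    have "free_energy w = ln (cosh (\<beta> * q\<^sub>0)) - slope w * (\<beta> * q\<^sub>0)\<^sup>2 / 2 + \<beta> * (\<beta> * slope w - 1) / 2 * w\<^sup>2"
      unfolding free_energy_def m by (simp add: field_simps power2_eq_square)
    also have "\<dots> \<le> ln (cosh (\<beta> * q\<^sub>0)) - slope w * (\<beta> * q\<^sub>0)\<^sup>2 / 2 + \<beta> * (\<beta> * slope w - 1) / 2 * q\<^sub>0\<^sup>2"
      using bs \<beta> w False by (intro add_left_mono mult_left_mono power_mono) auto
    also have "\<dots> = \<phi> q\<^sub>0" by (simp add: \<phi>_def field_simps power2_eq_square)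
    also have "\<dots> \<le> \<phi> t - \<beta> * c1 / 2 * (q\<^sub>0 - t)\<^sup>2" by (rule \<phi>_le) simp
    also have "\<beta> * c1 / 2 * (q\<^sub>0 - t)\<^sup>2 = c * t\<^sup>2"
      using q\<^sub>0(3) by (simp add: c_def power_mult_distrib power2_commute[of q\<^sub>0])
    also have "(w - t)\<^sup>2 \<le> t\<^sup>2" using w False q\<^sub>0 by (simp add: power2_le_iff_abs_le)
    then have "\<phi> t - c * t\<^sup>2 \<le> \<phi> t - c * (w - t)\<^sup>2" using c by simp
    finally show ?thesis .
  qed
  then show ?thesis using c unfolding \<phi>_def by (intro exI[of _ c]) auto
qed

end

section \<open>Diagonalization of real symmetric matrices\<close>

lemma symmetric_matD:
  assumes "A \<in> carrier_mat n n" "transpose_mat A = A" "i < n" "j < n"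
  shows "A $$ (i, j) = A $$ (j, i)"
  using assms by (metis carrier_matD index_transpose_mat(1))

text \<open>The characteristic polynomial has a complex root. It is real because the Hermitian form
  \<open>S\<close> of its eigenvector equals its own conjugate, by symmetry, and equals
  \<open>c * q\<close> with \<open>q > 0\<close>.\<close>

lemma real_symmetric_eigenvalue_exists:
  fixes A :: "real mat"
  assumes A: "A \<in> carrier_mat n n" and sym: "transpose_mat A = A" and n: "0 < n"
  shows "\<exists>e. eigenvalue A e"
proof -
  let ?C = "map_mat complex_of_real A"
  have C: "?C \<in> carrier_mat n n" using A by simp
  have "degree (char_poly ?C) = n" using degree_monic_char_poly[OF C] by simp
  then have "\<not> constant (poly (char_poly ?C))" using n by (simp add: constant_degree)
  then obtain c where "poly (char_poly ?C) c = 0" using fundamental_theorem_of_algebra by blast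
  then have "eigenvalue ?C c" using eigenvalue_root_char_poly[OF C] by simp
  then obtain v where v: "v \<in> carrier_vec n" "v \<noteq> 0\<^sub>v n" "?C *\<^sub>v v = c \<cdot>\<^sub>v v"
    using C unfolding eigenvalue_def eigenvector_def by auto
  have row: "(\<Sum>j<n. complex_of_real (A $$ (i, j)) * v $ j) = c * v $ i" if "i < n" for i
  proof -
    have "(?C *\<^sub>v v) $ i = (\<Sum>j<n. complex_of_real (A $$ (i, j)) * v $ j)"
      using that A v(1) by (auto simp: scalar_prod_def atLeast0LessThan intro!: sum.cong)
    then show ?thesis using v that by simp
  qed
  define S where "S = (\<Sum>i<n. \<Sum>j<n. complex_of_real (A $$ (i, j)) * v $ j * cnj (v $ i))"
  define q where "q = (\<Sum>i<n. (cmod (v $ i))\<^sup>2)"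
  have "S = (\<Sum>i<n. (\<Sum>j<n. complex_of_real (A $$ (i, j)) * v $ j) * cnj (v $ i))"
    by (simp add: S_def sum_distrib_right)
  also have "\<dots> = (\<Sum>i<n. c * (v $ i * cnj (v $ i)))"
    by (intro sum.cong refl) (simp add: row mult.assoc)
  also have "\<dots> = c * complex_of_real q"
    unfolding q_def of_real_sum sum_distrib_left
    by (intro sum.cong refl) (simp only: complex_norm_square)
  finally have S: "S = c * complex_of_real q" .
  have "cnj S = (\<Sum>i<n. \<Sum>j<n. complex_of_real (A $$ (i, j)) * cnj (v $ j) * v $ i)"
    by (simp add: S_def)
  also have "\<dots> = (\<Sum>j<n. \<Sum>i<n. complex_of_real (A $$ (i, j)) * cnj (v $ j) * v $ i)"
    by (rule sum.swap)
  also have "\<dots> = S"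
    unfolding S_def
  proof (intro sum.cong refl)
    fix i j assume "i \<in> {..<n}" "j \<in> {..<n}"
    then have "A $$ (j, i) = A $$ (i, j)" using symmetric_matD[OF A sym] by simp
    then show "complex_of_real (A $$ (j, i)) * cnj (v $ i) * v $ j
        = complex_of_real (A $$ (i, j)) * v $ j * cnj (v $ i)" by simp
  qed
  finally have "cnj S = S" .
  then have "cnj c * complex_of_real q = c * complex_of_real q" unfolding S by simp
  moreover have "q > 0"
  proof -
    obtain i where i: "i < n" "v $ i \<noteq> 0" using v(1,2) by (auto simp: vec_eq_iff)
    then show ?thesis unfolding q_def by (intro sum_pos2[of _ i]) auto
  qed
  ultimately have "cnj c = c" by simp
  then have "c \<in> \<real>" by (simp add: complex_is_Real_iff complex_eq_iff)
  then obtain r where r: "c = complex_of_real r" by (auto elim: Reals_cases)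
  have "complex_of_real (poly (char_poly A) r) = poly (char_poly ?C) c"
    unfolding r of_real_hom.char_poly_hom[OF A] by simp
  then have "poly (char_poly A) r = 0" using \<open>poly (char_poly ?C) c = 0\<close> by simp
  then show ?thesis using eigenvalue_root_char_poly[OF A] by blast
qed

text \<open>Gram-Schmidt on a basis that starts with \<open>v\<close> keeps the first vector, and
  normalizing the columns makes the matrix orthogonal. Applied to an eigenvector, it provides the
  change of basis for deflation.\<close>

lemma orthonormal_completion:
  fixes v :: "real vec"
  assumes v: "v \<in> carrier_vec n" "v \<noteq> 0\<^sub>v n"
  shows "\<exists>W. W \<in> carrier_mat n n \<and> transpose_mat W * W = 1\<^sub>m n \<and> (\<exists>c. col W 0 = c \<cdot>\<^sub>v v)"
proof -
  interpret cof_vec_space n "TYPE(real)" .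
  from v have n: "0 < n" by (cases n) auto
  let ?b = "basis_completion v"
  define ws where "ws = gram_schmidt n ?b"
  note bc = basis_completion[OF v]
  obtain vs where vs: "?b = v # vs" using bc(6,7) n by (cases ?b) auto
  have ws: "set ws \<subseteq> carrier_vec n" "corthogonal ws" "length ws = n"
    using gram_schmidt_result[OF bc(2,4,5) refl, folded ws_def] bc(6) by auto
  have ws0: "ws ! 0 = v"
  proof -
    have "hd ws = v" using gram_schmidt_hd[OF v(1), of vs] unfolding ws_def vs by simp
    moreover have "ws \<noteq> []" using ws(3) n by auto
    ultimately show ?thesis using hd_conv_nth[of ws] by simp
  qed
  have wsi: "ws ! i \<in> carrier_vec n" if "i < n" for i using ws that by auto
  define f where "f = (\<lambda>i. 1 / sqrt (ws ! i \<bullet> ws ! i))"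
  have orth: "ws ! i \<bullet> ws ! j = 0 \<longleftrightarrow> i \<noteq> j" if "i < n" "j < n" for i j
    using corthogonalD[OF ws(2), of i j] ws(3) that by simp
  have f: "f i * f i * (ws ! i \<bullet> ws ! i) = 1" if "i < n" for i
  proof -
    have "0 \<le> ws ! i \<bullet> ws ! i" unfolding scalar_prod_def by (intro sum_nonneg) simp
    moreover have "ws ! i \<bullet> ws ! i \<noteq> 0" using orth[OF that that] by simp
    ultimately show ?thesis by (simp add: f_def)
  qed
  let ?W = "mat_of_cols n (map (\<lambda>i. f i \<cdot>\<^sub>v (ws ! i)) [0..<n])"
  have W: "?W \<in> carrier_mat n n" by (simp add: mat_of_cols_def)
  have col: "col ?W i = f i \<cdot>\<^sub>v (ws ! i)" if "i < n" for i
    using that wsi by (subst col_mat_of_cols) auto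
  have "transpose_mat ?W * ?W = 1\<^sub>m n"
  proof (rule eq_matI)
    fix i j assume "i < dim_row (1\<^sub>m n :: real mat)" "j < dim_col (1\<^sub>m n :: real mat)"
    then have ij: "i < n" "j < n" by auto
    have "(transpose_mat ?W * ?W) $$ (i, j) = col ?W i \<bullet> col ?W j"
      using ij W by (simp add: mat_of_cols_def)
    also have "\<dots> = f i * f j * (ws ! i \<bullet> ws ! j)"
      unfolding col[OF ij(1)] col[OF ij(2)] using wsi[OF ij(1)] wsi[OF ij(2)] by simp
    also have "\<dots> = (1\<^sub>m n) $$ (i, j)"
      using ij orth[OF ij] f[OF ij(1)] by auto
    finally show "(transpose_mat ?W * ?W) $$ (i, j) = (1\<^sub>m n) $$ (i, j)" .
  qed (use W in auto)
  then show ?thesis using W col[OF n] unfolding ws0 by blast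
qed

text \<open>Deflation. In an orthonormal basis starting with an eigenvector the first column is
  \<open>e\<close> times the first unit vector, by symmetry so is the first row, and the remaining
  block is symmetric and one size smaller.\<close>

lemma real_symmetric_diagonalization:
  fixes A :: "real mat"
  assumes "A \<in> carrier_mat n n" "transpose_mat A = A"
  shows "\<exists>es P. length es = n \<and> P \<in> carrier_mat n n \<and> transpose_mat P * P = 1\<^sub>m n \<and>
    A = P * mat_diag n (\<lambda>i. es ! i) * transpose_mat P"
  using assms
proof (induction n arbitrary: A)
  case 0
  then show ?case by (intro exI[of _ "[]"] exI[of _ "1\<^sub>m 0"]) auto
next
  case (Suc n)
  note A = Suc.prems(1) and sym = Suc.prems(2)
  obtain e where "eigenvalue A e" using real_symmetric_eigenvalue_exists[OF A sym] by auto
  then obtain v where v: "v \<in> carrier_vec (Suc n)" "v \<noteq> 0\<^sub>v (Suc n)" "A *\<^sub>v v = e \<cdot>\<^sub>v v"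
    using A unfolding eigenvalue_def eigenvector_def by auto
  obtain W c where W: "W \<in> carrier_mat (Suc n) (Suc n)" and WW: "transpose_mat W * W = 1\<^sub>m (Suc n)"
    and col: "col W 0 = c \<cdot>\<^sub>v v"
    using orthonormal_completion[OF v(1,2)] by blast
  let ?W' = "transpose_mat W"
  have W': "?W' \<in> carrier_mat (Suc n) (Suc n)" using W by simp
  have WW': "W * ?W' = 1\<^sub>m (Suc n)" by (rule mat_mult_left_right_inverse[OF W' W WW])
  define B where "B = ?W' * A * W"
  have B: "B \<in> carrier_mat (Suc n) (Suc n)" unfolding B_def using A W by simp
  have B_sym: "transpose_mat B = B"
    unfolding B_def using A W sym
    by (simp add: transpose_mult[of _ "Suc n" "Suc n" _ "Suc n"] assoc_mult_mat[of _ "Suc n" "Suc n" _ "Suc n" _ "Suc n"])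
  have AB: "A = W * B * ?W'"
  proof -
    have "W * B * ?W' = (W * ?W') * A * (W * ?W')"
      unfolding B_def using A W W'
      by (simp add: assoc_mult_mat[of _ "Suc n" "Suc n" _ "Suc n" _ "Suc n"])
    then show ?thesis unfolding WW' using A by simp
  qed
  have ev: "A *\<^sub>v col W 0 = e \<cdot>\<^sub>v col W 0"
    unfolding col using v A by (simp add: mult_mat_vec[of _ "Suc n" "Suc n"] smult_smult_assoc mult.commute)
  have B0: "B $$ (i, 0) = (if i = 0 then e else 0)" if i: "i < Suc n" for i
  proof -
    have "B = ?W' * (A * W)" unfolding B_def by (rule assoc_mult_mat[OF W' A W])
    then have "B $$ (i, 0) = row ?W' i \<bullet> col (A * W) 0"
      using i A W W' by (simp only: index_mult_mat(1) carrier_matD index_mult_mat(3))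
    also have "col (A * W) 0 = A *\<^sub>v col W 0" by (rule col_mult2[OF A W]) simp
    finally have "B $$ (i, 0) = row ?W' i \<bullet> (A *\<^sub>v col W 0)" .
    also have "\<dots> = e * (row ?W' i \<bullet> col W 0)" unfolding ev using W i by simp
    also have "row ?W' i \<bullet> col W 0 = (?W' * W) $$ (i, 0)" using W i by simp
    also have "\<dots> = (if i = 0 then 1 else 0)" unfolding WW using i by simp
    finally show ?thesis by simp
  qed
  define A3 where "A3 = mat n n (\<lambda>(i, j). B $$ (Suc i, Suc j))"
  have A3: "A3 \<in> carrier_mat n n" by (simp add: A3_def)
  have A3_sym: "transpose_mat A3 = A3"
    unfolding A3_def using symmetric_matD[OF B B_sym] by (intro eq_matI) auto
  from Suc.IH[OF A3 A3_sym] obtain es P where es: "length es = n" and P: "P \<in> carrier_mat n n"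
    and PP: "transpose_mat P * P = 1\<^sub>m n"
    and A3_eq: "A3 = P * mat_diag n (\<lambda>i. es ! i) * transpose_mat P"
    by (elim exE conjE) (rule that)
  let ?D = "mat_diag n (\<lambda>i. es ! i)"
  let ?e = "mat 1 1 (\<lambda>_. e)"
  let ?F = "\<lambda>a X. four_block_mat a (0\<^sub>m 1 n) (0\<^sub>m n 1) X"
  have B_block: "B = ?F ?e A3"
  proof (rule eq_matI)
    fix i j assume "i < dim_row (?F ?e A3)" "j < dim_col (?F ?e A3)"
    then have ij: "i < Suc n" "j < Suc n" using A3 by auto
    have B0': "B $$ (0, j) = (if j = 0 then e else 0)"
      using B0[OF ij(2)] symmetric_matD[OF B B_sym, of 0 j] ij by simp
    show "B $$ (i, j) = ?F ?e A3 $$ (i, j)"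
      using ij B0[OF ij(1)] B0' A3 by (cases i; cases j) (auto simp: A3_def)
  qed (use B A3 in auto)
  let ?Q = "?F (1\<^sub>m 1) P"
  have Q: "?Q \<in> carrier_mat (Suc n) (Suc n)"
    using four_block_carrier_mat[of "1\<^sub>m 1" 1 1 P n n] P by simp
  have D_block: "mat_diag (Suc n) (\<lambda>i. (e # es) ! i) = ?F ?e ?D"
    by (rule eq_matI) (auto simp: mat_diag_def nth_Cons split: nat.splits)
  have Q': "transpose_mat ?Q = ?F (1\<^sub>m 1) (transpose_mat P)"
    using P by (subst transpose_four_block_mat[of _ 1 1 _ n _ n]) auto
  have QQ: "transpose_mat ?Q * ?Q = 1\<^sub>m (Suc n)"
    unfolding Q' using P PP by (subst mult_four_block_mat[of _ 1 1 _ n _ n _ _ 1 _ n]) auto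
  have Dc: "?D \<in> carrier_mat n n" by simp
  have Pt: "transpose_mat P \<in> carrier_mat n n" using P by simp
  have PD: "P * ?D \<in> carrier_mat n n" by (rule mult_carrier_mat[OF P Dc])
  have PDP: "P * ?D * transpose_mat P \<in> carrier_mat n n" by (rule mult_carrier_mat[OF PD Pt])
  note zero = left_mult_zero_mat[OF Dc] left_mult_zero_mat[OF Pt] right_mult_zero_mat[OF PD]
    right_mult_zero_mat[OF P] left_add_zero_mat[OF PD] left_add_zero_mat[OF PDP]
  have "?Q * ?F ?e ?D = ?F ?e (P * ?D)"
    using P by (subst mult_four_block_mat[of _ 1 1 _ n _ n _ _ 1 _ n]) (auto simp: zero)
  moreover have "?F ?e (P * ?D) * transpose_mat ?Q = ?F ?e A3"
    unfolding Q' A3_eq using P PD Pt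
    by (subst mult_four_block_mat[of _ 1 1 _ n _ n _ _ 1 _ n]) (auto simp: zero)
  ultimately have "?Q * ?F ?e ?D * transpose_mat ?Q = ?F ?e A3" by simp
  then have B_eq: "B = ?Q * mat_diag (Suc n) (\<lambda>i. (e # es) ! i) * transpose_mat ?Q"
    unfolding B_block D_block by simp
  let ?D1 = "mat_diag (Suc n) (\<lambda>i. (e # es) ! i)"
  have D1: "?D1 \<in> carrier_mat (Suc n) (Suc n)" by simp
  have Q'': "transpose_mat ?Q \<in> carrier_mat (Suc n) (Suc n)" using Q by simp
  have "A = (W * ?Q) * ?D1 * transpose_mat (W * ?Q)"
  proof -
    note DQ = mult_carrier_mat[OF D1 Q''] and Q'W = mult_carrier_mat[OF Q'' W']
    note QDQ = mult_carrier_mat[OF Q DQ] and DQW = mult_carrier_mat[OF D1 Q'W]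
    have "A = W * (?Q * (?D1 * transpose_mat ?Q)) * ?W'"
      unfolding AB B_eq assoc_mult_mat[OF Q D1 Q''] ..
    also have "\<dots> = W * (?Q * (?D1 * (transpose_mat ?Q * ?W')))"
      unfolding assoc_mult_mat[OF W QDQ W'] assoc_mult_mat[OF Q DQ W'] assoc_mult_mat[OF D1 Q'' W'] ..
    also have "\<dots> = (W * ?Q) * ?D1 * (transpose_mat ?Q * ?W')"
      unfolding assoc_mult_mat[OF mult_carrier_mat[OF W Q] D1 Q'W] assoc_mult_mat[OF W Q DQW] ..
    finally show ?thesis unfolding transpose_mult[OF W Q] .
  qed
  moreover have "transpose_mat (W * ?Q) * (W * ?Q) = 1\<^sub>m (Suc n)"
  proof -
    have "transpose_mat (W * ?Q) * (W * ?Q) = transpose_mat ?Q * ((?W' * W) * ?Q)"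
      unfolding transpose_mult[OF W Q] assoc_mult_mat[OF Q'' W' mult_carrier_mat[OF W Q]]
        assoc_mult_mat[OF W' W Q] ..
    also have "\<dots> = 1\<^sub>m (Suc n)" unfolding WW left_mult_one_mat[OF Q] by (rule QQ)
    finally show ?thesis .
  qed
  moreover have "W * ?Q \<in> carrier_mat (Suc n) (Suc n)" using W Q by simp
  moreover have "length (e # es) = Suc n" using es by simp
  ultimately show ?case by (intro exI[of _ "e # es"] exI[of _ "W * ?Q"] conjI)
qed

lemma proots_char_poly_diagonalization:
  fixes A :: "real mat"
  assumes es: "length es = n" and P: "P \<in> carrier_mat n n" and PP: "transpose_mat P * P = 1\<^sub>m n"
    and A: "A = P * mat_diag n (\<lambda>i. es ! i) * transpose_mat P"
  shows "proots (char_poly A) = mset es"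
proof -
  let ?D = "mat_diag n (\<lambda>i. es ! i)"
  have P': "transpose_mat P \<in> carrier_mat n n" using P by simp
  have PP': "P * transpose_mat P = 1\<^sub>m n" by (rule mat_mult_left_right_inverse[OF P' P PP])
  have "similar_mat_wit A ?D P (transpose_mat P)"
    by (rule similar_mat_witI[OF PP' PP A]) (use P A in auto)
  then have "char_poly A = char_poly ?D" by (intro char_poly_similar) (auto simp: similar_mat_def)
  also have "\<dots> = (\<Prod>a\<leftarrow>diag_mat ?D. [:- a, 1:])"
    by (rule char_poly_upper_triangular[of _ n]) (auto simp: mat_diag_def)
  also have "diag_mat ?D = es"
    using es by (intro nth_equalityI) (auto simp: diag_mat_def mat_diag_def)
  also have "proots (\<Prod>a\<leftarrow>es. [:- a, 1:]) = mset es"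
  proof (induction es)
    case (Cons a es)
    have "(\<Prod>a\<leftarrow>es. [:- a, 1:]) \<noteq> 0" by (auto simp: prod_list_zero_iff)
    then have "proots ([:- a, 1:] * (\<Prod>a\<leftarrow>es. [:- a, 1:])) = add_mset a (proots (\<Prod>a\<leftarrow>es. [:- a, 1:]))"
      by (subst proots_mult) auto
    then show ?case using Cons.IH by (simp only: list.map prod_list.Cons mset.simps)
  qed simp
  finally show ?thesis .
qed

lemma real_symmetric_quadratic_form:
  fixes A :: "real mat"
  assumes es: "length es = n" and P: "P \<in> carrier_mat n n" and PP: "transpose_mat P * P = 1\<^sub>m n"
    and A: "A = P * mat_diag n (\<lambda>i. es ! i) * transpose_mat P"
  shows "(\<Sum>i<n. \<Sum>j<n. A $$ (i, j) * x i * x j) = (\<Sum>k<n. es ! k * (\<Sum>i<n. P $$ (i, k) * x i)\<^sup>2)"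
    and "(\<Sum>i<n. (x i)\<^sup>2) = (\<Sum>k<n. (\<Sum>i<n. P $$ (i, k) * x i)\<^sup>2)"
    and "k < n \<Longrightarrow> (\<Sum>i<n. (P $$ (i, k))\<^sup>2) = 1"
proof -
  have P': "transpose_mat P \<in> carrier_mat n n" using P by simp
  have PP': "P * transpose_mat P = 1\<^sub>m n" by (rule mat_mult_left_right_inverse[OF P' P PP])
  have swap: "(\<Sum>i<n. \<Sum>j<n. (\<Sum>k<n. d k * P $$ (i, k) * P $$ (j, k)) * x i * x j)
      = (\<Sum>k<n. d k * (\<Sum>i<n. P $$ (i, k) * x i)\<^sup>2)" for d :: "nat \<Rightarrow> real"
  proof -
    have "(\<Sum>i<n. \<Sum>j<n. (\<Sum>k<n. d k * P $$ (i, k) * P $$ (j, k)) * x i * x j)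
        = (\<Sum>i<n. \<Sum>k<n. \<Sum>j<n. d k * P $$ (i, k) * P $$ (j, k) * x i * x j)"
      unfolding sum_distrib_right by (intro sum.cong refl sum.swap)
    also have "\<dots> = (\<Sum>k<n. \<Sum>i<n. \<Sum>j<n. d k * P $$ (i, k) * P $$ (j, k) * x i * x j)"
      by (rule sum.swap)
    also have "\<dots> = (\<Sum>k<n. d k * (\<Sum>i<n. P $$ (i, k) * x i)\<^sup>2)"
      unfolding power2_eq_square sum_product by (simp add: sum_distrib_left mult_ac)
    finally show ?thesis .
  qed
  have entry: "A $$ (i, j) = (\<Sum>k<n. es ! k * P $$ (i, k) * P $$ (j, k))" if "i < n" "j < n" for i j
    unfolding A using that P
    by (subst mat_diag_mult_right[OF P]) (auto simp: scalar_prod_def atLeast0LessThan mult_ac intro!: sum.cong)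
  have one: "(if i = j then 1 else 0) = (\<Sum>k<n. 1 * P $$ (i, k) * P $$ (j, k))" if "i < n" "j < n" for i j
  proof -
    have "(if i = j then 1 else 0) = (P * transpose_mat P) $$ (i, j)" unfolding PP' using that by simp
    also have "\<dots> = (\<Sum>k<n. 1 * P $$ (i, k) * P $$ (j, k))"
      using that P by (auto simp: scalar_prod_def atLeast0LessThan intro!: sum.cong)
    finally show ?thesis .
  qed
  show "(\<Sum>i<n. \<Sum>j<n. A $$ (i, j) * x i * x j) = (\<Sum>k<n. es ! k * (\<Sum>i<n. P $$ (i, k) * x i)\<^sup>2)"
    unfolding swap[symmetric] by (intro sum.cong refl) (simp add: entry)
  have "(\<Sum>i<n. (x i)\<^sup>2) = (\<Sum>i<n. \<Sum>j<n. (if i = j then 1 else 0) * x i * x j)"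
  proof (rule sum.cong[OF refl])
    fix i assume "i \<in> {..<n}"
    have "(\<Sum>j<n. (if i = j then 1 else 0) * x i * x j) = (\<Sum>j<n. if i = j then x i * x j else 0)"
      by (intro sum.cong) auto
    then show "(x i)\<^sup>2 = (\<Sum>j<n. (if i = j then 1 else 0) * x i * x j)"
      using \<open>i \<in> {..<n}\<close> by (simp add: power2_eq_square)
  qed
  also have "\<dots> = (\<Sum>i<n. \<Sum>j<n. (\<Sum>k<n. 1 * P $$ (i, k) * P $$ (j, k)) * x i * x j)"
    using one by (intro sum.cong refl) simp
  also have "\<dots> = (\<Sum>k<n. 1 * (\<Sum>i<n. P $$ (i, k) * x i)\<^sup>2)" by (rule swap)
  finally show "(\<Sum>i<n. (x i)\<^sup>2) = (\<Sum>k<n. (\<Sum>i<n. P $$ (i, k) * x i)\<^sup>2)" by simp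
  show "(\<Sum>i<n. (P $$ (i, k))\<^sup>2) = 1" if "k < n"
  proof -
    have "(transpose_mat P * P) $$ (k, k) = (\<Sum>i<n. P $$ (i, k) * P $$ (i, k))"
      using that P by (auto simp: scalar_prod_def atLeast0LessThan intro!: sum.cong)
    then show ?thesis unfolding PP using that by (simp add: power2_eq_square)
  qed
qed

section \<open>Rayleigh bounds from the two largest eigenvalues\<close>

text \<open>Only one occurrence of the maximum is taken out of the multiset, and the others are
  bounded by the next entry of the sorted list; for a repeated maximum that entry is the maximum
  again. The index \<open>k\<close> singles out one top eigenvector.\<close>

lemma two_largest_of_list:
  fixes es :: "'a :: linorder list"
  assumes n: "2 \<le> length es"
  defines "L \<equiv> rev (sorted_list_of_multiset (mset es))"
  shows "\<exists>k<length es. es ! k = L ! 0 \<and> (\<forall>j<length es. j \<noteq> k \<longrightarrow> es ! j \<le> L ! 1) \<and> L ! 1 \<le> L ! 0"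
proof -
  have mL: "mset L = mset es" by (simp add: L_def)
  then have len: "length L = length es" by (rule mset_eq_length)
  obtain a b R where L: "L = a # b # R"
    using n len by (cases L; cases "tl L") auto
  have "sorted (rev L)" by (simp add: L_def)
  then have srt: "sorted_wrt (\<ge>) L" by (simp add: sorted_wrt_rev)
  have "a \<in> set es" using mset_eq_setD[OF mL] unfolding L by auto
  then obtain k where k: "k < length es" "es ! k = a" by (auto simp: in_set_conv_nth)
  have "es ! j \<le> b" if j: "j < length es" "j \<noteq> k" for j
  proof -
    have "mset es = add_mset (es ! k) (mset (take k es @ drop (Suc k) es))"
      using arg_cong[OF id_take_nth_drop[OF k(1)], of mset] by simp
    then have "mset (take k es @ drop (Suc k) es) = mset (b # R)"
      using mL unfolding L k(2) by simp
    then have "set (take k es @ drop (Suc k) es) = set (b # R)" by (rule mset_eq_setD)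
    moreover have "es ! j \<in> set (take k es @ drop (Suc k) es)"
    proof (cases "j < k")
      case True
      then have "take k es ! j \<in> set (take k es)" using k(1) by (intro nth_mem) simp
      then show ?thesis using True by simp
    next
      case False
      then have "drop (Suc k) es ! (j - Suc k) \<in> set (drop (Suc k) es)"
        using j k(1) by (intro nth_mem) auto
      moreover have "drop (Suc k) es ! (j - Suc k) = es ! j" using False j k(1) by simp
      ultimately show ?thesis by simp
    qed
    ultimately show ?thesis using srt unfolding L by auto
  qed
  moreover have "b \<le> a" using srt unfolding L by simp
  ultimately show ?thesis using k unfolding L by auto
qed

lemma coupling_matrix_symmetric:
  assumes "coupling_matrix N A" "i < N" "j < N"
  shows "A $$ (i, j) = A $$ (j, i)"
  using assms symmetric_matD[of A N i j] by (simp add: coupling_matrix_def)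

text \<open>All that later sections use of the spectral theorem: off one unit vector
  \<open>u\<close> the form is bounded by the second eigenvalue. In the eigenbasis only the
  coordinate along \<open>u\<close> is treated separately.\<close>

lemma rayleigh_eigenvalue_desc:
  assumes A: "coupling_matrix N A" and N: "2 \<le> N"
  shows "\<exists>u. (\<Sum>i<N. (u i)\<^sup>2) = 1 \<and> eigenvalue_desc 2 A \<le> eigenvalue_desc 1 A \<and>
    (\<forall>x. (\<Sum>i<N. \<Sum>j<N. A $$ (i, j) * x i * x j) \<le> eigenvalue_desc 2 A * (\<Sum>i<N. (x i)\<^sup>2)
       + (eigenvalue_desc 1 A - eigenvalue_desc 2 A) * (\<Sum>i<N. u i * x i)\<^sup>2)"
proof -
  have "A \<in> carrier_mat N N" "transpose_mat A = A" using A by (auto simp: coupling_matrix_def)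
  from real_symmetric_diagonalization[OF this] obtain es P
    where es: "length es = N" and P: "P \<in> carrier_mat N N" and PP: "transpose_mat P * P = 1\<^sub>m N"
    and eq: "A = P * mat_diag N (\<lambda>i. es ! i) * transpose_mat P"
    by (elim exE conjE) (rule that)
  note qf = real_symmetric_quadratic_form[OF es P PP eq]
  let ?l1 = "eigenvalue_desc 1 A" and ?l2 = "eigenvalue_desc 2 A"
  obtain k where k: "k < N" "es ! k = ?l1" "\<And>j. j < N \<Longrightarrow> j \<noteq> k \<Longrightarrow> es ! j \<le> ?l2" "?l2 \<le> ?l1"
    using two_largest_of_list[of es] es N
    unfolding eigenvalue_desc_def proots_char_poly_diagonalization[OF es P PP eq] by auto
  have "(\<Sum>i<N. \<Sum>j<N. A $$ (i, j) * x i * x j) \<le> ?l2 * (\<Sum>i<N. (x i)\<^sup>2)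
       + (?l1 - ?l2) * (\<Sum>i<N. P $$ (i, k) * x i)\<^sup>2" for x
  proof -
    let ?c = "\<lambda>k. (\<Sum>i<N. P $$ (i, k) * x i)\<^sup>2"
    have "(\<Sum>j<N. es ! j * ?c j) \<le> (\<Sum>j<N. ?l2 * ?c j + (if j = k then (?l1 - ?l2) * ?c k else 0))"
    proof (rule sum_mono)
      fix j assume "j \<in> {..<N}"
      then show "es ! j * ?c j \<le> ?l2 * ?c j + (if j = k then (?l1 - ?l2) * ?c k else 0)"
        using k(2,3) by (cases "j = k") (auto simp: algebra_simps intro!: mult_right_mono)
    qed
    also have "\<dots> = ?l2 * (\<Sum>j<N. ?c j) + (?l1 - ?l2) * ?c k"
      using k(1) by (simp add: sum.distrib sum_distrib_left)
    finally show ?thesis unfolding qf(1)[of x] qf(2)[of x] .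
  qed
  then show ?thesis using qf(3)[OF k(1)] k(4) by (intro exI[of _ "\<lambda>i. P $$ (i, k)"]) auto
qed

section \<open>The Ising partition function\<close>

abbreviation (input) norm_sq :: "nat \<Rightarrow> (nat \<Rightarrow> real) \<Rightarrow> real" where
  "norm_sq N x \<equiv> \<Sum>i<N. (x i)\<^sup>2"

abbreviation (input) mat_form :: "nat \<Rightarrow> real mat \<Rightarrow> (nat \<Rightarrow> real) \<Rightarrow> real" where
  "mat_form N A x \<equiv> \<Sum>i<N. \<Sum>j<N. A $$ (i, j) * x i * x j"

abbreviation (input) field_sq :: "nat \<Rightarrow> real mat \<Rightarrow> (nat \<Rightarrow> real) \<Rightarrow> real" where
  "field_sq N A x \<equiv> \<Sum>i<N. (local_field N A x i)\<^sup>2"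

abbreviation (input) row_dev :: "nat \<Rightarrow> real mat \<Rightarrow> real" where
  "row_dev N A \<equiv> \<Sum>i<N. (row_sum N A i - 1)"

abbreviation (input) row_dev_sq :: "nat \<Rightarrow> real mat \<Rightarrow> real" where
  "row_dev_sq N A \<equiv> \<Sum>i<N. (row_sum N A i - 1)\<^sup>2"

section \<open>Norm bounds for the local fields\<close>

lemma frobenius_norm_sq: "(frobenius_norm N A)\<^sup>2 = (\<Sum>i<N. \<Sum>j<N. (A $$ (i, j))\<^sup>2)"
  by (simp add: frobenius_norm_def sum_nonneg)

lemma sum_mult_sq_le:
  fixes f g :: "'a \<Rightarrow> real"
  shows "(\<Sum>i\<in>I. f i * g i)\<^sup>2 \<le> (\<Sum>i\<in>I. (f i)\<^sup>2) * (\<Sum>i\<in>I. (g i)\<^sup>2)"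
  using Cauchy_Schwarz_ineq_sum[of f g I] .

text \<open>Schur test: Cauchy-Schwarz with weights \<open>sqrt (A $$ (i, j))\<close> in each row,
  then summation over rows, where the column sums are row sums by symmetry. It bounds the operator
  norm of \<open>A\<close> by \<open>K\<close>.\<close>

lemma local_field_sq_sum_le:
  assumes A: "coupling_matrix N A" and K: "\<And>i. i < N \<Longrightarrow> row_sum N A i \<le> K"
  shows "field_sq N A x \<le> K\<^sup>2 * norm_sq N x"
proof (cases "N = 0")
  case False
  have nn: "0 \<le> A $$ (i, j)" if "i < N" "j < N" for i j using A that by (simp add: coupling_matrix_def)
  have K0: "0 \<le> K"
  proof -
    have "0 \<le> row_sum N A 0" unfolding row_sum_def using False nn by (intro sum_nonneg) auto
    also have "\<dots> \<le> K" using False by (intro K) simp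
    finally show ?thesis .
  qed
  have "(local_field N A x i)\<^sup>2 \<le> K * (\<Sum>j<N. A $$ (i, j) * (x j)\<^sup>2)" if i: "i < N" for i
  proof -
    have "local_field N A x i = (\<Sum>j<N. sqrt (A $$ (i, j)) * (sqrt (A $$ (i, j)) * x j))"
      unfolding local_field_def using nn[OF i] by (intro sum.cong) (auto simp: mult.assoc[symmetric])
    then have "(local_field N A x i)\<^sup>2
        \<le> (\<Sum>j<N. (sqrt (A $$ (i, j)))\<^sup>2) * (\<Sum>j<N. (sqrt (A $$ (i, j)) * x j)\<^sup>2)"
      using sum_mult_sq_le[of "\<lambda>j. sqrt (A $$ (i, j))" "\<lambda>j. sqrt (A $$ (i, j)) * x j" "{..<N}"] by simp
    also have "\<dots> = row_sum N A i * (\<Sum>j<N. A $$ (i, j) * (x j)\<^sup>2)"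
      unfolding row_sum_def using nn[OF i] by (simp add: power_mult_distrib)
    also have "\<dots> \<le> K * (\<Sum>j<N. A $$ (i, j) * (x j)\<^sup>2)"
      using nn[OF i] by (intro mult_right_mono K i sum_nonneg) auto
    finally show ?thesis .
  qed
  then have "field_sq N A x \<le> (\<Sum>i<N. K * (\<Sum>j<N. A $$ (i, j) * (x j)\<^sup>2))"
    by (intro sum_mono) simp
  also have "\<dots> = K * (\<Sum>j<N. \<Sum>i<N. A $$ (i, j) * (x j)\<^sup>2)"
    unfolding sum_distrib_left[symmetric] by (subst sum.swap) (rule refl)
  also have "\<dots> = K * (\<Sum>j<N. row_sum N A j * (x j)\<^sup>2)"
    unfolding row_sum_def sum_distrib_right
    using coupling_matrix_symmetric[OF A] by (intro arg_cong[of _ _ "(*) K"] sum.cong refl) simp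
  also have "\<dots> \<le> K * (\<Sum>j<N. K * (x j)\<^sup>2)"
    using K K0 by (intro mult_left_mono sum_mono mult_right_mono) auto
  also have "\<dots> = K\<^sup>2 * norm_sq N x"
    by (simp add: sum_distrib_left[symmetric] power2_eq_square)
  finally show ?thesis .
qed simp

text \<open>The transpose of \<open>A\<close> times \<open>A\<close>. It puts the squared local
  fields into the same quadratic form as the Hamiltonian.\<close>

definition mat_square :: "nat \<Rightarrow> real mat \<Rightarrow> nat \<Rightarrow> nat \<Rightarrow> real" where
  "mat_square N A i j = (\<Sum>k<N. A $$ (k, i) * A $$ (k, j))"

lemma mat_square_form:
  "(\<Sum>i<N. \<Sum>j<N. mat_square N A i j * x i * x j) = (\<Sum>k<N. (local_field N A x k)\<^sup>2)"
proof -
  have "(\<Sum>i<N. \<Sum>j<N. mat_square N A i j * x i * x j)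
      = (\<Sum>i<N. \<Sum>k<N. \<Sum>j<N. A $$ (k, i) * A $$ (k, j) * x i * x j)"
    unfolding mat_square_def sum_distrib_right by (intro sum.cong refl sum.swap)
  also have "\<dots> = (\<Sum>k<N. \<Sum>i<N. \<Sum>j<N. A $$ (k, i) * A $$ (k, j) * x i * x j)"
    by (rule sum.swap)
  also have "\<dots> = (\<Sum>k<N. (local_field N A x k)\<^sup>2)"
    unfolding local_field_def power2_eq_square sum_product by (simp add: mult_ac)
  finally show ?thesis .
qed

lemma mat_square_trace: "(\<Sum>i<N. mat_square N A i i) = (frobenius_norm N A)\<^sup>2"
  unfolding frobenius_norm_sq mat_square_def
  by (subst sum.swap) (simp add: power2_eq_square)

text \<open>A column of the product is \<open>A\<close> applied to a column of \<open>A\<close>, so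
  the Schur test applies column by column.\<close>

lemma mat_square_frobenius_le:
  assumes A: "coupling_matrix N A" and K: "\<And>i. i < N \<Longrightarrow> row_sum N A i \<le> K"
  shows "(\<Sum>i<N. \<Sum>j<N. (mat_square N A i j)\<^sup>2) \<le> K\<^sup>2 * (frobenius_norm N A)\<^sup>2"
proof -
  have "(\<Sum>i<N. \<Sum>j<N. (mat_square N A i j)\<^sup>2)
      = (\<Sum>j<N. \<Sum>i<N. (local_field N A (\<lambda>k. A $$ (k, j)) i)\<^sup>2)"
    unfolding mat_square_def local_field_def
    using coupling_matrix_symmetric[OF A] by (subst sum.swap) (intro sum.cong refl arg_cong[of _ _ "\<lambda>x. x\<^sup>2"], simp)
  also have "\<dots> \<le> (\<Sum>j<N. K\<^sup>2 * (\<Sum>i<N. (A $$ (i, j))\<^sup>2))"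
    by (intro sum_mono local_field_sq_sum_le A K)
  also have "\<dots> = K\<^sup>2 * (frobenius_norm N A)\<^sup>2"
    unfolding frobenius_norm_sq sum_distrib_left[symmetric] by (subst sum.swap) (rule refl)
  finally show ?thesis .
qed

text \<open>Read off from \<open>subgaussian_quadratic_form\<close> for the matrix \<open>M\<close>
  of the next main lemma, with a variance proxy of at most 1: \<open>2 * \<gamma>\<close> pays for
  the trace, the middle term for the Frobenius sum, and 1 for the linear form.\<close>

definition core_const :: "real \<Rightarrow> real \<Rightarrow> real \<Rightarrow> real \<Rightarrow> real" where
  "core_const \<beta> \<gamma> K \<epsilon> = (2 * \<gamma> + (2 * \<beta>\<^sup>2 + 8 * \<gamma>\<^sup>2 * K\<^sup>2) / \<epsilon> + 1) / (2 * \<epsilon>)"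

lemma core_const_nonneg: "0 \<le> \<gamma> \<Longrightarrow> 0 < \<epsilon> \<Longrightarrow> 0 \<le> core_const \<beta> \<gamma> K \<epsilon>"
  unfolding core_const_def by (intro divide_nonneg_pos add_nonneg_nonneg) auto

text \<open>Common engine of all regimes, with \<open>D\<close> either \<open>A\<close> itself or
  \<open>A\<close> without its mean part. As \<open>D\<close> has zero diagonal, only the
  \<open>\<gamma>\<close> part enters the trace of \<open>M\<close>, so the cost is measured by
  squared Frobenius norms and the linear form, with no extra term of order \<open>N\<close>.\<close>

lemma spin_quadratic_exp_le:
  fixes D :: "nat \<Rightarrow> nat \<Rightarrow> real"
  defines "s \<equiv> tangent_slope"
  assumes A: "coupling_matrix N A" and K: "\<And>i. i < N \<Longrightarrow> row_sum N A i \<le> K"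
    and \<beta>: "0 \<le> \<beta>" and \<gamma>: "0 \<le> \<gamma>" and p: "0 \<le> p" and \<epsilon>: "0 < \<epsilon>"
    and Dsym: "\<And>i j. i < N \<Longrightarrow> j < N \<Longrightarrow> D i j = D j i" and Ddiag: "\<And>i. i < N \<Longrightarrow> D i i = 0"
    and pos: "\<And>x. s p * (\<beta> * (\<Sum>i<N. \<Sum>j<N. D i j * x i * x j) + 2 * \<gamma> * field_sq N A x)
        \<le> (1 - \<epsilon>) * norm_sq N x"
  shows "(\<Sum>\<sigma>\<in>spin_configs N. exp (h * (\<Sum>i<N. \<sigma> i)
        + \<beta> / 2 * (\<Sum>i<N. \<Sum>j<N. D i j * (\<sigma> i - s p * h) * (\<sigma> j - s p * h))
        + \<gamma> * field_sq N A (\<lambda>j. \<sigma> j - s p * h)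
        + (\<Sum>i<N. b i * (\<sigma> i - s p * h))))
    \<le> (2 * exp (ln (cosh p) + s p * (h\<^sup>2 - p\<^sup>2) / 2)) ^ N
      * exp (core_const \<beta> \<gamma> K \<epsilon> *
          ((\<Sum>i<N. \<Sum>j<N. (D i j)\<^sup>2) + (frobenius_norm N A)\<^sup>2 + (\<Sum>i<N. (b i)\<^sup>2)))"
proof -
  \<comment> \<open>The factor 2 compensates the halving of the quadratic form in
    \<open>subgaussian_quadratic_form\<close>.\<close>
  define M where "M = (\<lambda>i j. \<beta> * D i j + 2 * \<gamma> * mat_square N A i j)"
  let ?y = "\<lambda>v. v - s p * h"
  let ?F = "(frobenius_norm N A)\<^sup>2"
  let ?L = "2 * exp (ln (cosh p) + s p * (h\<^sup>2 - p\<^sup>2) / 2)"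
  have s: "0 \<le> s p" "s p \<le> 1" using tangent_slope_pos[OF p] tangent_slope_le_1[OF p] by (auto simp: s_def)
  have M_form: "(\<Sum>i<N. \<Sum>j<N. M i j * x i * x j)
      = \<beta> * (\<Sum>i<N. \<Sum>j<N. D i j * x i * x j) + 2 * \<gamma> * field_sq N A x" for x
  proof -
    have "(\<Sum>i<N. \<Sum>j<N. M i j * x i * x j) = \<beta> * (\<Sum>i<N. \<Sum>j<N. D i j * x i * x j)
       + 2 * \<gamma> * (\<Sum>i<N. \<Sum>j<N. mat_square N A i j * x i * x j)"
      unfolding M_def by (simp add: sum.distrib sum_distrib_left algebra_simps)
    then show ?thesis unfolding mat_square_form .
  qed
  have "(\<Sum>f\<in>PiE {..<N} (\<lambda>_. {-1, 1}). (\<Prod>i<N. exp (h * f i)) *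
          exp ((\<Sum>i<N. \<Sum>j<N. M i j * ?y (f i) * ?y (f j)) / 2 + (\<Sum>i<N. b i * ?y (f i))))
        \<le> ?L ^ card {..<N} * exp ((s p * (\<Sum>i<N. M i i) + (s p)\<^sup>2 / \<epsilon> * (\<Sum>i<N. \<Sum>j<N. (M i j)\<^sup>2)
             + s p * (\<Sum>i<N. (b i)\<^sup>2)) / (2 * \<epsilon>))"
  proof (rule subgaussian_quadratic_form)
    show "(\<Sum>v\<in>{-1, 1}. exp (h * v) * exp (\<theta> * ?y v)) \<le> ?L * exp (s p * \<theta>\<^sup>2 / 2)" for \<theta>
      unfolding s_def by (rule spin_exp_sum_le[OF p])
    show "M i j = M j i" if "i \<in> {..<N}" "j \<in> {..<N}" for i j
      using that Dsym by (simp add: M_def mat_square_def mult.commute)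
    show "0 \<le> M i i" if "i \<in> {..<N}" for i
      using that \<gamma> Ddiag by (simp add: M_def mat_square_def sum_nonneg)
    show "s p * (\<Sum>i<N. \<Sum>j<N. M i j * x i * x j) \<le> (1 - \<epsilon>) * norm_sq N x" for x
      unfolding M_form by (rule pos)
  qed (use s \<epsilon> in auto)
  also have "\<dots> \<le> ?L ^ N * exp (core_const \<beta> \<gamma> K \<epsilon> *
          ((\<Sum>i<N. \<Sum>j<N. (D i j)\<^sup>2) + ?F + (\<Sum>i<N. (b i)\<^sup>2)))"
  proof -
    let ?D = "\<Sum>i<N. \<Sum>j<N. (D i j)\<^sup>2" and ?b = "\<Sum>i<N. (b i)\<^sup>2"
    have nn: "0 \<le> ?D" "0 \<le> ?b" "0 \<le> ?F" by (auto intro!: sum_nonneg)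
    have tr: "(\<Sum>i<N. M i i) = 2 * \<gamma> * ?F"
      using Ddiag by (simp add: M_def sum.distrib sum_distrib_left[symmetric] mat_square_trace)
    have fro: "(\<Sum>i<N. \<Sum>j<N. (M i j)\<^sup>2) \<le> 2 * \<beta>\<^sup>2 * ?D + 8 * \<gamma>\<^sup>2 * K\<^sup>2 * ?F"
    proof -
      have "(M i j)\<^sup>2 \<le> 2 * \<beta>\<^sup>2 * (D i j)\<^sup>2 + 8 * \<gamma>\<^sup>2 * (mat_square N A i j)\<^sup>2" for i j
        using sum_squares_bound[of "\<beta> * D i j" "2 * \<gamma> * mat_square N A i j"]
        by (simp add: M_def power2_sum power_mult_distrib)
      then have "(\<Sum>i<N. \<Sum>j<N. (M i j)\<^sup>2)
          \<le> (\<Sum>i<N. \<Sum>j<N. 2 * \<beta>\<^sup>2 * (D i j)\<^sup>2 + 8 * \<gamma>\<^sup>2 * (mat_square N A i j)\<^sup>2)"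
        by (intro sum_mono)
      also have "\<dots> = 2 * \<beta>\<^sup>2 * ?D + 8 * \<gamma>\<^sup>2 * (\<Sum>i<N. \<Sum>j<N. (mat_square N A i j)\<^sup>2)"
        by (simp add: sum.distrib sum_distrib_left)
      also have "\<dots> \<le> 2 * \<beta>\<^sup>2 * ?D + 8 * \<gamma>\<^sup>2 * (K\<^sup>2 * ?F)"
        using mat_square_frobenius_le[OF A K] by (intro add_left_mono mult_left_mono) auto
      finally show ?thesis by (simp add: mult.assoc)
    qed
    let ?c = "2 * \<beta>\<^sup>2 + 8 * \<gamma>\<^sup>2 * K\<^sup>2" and ?T = "?D + ?F + ?b"
    have c: "0 \<le> ?c" by simp
    have T: "0 \<le> ?T" "?F \<le> ?T" "?b \<le> ?T" using nn by auto
    have "s p * (\<Sum>i<N. M i i) \<le> 1 * (2 * \<gamma> * ?T)"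
      unfolding tr using s \<gamma> nn T by (intro mult_mono mult_left_mono) auto
    moreover have "(s p)\<^sup>2 / \<epsilon> * (\<Sum>i<N. \<Sum>j<N. (M i j)\<^sup>2) \<le> 1 / \<epsilon> * (?c * ?T)"
    proof -
      have "2 * \<beta>\<^sup>2 * ?D + 8 * \<gamma>\<^sup>2 * K\<^sup>2 * ?F \<le> ?c * ?D + ?c * ?F"
        using nn by (intro add_mono mult_right_mono) auto
      also have "\<dots> \<le> ?c * ?T" using c nn by (simp add: distrib_left[symmetric] mult_left_mono)
      finally have "(\<Sum>i<N. \<Sum>j<N. (M i j)\<^sup>2) \<le> ?c * ?T" using fro by linarith
      moreover have "(s p)\<^sup>2 / \<epsilon> \<le> 1 / \<epsilon>" using s \<epsilon> by (intro divide_right_mono power_le_one) auto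
      ultimately show ?thesis using s \<epsilon> by (intro mult_mono) (auto intro!: sum_nonneg)
    qed
    moreover have "s p * ?b \<le> 1 * ?T" using s nn T by (intro mult_mono) auto
    ultimately have "s p * (\<Sum>i<N. M i i) + (s p)\<^sup>2 / \<epsilon> * (\<Sum>i<N. \<Sum>j<N. (M i j)\<^sup>2) + s p * ?b
        \<le> (2 * \<gamma> + ?c / \<epsilon> + 1) * ?T"
      by (simp add: distrib_right)
    then have "(s p * (\<Sum>i<N. M i i) + (s p)\<^sup>2 / \<epsilon> * (\<Sum>i<N. \<Sum>j<N. (M i j)\<^sup>2) + s p * ?b) / (2 * \<epsilon>)
        \<le> (2 * \<gamma> + ?c / \<epsilon> + 1) * ?T / (2 * \<epsilon>)"
      using \<epsilon> by (intro divide_right_mono) auto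
    also have "\<dots> = core_const \<beta> \<gamma> K \<epsilon> * ?T" by (simp add: core_const_def)
    finally show ?thesis by (intro mult_mono) auto
  qed
  also have "(\<Sum>f\<in>PiE {..<N} (\<lambda>_. {-1, 1}). (\<Prod>i<N. exp (h * f i)) *
          exp ((\<Sum>i<N. \<Sum>j<N. M i j * ?y (f i) * ?y (f j)) / 2 + (\<Sum>i<N. b i * ?y (f i))))
      = (\<Sum>\<sigma>\<in>spin_configs N. exp (h * (\<Sum>i<N. \<sigma> i)
        + \<beta> / 2 * (\<Sum>i<N. \<Sum>j<N. D i j * ?y (\<sigma> i) * ?y (\<sigma> j))
        + \<gamma> * field_sq N A (\<lambda>j. ?y (\<sigma> j))
        + (\<Sum>i<N. b i * ?y (\<sigma> i))))"
    unfolding spin_configs_def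
  proof (rule sum.cong[OF refl])
    fix f
    have "(\<Prod>i<N. exp (h * f i)) = exp (h * (\<Sum>i<N. f i))"
      by (simp add: exp_sum[symmetric] sum_distrib_left)
    moreover have "(\<Sum>i<N. \<Sum>j<N. M i j * ?y (f i) * ?y (f j)) / 2
        = \<beta> / 2 * (\<Sum>i<N. \<Sum>j<N. D i j * ?y (f i) * ?y (f j))
          + \<gamma> * field_sq N A (\<lambda>j. ?y (f j))"
      unfolding M_form[of "\<lambda>i. ?y (f i)"] by (simp add: field_simps)
    ultimately show "(\<Prod>i<N. exp (h * f i)) *
          exp ((\<Sum>i<N. \<Sum>j<N. M i j * ?y (f i) * ?y (f j)) / 2 + (\<Sum>i<N. b i * ?y (f i)))
        = exp (h * (\<Sum>i<N. f i) + \<beta> / 2 * (\<Sum>i<N. \<Sum>j<N. D i j * ?y (f i) * ?y (f j))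
        + \<gamma> * field_sq N A (\<lambda>j. ?y (f j)) + (\<Sum>i<N. b i * ?y (f i)))"
      by (simp only: mult_exp_exp add.assoc)
  qed
  finally show ?thesis .
qed

section \<open>Centring the Hamiltonian and bounding the partition function from below\<close>

lemma expectation_ising:
  "measure_pmf.expectation (ising_pmf N A \<beta> B) f
    = (\<Sum>\<sigma>\<in>spin_configs N. ising_weight N A \<beta> B \<sigma> * f \<sigma>) / ising_partition N A \<beta> B"
proof -
  have "measure_pmf.expectation (ising_pmf N A \<beta> B) f
      = (\<Sum>\<sigma>\<in>spin_configs N. f \<sigma> * pmf (ising_pmf N A \<beta> B) \<sigma>)"
    by (rule integral_measure_pmf_real[OF finite_spin_configs])
      (auto simp: set_pmf_eq pmf_ising split: if_splits)
  also have "\<dots> = (\<Sum>\<sigma>\<in>spin_configs N. ising_weight N A \<beta> B \<sigma> * f \<sigma> / ising_partition N A \<beta> B)"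
    by (intro sum.cong refl) (simp add: pmf_ising)
  finally show ?thesis by (simp add: sum_divide_distrib)
qed

text \<open>Valid for any real \<open>t\<close>. In the cross term the row sum is split as 1 plus
  its deviation: the 1 goes into the field \<open>\<beta> * t + B\<close>, and only the deviations
  stay in the linear form.\<close>

lemma ising_exponent_centered:
  assumes A: "coupling_matrix N A"
  defines "S \<equiv> row_dev N A"
  shows "\<beta> / 2 * (\<Sum>i<N. \<Sum>j<N. \<sigma> i * A $$ (i, j) * \<sigma> j) + B * (\<Sum>i<N. \<sigma> i)
    = (\<beta> * t + B) * (\<Sum>i<N. \<sigma> i) + \<beta> / 2 * (\<Sum>i<N. \<Sum>j<N. A $$ (i, j) * (\<sigma> i - t) * (\<sigma> j - t))
      + (\<Sum>i<N. \<beta> * t * (row_sum N A i - 1) * (\<sigma> i - t)) + \<beta> * t\<^sup>2 / 2 * (S - N)"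
proof -
  define y where "y = (\<lambda>i. \<sigma> i - t)"
  have \<sigma>: "\<sigma> i = y i + t" for i by (simp add: y_def)
  let ?R = "row_sum N A"
  have R': "(\<Sum>i<N. \<Sum>j<N. A $$ (i, j) * y j) = (\<Sum>j<N. ?R j * y j)"
  proof (subst sum.swap, rule sum.cong[OF refl])
    fix j assume "j \<in> {..<N}"
    then show "(\<Sum>i<N. A $$ (i, j) * y j) = ?R j * y j"
      unfolding row_sum_def sum_distrib_right
      using coupling_matrix_symmetric[OF A] by (intro sum.cong refl) simp
  qed
  have R: "(\<Sum>i<N. \<Sum>j<N. A $$ (i, j) * y i) = (\<Sum>i<N. ?R i * y i)"
    by (simp add: row_sum_def sum_distrib_right)
  have R1: "(\<Sum>i<N. \<Sum>j<N. A $$ (i, j)) = S + N"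
    by (simp add: row_sum_def[symmetric] S_def sum_subtractf)
  have "(\<Sum>i<N. \<Sum>j<N. \<sigma> i * A $$ (i, j) * \<sigma> j)
     = (\<Sum>i<N. \<Sum>j<N. A $$ (i, j) * y i * y j + t * (A $$ (i, j) * y i)
          + t * (A $$ (i, j) * y j) + t\<^sup>2 * A $$ (i, j))"
    unfolding \<sigma> by (intro sum.cong refl) (simp add: algebra_simps power2_eq_square)
  also have "\<dots> = (\<Sum>i<N. \<Sum>j<N. A $$ (i, j) * y i * y j) + t * (\<Sum>i<N. ?R i * y i)
      + t * (\<Sum>i<N. ?R i * y i) + t\<^sup>2 * (S + N)"
    unfolding sum.distrib sum_distrib_left[symmetric] R R' R1 ..
  finally have 1: "(\<Sum>i<N. \<Sum>j<N. \<sigma> i * A $$ (i, j) * \<sigma> j)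
      = (\<Sum>i<N. \<Sum>j<N. A $$ (i, j) * y i * y j) + 2 * t * (\<Sum>i<N. ?R i * y i) + t\<^sup>2 * (S + N)"
    by simp
  have 2: "(\<Sum>i<N. \<beta> * t * (?R i - 1) * y i) = \<beta> * t * ((\<Sum>i<N. ?R i * y i) - (\<Sum>i<N. y i))"
    by (simp add: sum_distrib_left sum_subtractf algebra_simps)
  have 3: "(\<Sum>i<N. \<sigma> i) = (\<Sum>i<N. y i) + N * t" by (simp add: \<sigma> sum.distrib)
  have y: "\<sigma> i - t = y i" for i by (simp add: y_def)
  show ?thesis
    unfolding 1 y unfolding 2 3 by (simp add: field_simps power2_eq_square)
qed

text \<open>Jensen's inequality for the product measure with mean \<open>t = tanh h\<close>, in the form \<open>exp g \<ge> 1 + g\<close>: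
  the quadratic and linear parts of the exponent are centered.\<close>

lemma ising_partition_ge:
  assumes A: "coupling_matrix N A" and t: "t = tanh (\<beta> * t + B)"
  defines "S \<equiv> row_dev N A"
  shows "exp (\<beta> * t\<^sup>2 / 2 * (S - N)) * (2 * cosh (\<beta> * t + B)) ^ N \<le> ising_partition N A \<beta> B"
proof -
  define h where "h = \<beta> * t + B"
  have th: "t = tanh h" using t by (simp add: h_def)
  have zero: "(\<Sum>v\<in>{-1, 1::real}. exp (h * v) * (v - t)) = 0"
  proof -
    have "t * cosh h = sinh h" unfolding th by (simp add: tanh_def)
    then have "t * (exp h + exp (- h)) = exp h - exp (- h)"
      by (simp add: cosh_field_def sinh_field_def)
    then show ?thesis by (simp add: algebra_simps)
  qed
  have prod_exp: "exp (h * (\<Sum>i<N. \<sigma> i)) = (\<Prod>i<N. exp (h * \<sigma> i))" for \<sigma>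
    by (simp add: exp_sum[symmetric] sum_distrib_left)
  have total: "(\<Sum>\<sigma>\<in>spin_configs N. exp (h * (\<Sum>i<N. \<sigma> i))) = (2 * cosh h) ^ N"
  proof -
    have "exp (- h) + exp h = 2 * cosh h" by (simp add: cosh_field_def)
    then show ?thesis unfolding spin_configs_def prod_exp by (subst prod_sum_PiE[symmetric]) auto
  qed
  have lin: "(\<Sum>\<sigma>\<in>spin_configs N. exp (h * (\<Sum>i<N. \<sigma> i)) * (\<sigma> i - t)) = 0" if i: "i < N" for i
  proof -
    have "exp (h * (\<Sum>k<N. \<sigma> k)) * (\<sigma> i - t)
        = (\<Prod>k<N. exp (h * \<sigma> k) * (if k = i then \<sigma> k - t else 1))" for \<sigma>
      unfolding prod_exp prod.distrib using i by simp
    then have "(\<Sum>\<sigma>\<in>spin_configs N. exp (h * (\<Sum>i<N. \<sigma> i)) * (\<sigma> i - t))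
        = (\<Prod>k<N. \<Sum>v\<in>{-1, 1}. exp (h * v) * (if k = i then v - t else 1))"
      unfolding spin_configs_def by (subst prod_sum_PiE) auto
    also have "\<dots> = 0" using i zero by (intro prod_zero bexI[of _ i]) auto
    finally show ?thesis .
  qed
  have quad: "(\<Sum>\<sigma>\<in>spin_configs N. exp (h * (\<Sum>i<N. \<sigma> i)) * ((\<sigma> i - t) * (\<sigma> j - t))) = 0"
    if ij: "i < N" "j < N" "i \<noteq> j" for i j
  proof -
    have "exp (h * (\<Sum>k<N. \<sigma> k)) * ((\<sigma> i - t) * (\<sigma> j - t))
        = (\<Prod>k<N. exp (h * \<sigma> k) * ((if k = i then \<sigma> k - t else 1) * (if k = j then \<sigma> k - t else 1)))" for \<sigma>
      unfolding prod_exp prod.distrib using ij by simp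
    then have "(\<Sum>\<sigma>\<in>spin_configs N. exp (h * (\<Sum>i<N. \<sigma> i)) * ((\<sigma> i - t) * (\<sigma> j - t)))
        = (\<Prod>k<N. \<Sum>v\<in>{-1, 1}. exp (h * v) * ((if k = i then v - t else 1) * (if k = j then v - t else 1)))"
      unfolding spin_configs_def by (subst prod_sum_PiE) auto
    also have "\<dots> = 0" using ij zero by (intro prod_zero bexI[of _ i]) auto
    finally show ?thesis .
  qed
  define g where "g = (\<lambda>\<sigma>. \<beta> / 2 * (\<Sum>i<N. \<Sum>j<N. A $$ (i, j) * (\<sigma> i - t) * (\<sigma> j - t))
      + (\<Sum>i<N. \<beta> * t * (row_sum N A i - 1) * (\<sigma> i - t)))"
  let ?E = "\<lambda>\<sigma>. exp (h * (\<Sum>i<N. \<sigma> i))"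
  have "(\<Sum>\<sigma>\<in>spin_configs N. ?E \<sigma> * g \<sigma>) = 0"
  proof -
    have "(\<Sum>\<sigma>\<in>spin_configs N. ?E \<sigma> * g \<sigma>) =
       (\<Sum>\<sigma>\<in>spin_configs N. (\<Sum>i<N. \<Sum>j<N. \<beta> / 2 * A $$ (i, j) * (?E \<sigma> * ((\<sigma> i - t) * (\<sigma> j - t))))
         + (\<Sum>i<N. \<beta> * t * (row_sum N A i - 1) * (?E \<sigma> * (\<sigma> i - t))))"
      unfolding g_def by (intro sum.cong refl) (simp add: sum_distrib_left distrib_left mult_ac)
    also have "\<dots> = (\<Sum>i<N. \<Sum>j<N. \<beta> / 2 * A $$ (i, j) * (\<Sum>\<sigma>\<in>spin_configs N. ?E \<sigma> * ((\<sigma> i - t) * (\<sigma> j - t))))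
         + (\<Sum>i<N. \<beta> * t * (row_sum N A i - 1) * (\<Sum>\<sigma>\<in>spin_configs N. ?E \<sigma> * (\<sigma> i - t)))"
      unfolding sum.distrib sum_distrib_left
      by (intro arg_cong2[of _ _ _ _ "(+)"])
        (subst sum.swap, intro sum.cong refl, rule sum.swap, rule sum.swap)
    also have "\<dots> = 0"
    proof -
      \<comment> \<open>Distinct sites decouple under the product measure. On the diagonal the
        second moment does not vanish in general, and the zero entry of \<open>A\<close> removes
        it.\<close>
      have "A $$ (i, j) * (\<Sum>\<sigma>\<in>spin_configs N. ?E \<sigma> * ((\<sigma> i - t) * (\<sigma> j - t))) = 0"
        if "i < N" "j < N" for i j
        using quad[OF that] A that by (cases "i = j") (auto simp: coupling_matrix_def)
      then have "(\<Sum>i<N. \<Sum>j<N. \<beta> / 2 * A $$ (i, j)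
          * (\<Sum>\<sigma>\<in>spin_configs N. ?E \<sigma> * ((\<sigma> i - t) * (\<sigma> j - t)))) = 0"
        by (intro sum.neutral ballI) auto
      moreover have "(\<Sum>i<N. \<beta> * t * (row_sum N A i - 1) * (\<Sum>\<sigma>\<in>spin_configs N. ?E \<sigma> * (\<sigma> i - t))) = 0"
        using lin by (intro sum.neutral ballI) auto
      ultimately show ?thesis by simp
    qed
    finally show ?thesis .
  qed
  then have "(2 * cosh h) ^ N = (\<Sum>\<sigma>\<in>spin_configs N. ?E \<sigma> * (1 + g \<sigma>))"
    using total by (simp add: distrib_left sum.distrib)
  also have "\<dots> \<le> (\<Sum>\<sigma>\<in>spin_configs N. ?E \<sigma> * exp (g \<sigma>))"
    by (intro sum_mono mult_left_mono exp_ge_add_one_self) auto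
  finally have "exp (\<beta> * t\<^sup>2 / 2 * (S - N)) * (2 * cosh h) ^ N
      \<le> exp (\<beta> * t\<^sup>2 / 2 * (S - N)) * (\<Sum>\<sigma>\<in>spin_configs N. ?E \<sigma> * exp (g \<sigma>))"
    by (intro mult_left_mono) auto
  also have "\<dots> = (\<Sum>\<sigma>\<in>spin_configs N. exp (\<beta> * t\<^sup>2 / 2 * (S - N)) * (?E \<sigma> * exp (g \<sigma>)))"
    by (rule sum_distrib_left)
  also have "\<dots> = ising_partition N A \<beta> B"
    unfolding ising_partition_def ising_weight_def ising_exponent_centered[OF A, of \<beta> _ B t]
      S_def[symmetric]
    by (intro sum.cong refl) (simp only: g_def h_def mult_exp_exp add_ac)
  finally show ?thesis unfolding h_def .
qed

section \<open>The subcritical regime\<close>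

text \<open>Finitely many exceptional \<open>N\<close> are absorbed by adding their ratios to the
  constant. Where \<open>y N\<close> vanishes no constant can help, hence the second alternative in
  the side condition.\<close>

lemma lesssimI:
  assumes ev: "eventually (\<lambda>N. x N \<le> C * y N) sequentially"
    and pos: "\<And>N. 2 \<le> N \<Longrightarrow> 0 < y N \<or> (0 \<le> y N \<and> x N \<le> 0)"
  shows "lesssim x y"
proof -
  obtain N0 where N0: "\<And>N. N0 \<le> N \<Longrightarrow> x N \<le> C * y N" using ev by (auto simp: eventually_sequentially)
  define C' where "C' = \<bar>C\<bar> + (\<Sum>N<N0. \<bar>x N / y N\<bar>)"
  have C': "\<bar>C\<bar> \<le> C'" "0 \<le> C'" unfolding C'_def by (auto intro!: sum_nonneg add_nonneg_nonneg)
  have "x N \<le> C' * y N" if N: "2 \<le> N" for N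
  proof (cases "0 < y N")
    case True
    show ?thesis
    proof (cases "N0 \<le> N")
      case True
      have "x N \<le> C * y N" by (rule N0[OF True])
      also have "\<dots> \<le> C' * y N" using \<open>0 < y N\<close> C'(1) by (intro mult_right_mono) auto
      finally show ?thesis .
    next
      case False
      then have "\<bar>x N / y N\<bar> \<le> (\<Sum>N<N0. \<bar>x N / y N\<bar>)"
        by (intro member_le_sum) auto
      then have "x N / y N \<le> C'" unfolding C'_def by linarith
      then show ?thesis using True by (simp add: divide_le_eq)
    qed
  next
    case False
    then have "x N \<le> 0" "0 \<le> y N" using pos[OF N] by auto
    then show ?thesis using C'(2) by (meson mult_nonneg_nonneg order_trans)
  qed
  then show ?thesis unfolding lesssim_def by blast
qed

lemma local_field_center:
  "local_field N A \<sigma> i - t = local_field N A (\<lambda>j. \<sigma> j - t) i + t * (row_sum N A i - 1)"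
  unfolding local_field_def row_sum_def
  by (simp add: algebra_simps sum.distrib sum_subtractf sum_distrib_left)

lemma local_field_center_sq_le:
  "(\<Sum>i<N. (local_field N A \<sigma> i - t)\<^sup>2)
    \<le> 2 * field_sq N A (\<lambda>j. \<sigma> j - t) + 2 * t\<^sup>2 * row_dev_sq N A"
proof -
  have "(local_field N A \<sigma> i - t)\<^sup>2
      \<le> 2 * (local_field N A (\<lambda>j. \<sigma> j - t) i)\<^sup>2 + 2 * t\<^sup>2 * (row_sum N A i - 1)\<^sup>2" for i
    unfolding local_field_center[of N A \<sigma> i t]
    using sum_squares_bound[of "local_field N A (\<lambda>j. \<sigma> j - t) i" "t * (row_sum N A i - 1)"]
    by (simp add: power2_sum power_mult_distrib)
  then have "(\<Sum>i<N. (local_field N A \<sigma> i - t)\<^sup>2)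
      \<le> (\<Sum>i<N. 2 * (local_field N A (\<lambda>j. \<sigma> j - t) i)\<^sup>2 + 2 * t\<^sup>2 * (row_sum N A i - 1)\<^sup>2)"
    by (intro sum_mono)
  then show ?thesis by (simp add: sum.distrib sum_distrib_left)
qed

lemma ising_weight_pos: "0 < ising_weight N A \<beta> B \<sigma>"
  by (simp add: ising_weight_def)

lemma spin_configs_nonempty: "spin_configs N \<noteq> {}"
  by (auto simp: spin_configs_def PiE_eq_empty_iff)

lemma ln_expectation_exp_le:
  fixes f :: "(nat \<Rightarrow> real) \<Rightarrow> real"
  assumes "(\<Sum>\<sigma>\<in>spin_configs N. ising_weight N A \<beta> B \<sigma> * exp (f \<sigma>)) \<le> exp X * ising_partition N A \<beta> B"
  shows "ln (measure_pmf.expectation (ising_pmf N A \<beta> B) (\<lambda>\<sigma>. exp (f \<sigma>))) \<le> X"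
proof -
  let ?n = "\<Sum>\<sigma>\<in>spin_configs N. ising_weight N A \<beta> B \<sigma> * exp (f \<sigma>)"
  have Z: "0 < ising_partition N A \<beta> B" by (rule ising_partition_pos)
  have "0 < ?n"
    by (intro sum_pos finite_spin_configs spin_configs_nonempty mult_pos_pos ising_weight_pos) auto
  then have "0 < ?n / ising_partition N A \<beta> B" using Z by simp
  moreover have "?n / ising_partition N A \<beta> B \<le> exp X" using assms Z by (simp add: divide_le_eq)
  ultimately have "ln (?n / ising_partition N A \<beta> B) \<le> ln (exp X)" by (subst ln_le_cancel_iff) auto
  then show ?thesis unfolding expectation_ising by simp
qed

lemma ln_expectation_exp_le_sup:
  fixes f :: "(nat \<Rightarrow> real) \<Rightarrow> real"
  assumes "\<And>\<sigma>. \<sigma> \<in> spin_configs N \<Longrightarrow> f \<sigma> \<le> X"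
  shows "ln (measure_pmf.expectation (ising_pmf N A \<beta> B) (\<lambda>\<sigma>. exp (f \<sigma>))) \<le> X"
proof (rule ln_expectation_exp_le)
  have "(\<Sum>\<sigma>\<in>spin_configs N. ising_weight N A \<beta> B \<sigma> * exp (f \<sigma>))
      \<le> (\<Sum>\<sigma>\<in>spin_configs N. ising_weight N A \<beta> B \<sigma> * exp X)"
    using assms by (intro sum_mono mult_left_mono) (auto simp: less_imp_le[OF ising_weight_pos])
  then show "(\<Sum>\<sigma>\<in>spin_configs N. ising_weight N A \<beta> B \<sigma> * exp (f \<sigma>)) \<le> exp X * ising_partition N A \<beta> B"
    by (simp add: ising_partition_def sum_distrib_left mult.commute)
qed

text \<open>The factor \<open>c * (2 * cosh h) ^ N\<close> of the numerator is the lower bound of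
  the partition function and cancels. What is left is the cost of the quadratic form, of the linear
  form in the row deviations, and of recentring the local fields.\<close>

lemma ln_expectation_subcritical_le:
  assumes A: "coupling_matrix N A" and K: "\<And>i. i < N \<Longrightarrow> row_sum N A i \<le> K"
    and \<beta>: "0 < \<beta>" and \<delta>: "0 < \<delta>" and \<epsilon>: "0 < \<epsilon>" and t: "t = tanh (\<beta> * t + B)"
    and pos: "\<And>x. tangent_slope \<bar>\<beta> * t + B\<bar> * (\<beta> * mat_form N A x
        + 2 * \<delta> * field_sq N A x) \<le> (1 - \<epsilon>) * norm_sq N x"
  defines "\<rho> \<equiv> row_dev_sq N A"
  shows "ln (measure_pmf.expectation (ising_pmf N A \<beta> B)
        (\<lambda>\<sigma>. exp (\<delta> / 2 * (\<Sum>i<N. (local_field N A \<sigma> i - t)\<^sup>2))))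
      \<le> \<delta> * t\<^sup>2 * \<rho> + core_const \<beta> \<delta> K \<epsilon> * (2 * (frobenius_norm N A)\<^sup>2 + \<beta>\<^sup>2 * t\<^sup>2 * \<rho>)"
proof (rule ln_expectation_exp_le)
  define h where "h = \<beta> * t + B"
  define S where "S = row_dev N A"
  define c where "c = exp (\<beta> * t\<^sup>2 / 2 * (S - N))"
  let ?F = "(frobenius_norm N A)\<^sup>2"
  have th: "t = tanh h" using t by (simp add: h_def)
  \<comment> \<open>With contact point \<open>\<bar>h\<bar>\<close> the centre required by
    \<open>spin_quadratic_exp_le\<close> is the mean \<open>t\<close>, and the tangent bound is
    exact at the field.\<close>
  have sh: "tangent_slope \<bar>h\<bar> * h = t"
    using th tangent_slope_mult[of h] by (cases "0 \<le> h") (auto simp: abs_if)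
  define E where "E = (\<lambda>\<sigma>. h * (\<Sum>i<N. \<sigma> i)
        + \<beta> / 2 * (\<Sum>i<N. \<Sum>j<N. A $$ (i, j) * (\<sigma> i - t) * (\<sigma> j - t))
        + \<delta> * field_sq N A (\<lambda>j. \<sigma> j - t)
        + (\<Sum>i<N. \<beta> * t * (row_sum N A i - 1) * (\<sigma> i - t)))"
  have "(\<Sum>\<sigma>\<in>spin_configs N. exp (h * (\<Sum>i<N. \<sigma> i)
        + \<beta> / 2 * (\<Sum>i<N. \<Sum>j<N. A $$ (i, j) * (\<sigma> i - tangent_slope \<bar>h\<bar> * h) * (\<sigma> j - tangent_slope \<bar>h\<bar> * h))
        + \<delta> * field_sq N A (\<lambda>j. \<sigma> j - tangent_slope \<bar>h\<bar> * h)
        + (\<Sum>i<N. \<beta> * t * (row_sum N A i - 1) * (\<sigma> i - tangent_slope \<bar>h\<bar> * h))))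
      \<le> (2 * exp (ln (cosh \<bar>h\<bar>) + tangent_slope \<bar>h\<bar> * (h\<^sup>2 - \<bar>h\<bar>\<^sup>2) / 2)) ^ N
      * exp (core_const \<beta> \<delta> K \<epsilon> * ((\<Sum>i<N. \<Sum>j<N. (A $$ (i, j))\<^sup>2) + ?F
          + (\<Sum>i<N. (\<beta> * t * (row_sum N A i - 1))\<^sup>2)))"
  proof (rule spin_quadratic_exp_le[OF A])
    show "A $$ (i, i) = 0" if "i < N" for i using A that by (simp add: coupling_matrix_def)
    show "A $$ (i, j) = A $$ (j, i)" if "i < N" "j < N" for i j
      by (rule coupling_matrix_symmetric[OF A that])
    show "tangent_slope \<bar>h\<bar> * (\<beta> * mat_form N A x
        + 2 * \<delta> * field_sq N A x) \<le> (1 - \<epsilon>) * norm_sq N x" for x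
      unfolding h_def by (rule pos)
  qed (use K \<beta> \<delta> \<epsilon> in auto)
  then have "(\<Sum>\<sigma>\<in>spin_configs N. exp (E \<sigma>))
      \<le> (2 * exp (ln (cosh \<bar>h\<bar>) + tangent_slope \<bar>h\<bar> * (h\<^sup>2 - \<bar>h\<bar>\<^sup>2) / 2)) ^ N
      * exp (core_const \<beta> \<delta> K \<epsilon> * ((\<Sum>i<N. \<Sum>j<N. (A $$ (i, j))\<^sup>2) + ?F
          + (\<Sum>i<N. (\<beta> * t * (row_sum N A i - 1))\<^sup>2)))"
    unfolding sh E_def .
  also have "2 * exp (ln (cosh \<bar>h\<bar>) + tangent_slope \<bar>h\<bar> * (h\<^sup>2 - \<bar>h\<bar>\<^sup>2) / 2) = 2 * cosh h" by simp
  also have "(\<Sum>i<N. \<Sum>j<N. (A $$ (i, j))\<^sup>2) + ?F + (\<Sum>i<N. (\<beta> * t * (row_sum N A i - 1))\<^sup>2)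
      = 2 * ?F + \<beta>\<^sup>2 * t\<^sup>2 * \<rho>"
    unfolding frobenius_norm_sq \<rho>_def by (simp add: power_mult_distrib sum_distrib_left)
  finally have core: "(\<Sum>\<sigma>\<in>spin_configs N. exp (E \<sigma>))
      \<le> (2 * cosh h) ^ N * exp (core_const \<beta> \<delta> K \<epsilon> * (2 * ?F + \<beta>\<^sup>2 * t\<^sup>2 * \<rho>))" .
  have "(\<Sum>\<sigma>\<in>spin_configs N. ising_weight N A \<beta> B \<sigma>
          * exp (\<delta> / 2 * (\<Sum>i<N. (local_field N A \<sigma> i - t)\<^sup>2)))
      \<le> (\<Sum>\<sigma>\<in>spin_configs N. exp (\<delta> * t\<^sup>2 * \<rho>) * c * exp (E \<sigma>))"
  proof (rule sum_mono)
    fix \<sigma>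
    have "\<delta> / 2 * (\<Sum>i<N. (local_field N A \<sigma> i - t)\<^sup>2)
        \<le> \<delta> / 2 * (2 * field_sq N A (\<lambda>j. \<sigma> j - t) + 2 * t\<^sup>2 * \<rho>)"
      unfolding \<rho>_def using \<delta> by (intro mult_left_mono local_field_center_sq_le) auto
    then have le: "\<delta> / 2 * (\<Sum>i<N. (local_field N A \<sigma> i - t)\<^sup>2)
        \<le> \<delta> * field_sq N A (\<lambda>j. \<sigma> j - t) + \<delta> * t\<^sup>2 * \<rho>"
      by (simp add: algebra_simps)
    have "ising_weight N A \<beta> B \<sigma> * exp (\<delta> / 2 * (\<Sum>i<N. (local_field N A \<sigma> i - t)\<^sup>2))
        = exp (h * (\<Sum>i<N. \<sigma> i) + \<beta> / 2 * (\<Sum>i<N. \<Sum>j<N. A $$ (i, j) * (\<sigma> i - t) * (\<sigma> j - t))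
          + (\<Sum>i<N. \<beta> * t * (row_sum N A i - 1) * (\<sigma> i - t)) + \<beta> * t\<^sup>2 / 2 * (S - N)
          + \<delta> / 2 * (\<Sum>i<N. (local_field N A \<sigma> i - t)\<^sup>2))"
      unfolding ising_weight_def ising_exponent_centered[OF A, of \<beta> \<sigma> B t] S_def[symmetric]
        h_def[symmetric] mult_exp_exp ..
    also have "\<dots> \<le> exp (\<delta> * t\<^sup>2 * \<rho> + \<beta> * t\<^sup>2 / 2 * (S - N) + E \<sigma>)"
      using le by (simp add: E_def)
    also have "\<dots> = exp (\<delta> * t\<^sup>2 * \<rho>) * c * exp (E \<sigma>)" by (simp add: c_def exp_add)
    finally show "ising_weight N A \<beta> B \<sigma> * exp (\<delta> / 2 * (\<Sum>i<N. (local_field N A \<sigma> i - t)\<^sup>2))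
        \<le> exp (\<delta> * t\<^sup>2 * \<rho>) * c * exp (E \<sigma>)" .
  qed
  also have "\<dots> = exp (\<delta> * t\<^sup>2 * \<rho>) * c * (\<Sum>\<sigma>\<in>spin_configs N. exp (E \<sigma>))"
    by (rule sum_distrib_left[symmetric])
  also have "\<dots> \<le> exp (\<delta> * t\<^sup>2 * \<rho>) * c
      * ((2 * cosh h) ^ N * exp (core_const \<beta> \<delta> K \<epsilon> * (2 * ?F + \<beta>\<^sup>2 * t\<^sup>2 * \<rho>)))"
    using core by (intro mult_left_mono) (auto simp: c_def)
  also have "\<dots> = exp (\<delta> * t\<^sup>2 * \<rho> + core_const \<beta> \<delta> K \<epsilon> * (2 * ?F + \<beta>\<^sup>2 * t\<^sup>2 * \<rho>)) * (c * (2 * cosh h) ^ N)"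
    by (simp add: exp_add)
  also have "\<dots> \<le> exp (\<delta> * t\<^sup>2 * \<rho> + core_const \<beta> \<delta> K \<epsilon> * (2 * ?F + \<beta>\<^sup>2 * t\<^sup>2 * \<rho>)) * ising_partition N A \<beta> B"
    using ising_partition_ge[OF A t] unfolding c_def S_def h_def by (intro mult_left_mono) auto
  finally show "(\<Sum>\<sigma>\<in>spin_configs N. ising_weight N A \<beta> B \<sigma>
          * exp (\<delta> / 2 * (\<Sum>i<N. (local_field N A \<sigma> i - t)\<^sup>2)))
      \<le> exp (\<delta> * t\<^sup>2 * \<rho> + core_const \<beta> \<delta> K \<epsilon> * (2 * ?F + \<beta>\<^sup>2 * t\<^sup>2 * \<rho>)) * ising_partition N A \<beta> B" .
qed

lemma frobenius_eq_0_imp_local_field: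
  assumes "(frobenius_norm N A)\<^sup>2 = 0" "i < N"
  shows "local_field N A \<sigma> i = 0" "row_sum N A i = 0"
proof -
  have z: "(\<Sum>j<N. (A $$ (i, j))\<^sup>2) = 0"
    using assms unfolding frobenius_norm_sq
    by (subst (asm) sum_nonneg_eq_0_iff) (auto intro!: sum_nonneg)
  have "A $$ (i, j) = 0" if "j < N" for j
    using z that by (subst (asm) sum_nonneg_eq_0_iff) auto
  then show "local_field N A \<sigma> i = 0" "row_sum N A i = 0"
    by (simp_all add: local_field_def row_sum_def)
qed

text \<open>If the bound vanishes, all entries of \<open>A\<close> do, so every row sum is 0 and the
  squared deviations add up to \<open>N\<close>; this forces \<open>t = 0\<close>. Then local fields
  and centre vanish and the exponent is 0.\<close>

lemma theta_rhs_pos_or_trivial: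
  fixes c :: "(nat \<Rightarrow> real) \<Rightarrow> real" and A :: "real mat"
  assumes N: "2 \<le> N" and c: "t = 0 \<Longrightarrow> (\<And>\<sigma>. c \<sigma> = 0)"
  defines "y \<equiv> (frobenius_norm N A)\<^sup>2 + t\<^sup>2 * row_dev_sq N A"
  shows "0 < y \<or> (0 \<le> y \<and> ln (measure_pmf.expectation (ising_pmf N A \<beta> B)
    (\<lambda>\<sigma>. exp (\<delta> / 2 * (\<Sum>i<N. (local_field N A \<sigma> i - c \<sigma>)\<^sup>2)))) \<le> 0)"
proof (cases "0 < y")
  case False
  let ?\<rho> = "row_dev_sq N A"
  have nn: "0 \<le> (frobenius_norm N A)\<^sup>2" "0 \<le> t\<^sup>2 * ?\<rho>" by (auto intro!: mult_nonneg_nonneg sum_nonneg)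
  then have F: "(frobenius_norm N A)\<^sup>2 = 0" and t\<rho>: "t\<^sup>2 * ?\<rho> = 0" using False unfolding y_def by linarith+
  have "?\<rho> = N" using frobenius_eq_0_imp_local_field(2)[OF F] by simp
  then have "t = 0" using t\<rho> N by auto
  then have "(\<Sum>i<N. (local_field N A \<sigma> i - c \<sigma>)\<^sup>2) = 0" for \<sigma>
    using frobenius_eq_0_imp_local_field(1)[OF F] c by (intro sum.neutral) auto
  then have "ln (measure_pmf.expectation (ising_pmf N A \<beta> B)
    (\<lambda>\<sigma>. exp (\<delta> / 2 * (\<Sum>i<N. (local_field N A \<sigma> i - c \<sigma>)\<^sup>2)))) \<le> 0"
    by (intro ln_expectation_exp_le_sup) simp
  moreover have "0 \<le> y" using nn unfolding y_def by linarith
  ultimately show ?thesis by blast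
qed simp

lemma coupling_sequence_row_sum_bound:
  assumes "lesssim (\<lambda>N. Max (row_sum N (A N) ` {..<N})) (\<lambda>_. 1)"
  obtains K where "0 \<le> K" "\<And>N i. 2 \<le> N \<Longrightarrow> i < N \<Longrightarrow> row_sum N (A N) i \<le> K"
proof -
  obtain C where C: "\<And>N. 2 \<le> N \<Longrightarrow> Max (row_sum N (A N) ` {..<N}) \<le> C"
    using assms unfolding lesssim_def by auto
  show ?thesis
  proof (rule that[of "max C 0"])
    fix N i :: nat assume "2 \<le> N" "i < N"
    then have "row_sum N (A N) i \<le> Max (row_sum N (A N) ` {..<N})" by (intro Max_ge) auto
    also have "\<dots> \<le> C" by (rule C[OF \<open>2 \<le> N\<close>])
    finally show "row_sum N (A N) i \<le> max C 0" by simp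
  qed simp
qed

lemma rayleigh_le_eigenvalue1:
  assumes A: "coupling_matrix N A" and N: "2 \<le> N"
  shows "mat_form N A x \<le> eigenvalue_desc 1 A * norm_sq N x"
proof -
  obtain u where u: "(\<Sum>i<N. (u i)\<^sup>2) = 1" "eigenvalue_desc 2 A \<le> eigenvalue_desc 1 A"
    and ray: "mat_form N A x \<le> eigenvalue_desc 2 A * norm_sq N x
       + (eigenvalue_desc 1 A - eigenvalue_desc 2 A) * (\<Sum>i<N. u i * x i)\<^sup>2"
    using rayleigh_eigenvalue_desc[OF A N] by blast
  have "(\<Sum>i<N. u i * x i)\<^sup>2 \<le> norm_sq N x" using sum_mult_sq_le[of u x "{..<N}"] u(1) by simp
  then have "(eigenvalue_desc 1 A - eigenvalue_desc 2 A) * (\<Sum>i<N. u i * x i)\<^sup>2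
      \<le> (eigenvalue_desc 1 A - eigenvalue_desc 2 A) * norm_sq N x"
    using u(2) by (intro mult_left_mono) auto
  then show ?thesis using ray by (simp add: algebra_simps)
qed

lemma ln_expectation_lesssim_Theta1:
  assumes A: "\<forall>N\<ge>2. coupling_matrix N (A N)"
    and row: "lesssim (\<lambda>N. Max (row_sum N (A N) ` {..<N})) (\<lambda>_. 1)"
    and ev1: "(\<lambda>N. eigenvalue_desc 1 (A N)) \<longlonglongrightarrow> 1"
    and \<beta>B: "(\<beta>, B) \<in> Theta1"
  shows "\<exists>\<delta>>0. lesssim
          (\<lambda>N. ln (measure_pmf.expectation (ising_pmf N (A N) \<beta> B)
             (\<lambda>\<sigma>. exp (\<delta> / 2 * (\<Sum>i<N. (local_field N (A N) \<sigma> i - mf_root \<beta> B)\<^sup>2)))))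
          (\<lambda>N. (frobenius_norm N (A N))\<^sup>2
             + (mf_root \<beta> B)\<^sup>2 * row_dev_sq N (A N))"
proof -
  obtain K where K0: "0 \<le> K" and K: "\<And>N i. 2 \<le> N \<Longrightarrow> i < N \<Longrightarrow> row_sum N (A N) i \<le> K"
    by (rule coupling_sequence_row_sum_bound[OF row]) (rule that)
  define t where "t = mf_root \<beta> B"
  note m = mf_root_Theta1[OF \<beta>B, folded t_def]
  define s where "s = tangent_slope \<bar>\<beta> * t + B\<bar>"
  have s: "0 < s" "s \<le> 1" unfolding s_def by (auto intro: tangent_slope_pos tangent_slope_le_1)
  \<comment> \<open>The spectral margin is \<open>4 * \<epsilon>\<close>:
    \<open>2 * \<epsilon>\<close> goes to the convergence of the top eigenvalue,
    \<open>\<epsilon>\<close> to the squared local fields through the choice of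
    \<open>\<delta>\<close>, and \<open>\<epsilon>\<close> is kept.\<close>
  define \<epsilon> where "\<epsilon> = (1 - \<beta> * s) / 4"
  have \<epsilon>: "0 < \<epsilon>" "\<beta> * s = 1 - 4 * \<epsilon>"
    using m(3) unfolding s_def[symmetric] by (auto simp: \<epsilon>_def field_simps)
  define \<delta> where "\<delta> = \<epsilon> / (2 * (K\<^sup>2 + 1))"
  have K1: "0 < K\<^sup>2 + 1" by (simp add: add_nonneg_pos)
  have \<delta>: "0 < \<delta>" "2 * \<delta> * K\<^sup>2 \<le> \<epsilon>"
    using \<epsilon>(1) K1 by (auto simp: \<delta>_def field_simps)
  define C where "C = \<delta> + core_const \<beta> \<delta> K \<epsilon> * (2 + \<beta>\<^sup>2)"
  have cc: "0 \<le> core_const \<beta> \<delta> K \<epsilon>" using \<delta>(1) \<epsilon>(1) by (intro core_const_nonneg) auto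
  have "(\<lambda>N. \<beta> * s * eigenvalue_desc 1 (A N)) \<longlonglongrightarrow> \<beta> * s * 1" by (intro tendsto_intros ev1)
  then have "eventually (\<lambda>N. \<beta> * s * eigenvalue_desc 1 (A N) < 1 - 2 * \<epsilon>) sequentially"
    using \<epsilon> by (intro order_tendstoD(2)) auto
  then have "eventually (\<lambda>N. ln (measure_pmf.expectation (ising_pmf N (A N) \<beta> B)
             (\<lambda>\<sigma>. exp (\<delta> / 2 * (\<Sum>i<N. (local_field N (A N) \<sigma> i - t)\<^sup>2))))
      \<le> C * ((frobenius_norm N (A N))\<^sup>2 + t\<^sup>2 * row_dev_sq N (A N))) sequentially"
    using eventually_ge_at_top[of 2]
  proof eventually_elim
    case (elim N)
    have AN: "coupling_matrix N (A N)" using A elim(2) by blast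
    let ?F = "(frobenius_norm N (A N))\<^sup>2" and ?\<rho> = "row_dev_sq N (A N)"
    have "s * (\<beta> * mat_form N (A N) x
        + 2 * \<delta> * field_sq N (A N) x) \<le> (1 - \<epsilon>) * norm_sq N x" for x
    proof -
      let ?X = "norm_sq N x"
      have X: "0 \<le> ?X" by (intro sum_nonneg) auto
      have "\<beta> * s * mat_form N (A N) x \<le> \<beta> * s * (eigenvalue_desc 1 (A N) * ?X)"
        using m(1) s(1) by (intro mult_left_mono rayleigh_le_eigenvalue1 AN elim) auto
      also have "\<dots> \<le> (1 - 2 * \<epsilon>) * ?X"
        using elim(1) X mult_right_mono[of "\<beta> * s * eigenvalue_desc 1 (A N)" "1 - 2 * \<epsilon>" ?X] by simp
      finally have 1: "s * (\<beta> * mat_form N (A N) x) \<le> (1 - 2 * \<epsilon>) * ?X"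
        by (simp add: mult_ac)
      have "s * (2 * \<delta> * field_sq N (A N) x) \<le> 1 * (2 * \<delta> * (K\<^sup>2 * ?X))"
        using s \<delta> X K[OF elim(2)]
        by (intro mult_mono mult_left_mono local_field_sq_sum_le AN mult_nonneg_nonneg sum_nonneg) auto
      also have "\<dots> \<le> \<epsilon> * ?X" using mult_right_mono[OF \<delta>(2) X] by (simp add: mult.assoc)
      finally show ?thesis using 1 by (simp add: algebra_simps)
    qed
    then have "ln (measure_pmf.expectation (ising_pmf N (A N) \<beta> B)
             (\<lambda>\<sigma>. exp (\<delta> / 2 * (\<Sum>i<N. (local_field N (A N) \<sigma> i - t)\<^sup>2))))
        \<le> \<delta> * t\<^sup>2 * ?\<rho> + core_const \<beta> \<delta> K \<epsilon> * (2 * ?F + \<beta>\<^sup>2 * t\<^sup>2 * ?\<rho>)"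
      unfolding s_def using K[OF elim(2)] m(1,2) \<delta>(1) \<epsilon>(1)
      by (intro ln_expectation_subcritical_le AN) auto
    also have "\<dots> \<le> C * (?F + t\<^sup>2 * ?\<rho>)"
    proof -
      have nn: "0 \<le> ?F" "0 \<le> t\<^sup>2 * ?\<rho>" by (auto intro!: mult_nonneg_nonneg sum_nonneg)
      have "2 * ?F + \<beta>\<^sup>2 * t\<^sup>2 * ?\<rho> \<le> (2 + \<beta>\<^sup>2) * (?F + t\<^sup>2 * ?\<rho>)"
        using nn mult_nonneg_nonneg[of "\<beta>\<^sup>2" ?F] by (simp add: algebra_simps)
      from mult_left_mono[OF this cc] have "core_const \<beta> \<delta> K \<epsilon> * (2 * ?F + \<beta>\<^sup>2 * t\<^sup>2 * ?\<rho>)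
          \<le> core_const \<beta> \<delta> K \<epsilon> * (2 + \<beta>\<^sup>2) * (?F + t\<^sup>2 * ?\<rho>)" by (simp add: mult.assoc)
      moreover have "\<delta> * t\<^sup>2 * ?\<rho> \<le> \<delta> * (?F + t\<^sup>2 * ?\<rho>)"
        unfolding mult.assoc using \<delta>(1) nn by (intro mult_left_mono) auto
      ultimately show ?thesis by (simp add: C_def distrib_right)
    qed
    finally show ?case .
  qed
  then have "lesssim (\<lambda>N. ln (measure_pmf.expectation (ising_pmf N (A N) \<beta> B)
             (\<lambda>\<sigma>. exp (\<delta> / 2 * (\<Sum>i<N. (local_field N (A N) \<sigma> i - t)\<^sup>2)))))
      (\<lambda>N. (frobenius_norm N (A N))\<^sup>2 + t\<^sup>2 * row_dev_sq N (A N))"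
    by (rule lesssimI) (rule theta_rhs_pos_or_trivial, auto)
  then show ?thesis using \<delta>(1) unfolding t_def by blast
qed

section \<open>Linearization of the magnetization\<close>

text \<open>If the row sums are close to 1 on average, the constant vector is close to the top eigenvector, so
  the spectral gap survives on subtracting the projection onto constants.\<close>

lemma spectral_gap_off_constants:
  fixes \<theta> :: real
  assumes A: "coupling_matrix N A" and N: "2 \<le> N" and \<kappa>: "0 < \<kappa>" "\<kappa> \<le> 1 / 4"
    and gap: "eigenvalue_desc 2 A \<le> (1 - \<kappa>) * eigenvalue_desc 1 A"
    and l1: "0 < eigenvalue_desc 1 A" "eigenvalue_desc 1 A \<le> 2"
    and S: "\<bar>\<Sum>i<N. (row_sum N A i - 1)\<bar> \<le> \<theta> * N"
  shows "mat_form N A x - (\<Sum>i<N. x i)\<^sup>2 / N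
    \<le> ((1 - \<kappa>) * eigenvalue_desc 1 A + 2 * (eigenvalue_desc 1 A - 1 + \<theta>)) * norm_sq N x"
proof -
  define l1 where "l1 = eigenvalue_desc 1 A"
  define \<mu> where "\<mu> = (1 - \<kappa>) * l1"
  obtain u where u: "(\<Sum>i<N. (u i)\<^sup>2) = 1"
    and ray: "\<And>x. mat_form N A x \<le> eigenvalue_desc 2 A * norm_sq N x
       + (l1 - eigenvalue_desc 2 A) * (\<Sum>i<N. u i * x i)\<^sup>2"
    using rayleigh_eigenvalue_desc[OF A N] unfolding l1_def by blast
  have Npos: "0 < real N" using N by simp
  have ray2: "mat_form N A x
      \<le> \<mu> * norm_sq N x + \<kappa> * l1 * (\<Sum>i<N. u i * x i)\<^sup>2" for x
  proof -
    have "(\<Sum>i<N. u i * x i)\<^sup>2 \<le> norm_sq N x" using sum_mult_sq_le[of u x "{..<N}"] u by simp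
    then have "(\<mu> - eigenvalue_desc 2 A) * (\<Sum>i<N. u i * x i)\<^sup>2
        \<le> (\<mu> - eigenvalue_desc 2 A) * norm_sq N x"
      using gap unfolding \<mu>_def l1_def by (intro mult_left_mono) auto
    then show ?thesis using ray[of x] by (simp add: \<mu>_def algebra_simps)
  qed
  define U where "U = (\<Sum>i<N. u i)"
  \<comment> \<open>Squared distance from the unit vector \<open>u\<close> to the line of constant
    vectors.\<close>
  define \<tau> where "\<tau> = 1 - U\<^sup>2 / N"
  have U2: "U\<^sup>2 \<le> N" using sum_mult_sq_le[of u "\<lambda>_. 1" "{..<N}"] u by (simp add: U_def)
  \<comment> \<open>The Rayleigh bound tested on the all-ones vector, whose form is \<open>N\<close>
    plus the sum of row deviations: a vector \<open>u\<close> far from the constants would make the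
    bound too small.\<close>
  have \<kappa>\<tau>: "\<kappa> * l1 * \<tau> \<le> l1 - 1 + \<theta>"
  proof -
    have "(\<Sum>i<N. \<Sum>j<N. A $$ (i, j) * 1 * 1) = row_dev N A + N"
      by (simp add: row_sum_def[symmetric] sum_subtractf)
    then have "(1 - \<theta>) * N \<le> (\<Sum>i<N. \<Sum>j<N. A $$ (i, j) * 1 * 1)"
      using S by (simp add: algebra_simps)
    also have "\<dots> \<le> \<mu> * N + \<kappa> * l1 * U\<^sup>2" using ray2[of "\<lambda>_. 1"] by (simp add: U_def)
    also have "\<dots> = (\<mu> + \<kappa> * l1 * (U\<^sup>2 / N)) * N" using Npos by (simp add: field_simps)
    finally have "1 - \<theta> \<le> \<mu> + \<kappa> * l1 * (U\<^sup>2 / N)" using Npos by simp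
    then show ?thesis by (simp add: \<tau>_def \<mu>_def algebra_simps)
  qed
  let ?X = "norm_sq N x"
  define e where "e = (\<Sum>i<N. x i)"
  have X: "0 \<le> ?X" by (intro sum_nonneg) auto
  have ux: "(\<Sum>i<N. u i * x i)\<^sup>2 \<le> 2 * (e\<^sup>2 / N) + 2 * \<tau> * ?X"
  proof -
    define p where "p = (\<lambda>i. u i - U / N)"
    have "(\<Sum>i<N. u i * x i) = U * e / N + (\<Sum>i<N. p i * x i)"
      by (simp add: p_def e_def sum_subtractf left_diff_distrib sum_divide_distrib[symmetric] sum_distrib_left[symmetric])
    then have "(\<Sum>i<N. u i * x i)\<^sup>2 \<le> 2 * (U * e / N)\<^sup>2 + 2 * (\<Sum>i<N. p i * x i)\<^sup>2"
      using sum_squares_bound[of "U * e / N" "\<Sum>i<N. p i * x i"] by (simp add: power2_sum)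
    moreover have "(\<Sum>i<N. p i * x i)\<^sup>2 \<le> \<tau> * ?X"
    proof -
      have "(\<Sum>i<N. (p i)\<^sup>2) = (\<Sum>i<N. (u i)\<^sup>2 - 2 * (U / N) * u i + (U / N)\<^sup>2)"
        by (simp add: p_def power2_diff algebra_simps)
      also have "\<dots> = 1 - 2 * (U / N) * U + N * (U / N)\<^sup>2"
        unfolding sum.distrib sum_subtractf sum_distrib_left[symmetric] u by (simp add: U_def)
      also have "\<dots> = \<tau>" using Npos by (simp add: \<tau>_def power2_eq_square field_simps)
      finally show ?thesis using sum_mult_sq_le[of p x "{..<N}"] by simp
    qed
    moreover have "(U * e / N)\<^sup>2 \<le> e\<^sup>2 / N"
    proof -
      have "(U * e / N)\<^sup>2 = (U\<^sup>2 / N) * (e\<^sup>2 / N)" by (simp add: power2_eq_square)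
      also have "\<dots> \<le> 1 * (e\<^sup>2 / N)" using U2 Npos by (intro mult_right_mono) (auto simp: divide_le_eq_1)
      finally show ?thesis by simp
    qed
    ultimately show ?thesis by (simp add: mult.assoc)
  qed
  \<comment> \<open>The second bound, from \<open>\<kappa> \<le> 1 / 4\<close> and a top eigenvalue
    of at most 2, keeps the coefficient of \<open>e\<^sup>2 / N\<close> at most 1, so that the
    subtracted projection onto constants compensates it.\<close>
  have k0: "0 \<le> \<kappa> * l1" "\<kappa> * l1 * 2 \<le> 1"
  proof -
    show "0 \<le> \<kappa> * l1" using \<kappa> l1 by (simp add: l1_def)
    have "\<kappa> * l1 \<le> 1 / 4 * 2" using \<kappa> l1 unfolding l1_def by (intro mult_mono) auto
    then show "\<kappa> * l1 * 2 \<le> 1" by simp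
  qed
  have "\<kappa> * l1 * (\<Sum>i<N. u i * x i)\<^sup>2 \<le> \<kappa> * l1 * (2 * (e\<^sup>2 / N) + 2 * \<tau> * ?X)"
    using k0 ux by (intro mult_left_mono)
  also have "\<dots> = (\<kappa> * l1 * 2) * (e\<^sup>2 / N) + 2 * (\<kappa> * l1 * \<tau>) * ?X" by (simp add: algebra_simps)
  also have "\<dots> \<le> 1 * (e\<^sup>2 / N) + 2 * (l1 - 1 + \<theta>) * ?X"
    using k0 \<kappa>\<tau> X by (intro add_mono mult_right_mono mult_left_mono) auto
  finally show ?thesis using ray2[of x] unfolding e_def \<mu>_def l1_def by (simp add: algebra_simps)
qed

text \<open>\<open>A - J / N + I / N\<close> with \<open>J\<close> the all-ones matrix; adding \<open>I / N\<close> keeps the diagonal zero.\<close>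

definition mean_removed :: "nat \<Rightarrow> real mat \<Rightarrow> nat \<Rightarrow> nat \<Rightarrow> real" where
  "mean_removed N A i j = A $$ (i, j) - (if i = j then 0 else 1 / N)"

abbreviation (input) mean_removed_form :: "nat \<Rightarrow> real mat \<Rightarrow> (nat \<Rightarrow> real) \<Rightarrow> real" where
  "mean_removed_form N A x \<equiv> \<Sum>i<N. \<Sum>j<N. mean_removed N A i j * x i * x j"

lemma mean_removed_form_eq:
  "mean_removed_form N A x
    = mat_form N A x - (\<Sum>i<N. x i)\<^sup>2 / N + norm_sq N x / N"
proof -
  have "(\<Sum>j<N. mean_removed N A i j * x i * x j)
      = (\<Sum>j<N. A $$ (i, j) * x i * x j) - x i * (\<Sum>j<N. x j) / N + (x i)\<^sup>2 / N" if "i < N" for i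
  proof -
    have "(\<Sum>j<N. mean_removed N A i j * x i * x j)
       = (\<Sum>j<N. A $$ (i, j) * x i * x j - x i * x j / N + (if i = j then (x i)\<^sup>2 / N else 0))"
      by (intro sum.cong refl) (auto simp: mean_removed_def power2_eq_square algebra_simps)
    then show ?thesis
      using that by (simp add: sum.distrib sum_subtractf sum_divide_distrib sum_distrib_left)
  qed
  then have "mean_removed_form N A x
      = (\<Sum>i<N. (\<Sum>j<N. A $$ (i, j) * x i * x j) - x i * (\<Sum>j<N. x j) / N + (x i)\<^sup>2 / N)"
    by (intro sum.cong refl) simp
  also have "\<dots> = mat_form N A x - (\<Sum>i<N. x i) * (\<Sum>j<N. x j) / N
      + norm_sq N x / N"
    by (simp only: sum.distrib sum_subtractf sum_divide_distrib[symmetric] sum_distrib_right[symmetric])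
  finally show ?thesis by (simp add: power2_eq_square)
qed

text \<open>The matrix \<open>J / N\<close> has Frobenius norm 1, so removing the mean costs only an
  additive constant.\<close>

lemma mean_removed_sq_sum_le:
  assumes "0 < N"
  shows "(\<Sum>i<N. \<Sum>j<N. (mean_removed N A i j)\<^sup>2) \<le> 2 * (frobenius_norm N A)\<^sup>2 + 2"
proof -
  have "(mean_removed N A i j)\<^sup>2 \<le> 2 * (A $$ (i, j))\<^sup>2 + 2 * (1 / N)\<^sup>2" for i j
  proof -
    define b where "b = (if i = j then 0 else 1 / real N)"
    have "(mean_removed N A i j)\<^sup>2 \<le> 2 * (A $$ (i, j))\<^sup>2 + 2 * b\<^sup>2"
      using zero_le_power2[of "A $$ (i, j) + b"]
      unfolding mean_removed_def b_def[symmetric] by (simp add: power2_sum power2_diff)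
    moreover have "b\<^sup>2 \<le> (1 / N)\<^sup>2" by (simp add: b_def)
    ultimately show ?thesis by linarith
  qed
  then have "(\<Sum>i<N. \<Sum>j<N. (mean_removed N A i j)\<^sup>2)
      \<le> (\<Sum>i<N. \<Sum>j<N. 2 * (A $$ (i, j))\<^sup>2 + 2 * (1 / N)\<^sup>2)"
    by (intro sum_mono)
  also have "\<dots> = 2 * (frobenius_norm N A)\<^sup>2 + N * (N * (2 * (1 / N)\<^sup>2))"
    by (simp add: sum.distrib sum_distrib_left frobenius_norm_sq)
  also have "N * (N * (2 * (1 / N)\<^sup>2)) = (2::real)" using assms by (simp add: power2_eq_square)
  finally show ?thesis .
qed

text \<open>Rounding down; \<open>nat\<close> truncates only for negative magnetization, which the
  spin flip removes. The spacing \<open>1 / sqrt N\<close> balances the loss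
  \<open>N * (m - w)\<^sup>2 \<le> 1\<close> in the exponent against at most
  \<open>sqrt N + 1\<close> grid points.\<close>

definition grid_index :: "nat \<Rightarrow> (nat \<Rightarrow> real) \<Rightarrow> nat" where
  "grid_index N \<sigma> = nat \<lfloor>spin_mean N \<sigma> * sqrt N\<rfloor>"

definition grid_point :: "nat \<Rightarrow> nat \<Rightarrow> real" where
  "grid_point N k = k / sqrt N"

lemma spin_sum_le: "\<sigma> \<in> spin_configs N \<Longrightarrow> (\<Sum>i<N. \<sigma> i) \<le> N"
proof -
  assume \<sigma>: "\<sigma> \<in> spin_configs N"
  have "(\<Sum>i<N. \<sigma> i) \<le> (\<Sum>i<N. 1)"
    using \<sigma> by (intro sum_mono) (auto simp: spin_configs_def PiE_def Pi_def)
  then show ?thesis by simp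
qed

lemma grid_index_le:
  assumes N: "0 < N" and \<sigma>: "\<sigma> \<in> spin_configs N"
  shows "grid_index N \<sigma> \<le> nat \<lfloor>sqrt N\<rfloor>"
proof -
  have "spin_mean N \<sigma> \<le> 1" using spin_sum_le[OF \<sigma>] N by (simp add: spin_mean_def)
  then have "spin_mean N \<sigma> * sqrt N \<le> 1 * sqrt N" by (intro mult_right_mono) auto
  then show ?thesis unfolding grid_index_def by (intro nat_mono floor_mono) simp
qed

lemma grid_point_bounds:
  assumes N: "0 < N" and k: "k \<le> nat \<lfloor>sqrt N\<rfloor>"
  shows "0 \<le> grid_point N k" "grid_point N k \<le> 1"
proof -
  have "real k \<le> sqrt N" using k by (simp add: le_nat_iff le_floor_iff)
  then show "0 \<le> grid_point N k" "grid_point N k \<le> 1" using N by (auto simp: grid_point_def)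
qed

text \<open>A discrete Hubbard--Stratonovich linearization: the square is replaced by its tangent at the grid
  point of spacing \<open>1 / sqrt N\<close> below the magnetization, at the cost of the constant \<open>1\<close>.\<close>

lemma square_le_tangent_at_grid:
  assumes N: "0 < N" and pos: "0 \<le> spin_mean N \<sigma>"
  defines "w \<equiv> grid_point N (grid_index N \<sigma>)"
  shows "(\<Sum>i<N. \<sigma> i)\<^sup>2 / N \<le> 2 * w * (\<Sum>i<N. \<sigma> i) - N * w\<^sup>2 + 1"
proof -
  define m where "m = spin_mean N \<sigma>"
  have sq: "0 < sqrt N" "sqrt N * sqrt N = N" using N by auto
  have "0 \<le> m * sqrt N" using pos by (simp add: m_def)
  then have "real (grid_index N \<sigma>) = of_int \<lfloor>m * sqrt N\<rfloor>" by (simp add: grid_index_def m_def)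
  then have ws: "w * sqrt N = of_int \<lfloor>m * sqrt N\<rfloor>" using sq by (simp add: w_def grid_point_def)
  have "0 \<le> m * sqrt N - w * sqrt N" "m * sqrt N - w * sqrt N \<le> 1" unfolding ws by linarith+
  then have "(m * sqrt N - w * sqrt N)\<^sup>2 \<le> 1" by (simp add: power_le_one)
  moreover have "(m * sqrt N - w * sqrt N)\<^sup>2 = N * (m - w)\<^sup>2"
    using sq by (simp add: left_diff_distrib[symmetric] power_mult_distrib)
  ultimately have "N * (m - w)\<^sup>2 \<le> 1" by simp
  then have "N * m\<^sup>2 \<le> 2 * w * (N * m) - N * w\<^sup>2 + 1"
    by (simp add: power2_diff algebra_simps)
  moreover have "N * m = (\<Sum>i<N. \<sigma> i)" using N by (simp add: m_def spin_mean_def)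
  moreover have "N * m\<^sup>2 = (\<Sum>i<N. \<sigma> i)\<^sup>2 / N" using N by (simp add: m_def spin_mean_def power2_eq_square)
  ultimately show ?thesis by simp
qed

text \<open>The centre \<open>\<eta>\<close> is independent of the grid point: the projection term
  recombines with the linear term of the expansion into the square of the total spin, and outside
  the centred forms only \<open>\<eta>\<^sup>2 * S\<close> survives. So the field is
  \<open>\<beta> * w\<close> for every \<open>\<eta>\<close>, and \<open>\<eta>\<close> can be set
  to the centre that \<open>spin_quadratic_exp_le\<close> prescribes.\<close>

lemma ising_exponent_mean_removed_le:
  assumes A: "coupling_matrix N A" and N: "0 < N" and \<beta>: "0 \<le> \<beta>"
    and w: "(\<Sum>i<N. \<sigma> i)\<^sup>2 / N \<le> 2 * w * (\<Sum>i<N. \<sigma> i) - N * w\<^sup>2 + 1"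
  defines "S \<equiv> row_dev N A"
  shows "\<beta> / 2 * (\<Sum>i<N. \<Sum>j<N. \<sigma> i * A $$ (i, j) * \<sigma> j)
    \<le> \<beta> * w * (\<Sum>i<N. \<sigma> i) + \<beta> / 2 * (\<Sum>i<N. \<Sum>j<N. mean_removed N A i j * (\<sigma> i - \<eta>) * (\<sigma> j - \<eta>))
      + (\<Sum>i<N. \<beta> * \<eta> * (row_sum N A i - 1) * (\<sigma> i - \<eta>)) + (\<beta> * \<eta>\<^sup>2 / 2 * S - \<beta> * N * w\<^sup>2 / 2 + \<beta> / 2)"
proof -
  define T where "T = (\<Sum>i<N. \<sigma> i)"
  define Q where "Q = (\<Sum>i<N. \<Sum>j<N. A $$ (i, j) * (\<sigma> i - \<eta>) * (\<sigma> j - \<eta>))"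
  define D where "D = (\<Sum>i<N. \<Sum>j<N. mean_removed N A i j * (\<sigma> i - \<eta>) * (\<sigma> j - \<eta>))"
  define b where "b = (\<Sum>i<N. \<beta> * \<eta> * (row_sum N A i - 1) * (\<sigma> i - \<eta>))"
  have Y: "(\<Sum>i<N. \<sigma> i - \<eta>) = T - N * \<eta>" by (simp add: T_def sum_subtractf)
  have "0 \<le> (\<Sum>i<N. (\<sigma> i - \<eta>)\<^sup>2) / N" by (intro divide_nonneg_nonneg sum_nonneg) auto
  then have "Q \<le> D + (T - N * \<eta>)\<^sup>2 / N"
    unfolding Q_def D_def mean_removed_form_eq[of N A "\<lambda>i. \<sigma> i - \<eta>"] Y by simp
  also have "(T - N * \<eta>)\<^sup>2 / N = T\<^sup>2 / N - 2 * \<eta> * T + N * \<eta>\<^sup>2"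
    using N by (simp add: power2_eq_square field_simps)
  finally have "\<beta> / 2 * Q \<le> \<beta> / 2 * (D + (T\<^sup>2 / N - 2 * \<eta> * T + N * \<eta>\<^sup>2))"
    using \<beta> by (intro mult_left_mono) auto
  moreover have "\<beta> / 2 * (T\<^sup>2 / N) \<le> \<beta> / 2 * (2 * w * T - N * w\<^sup>2 + 1)"
    using w \<beta> unfolding T_def by (intro mult_left_mono) auto
  moreover have "\<beta> / 2 * (\<Sum>i<N. \<Sum>j<N. \<sigma> i * A $$ (i, j) * \<sigma> j)
      = \<beta> * \<eta> * T + \<beta> / 2 * Q + b + \<beta> * \<eta>\<^sup>2 / 2 * (S - N)"
    using ising_exponent_centered[OF A, of \<beta> \<sigma> 0 \<eta>] by (simp add: T_def Q_def b_def S_def)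
  ultimately show ?thesis unfolding T_def[symmetric] D_def[symmetric] b_def[symmetric]
    by (simp add: algebra_simps add_divide_distrib diff_divide_distrib)
qed

section \<open>Global spin flip and restriction to nonnegative magnetization\<close>

text \<open>The restriction keeps the value \<open>undefined\<close> outside \<open>{..<N}\<close>,
  as membership in \<open>spin_configs N\<close> requires.\<close>

definition spin_flip :: "nat \<Rightarrow> (nat \<Rightarrow> real) \<Rightarrow> nat \<Rightarrow> real" where
  "spin_flip N \<sigma> = (\<lambda>i\<in>{..<N}. - \<sigma> i)"

lemma spin_flip_apply: "i < N \<Longrightarrow> spin_flip N \<sigma> i = - \<sigma> i"
  by (simp add: spin_flip_def)

lemma spin_flip_in: "\<sigma> \<in> spin_configs N \<Longrightarrow> spin_flip N \<sigma> \<in> spin_configs N"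
  by (auto simp: spin_configs_def spin_flip_def PiE_def Pi_def)

lemma spin_flip_inj: "inj_on (spin_flip N) (spin_configs N)"
proof (rule inj_onI)
  fix \<sigma> \<tau> assume \<sigma>: "\<sigma> \<in> spin_configs N" and \<tau>: "\<tau> \<in> spin_configs N" and eq: "spin_flip N \<sigma> = spin_flip N \<tau>"
  have "\<sigma> i = \<tau> i" if "i < N" for i
    using fun_cong[OF eq, of i] that by (simp add: spin_flip_apply)
  then show "\<sigma> = \<tau>" using \<sigma> \<tau> unfolding spin_configs_def by (intro PiE_ext) auto
qed

lemma spin_flip_mean: "spin_mean N (spin_flip N \<sigma>) = - spin_mean N \<sigma>"
  by (simp add: spin_mean_def spin_flip_apply sum_negf)

lemma spin_flip_weight: "ising_weight N A \<beta> 0 (spin_flip N \<sigma>) = ising_weight N A \<beta> 0 \<sigma>"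
  by (simp add: ising_weight_def spin_flip_apply)

lemma spin_flip_local_field: "local_field N A (spin_flip N \<sigma>) i = - local_field N A \<sigma> i"
  by (simp add: local_field_def spin_flip_apply sum_negf)

text \<open>The flip maps negative means injectively to positive ones, so both halves are bounded by
  the same sum. Separate \<open>F\<close> and \<open>G\<close> allow a centre that changes sign with
  the magnetization in \<open>F\<close> and is fixed in \<open>G\<close>.\<close>

lemma sum_le_twice_positive_mean:
  assumes pos: "\<And>\<sigma>. \<sigma> \<in> spin_configs N \<Longrightarrow> 0 \<le> spin_mean N \<sigma> \<Longrightarrow> F \<sigma> \<le> G \<sigma>"
    and neg: "\<And>\<sigma>. \<sigma> \<in> spin_configs N \<Longrightarrow> spin_mean N \<sigma> < 0 \<Longrightarrow> F \<sigma> \<le> G (spin_flip N \<sigma>)"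
    and nn: "\<And>\<sigma>. 0 \<le> (G \<sigma> :: real)"
  shows "(\<Sum>\<sigma>\<in>spin_configs N. F \<sigma>) \<le> 2 * (\<Sum>\<sigma>\<in>{\<sigma>\<in>spin_configs N. 0 \<le> spin_mean N \<sigma>}. G \<sigma>)"
proof -
  let ?P = "{\<sigma>\<in>spin_configs N. 0 \<le> spin_mean N \<sigma>}" and ?M = "{\<sigma>\<in>spin_configs N. spin_mean N \<sigma> < 0}"
  have fin: "finite ?P" "finite ?M" using finite_spin_configs by auto
  have "(\<Sum>\<sigma>\<in>spin_configs N. F \<sigma>) = (\<Sum>\<sigma>\<in>?P \<union> ?M. F \<sigma>)" by (intro sum.cong) auto
  also have "\<dots> = (\<Sum>\<sigma>\<in>?P. F \<sigma>) + (\<Sum>\<sigma>\<in>?M. F \<sigma>)" using fin by (intro sum.union_disjoint) auto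
  also have "(\<Sum>\<sigma>\<in>?P. F \<sigma>) \<le> (\<Sum>\<sigma>\<in>?P. G \<sigma>)" using pos by (intro sum_mono) auto
  also have "(\<Sum>\<sigma>\<in>?M. F \<sigma>) \<le> (\<Sum>\<sigma>\<in>?M. G (spin_flip N \<sigma>))" using neg by (intro sum_mono) auto
  also have "(\<Sum>\<sigma>\<in>?M. G (spin_flip N \<sigma>)) = (\<Sum>\<sigma>\<in>spin_flip N ` ?M. G \<sigma>)"
    by (subst sum.reindex) (auto intro: inj_on_subset[OF spin_flip_inj])
  also have "\<dots> \<le> (\<Sum>\<sigma>\<in>?P. G \<sigma>)"
    using fin nn by (intro sum_mono2) (auto simp: spin_flip_in spin_flip_mean)
  finally show ?thesis by simp
qed

text \<open>The grid point depends on the configuration. Bounding its term by the sum over all grid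
  points removes this dependence; each summand then has a fixed field \<open>\<beta> * w\<close> and
  extends to all configurations by positivity. The contact point \<open>p w\<close> stays open
  because the two regimes choose it differently.\<close>

lemma positive_mean_sum_le:
  fixes q :: "(nat \<Rightarrow> real) \<Rightarrow> real" and p :: "real \<Rightarrow> real"
  assumes A: "coupling_matrix N A" and K: "\<And>i. i < N \<Longrightarrow> row_sum N A i \<le> K" and N: "0 < N"
    and \<beta>: "0 < \<beta>" and \<gamma>: "0 \<le> \<gamma>" and \<epsilon>: "0 < \<epsilon>"
    and p: "\<And>w. 0 \<le> w \<Longrightarrow> w \<le> 1 \<Longrightarrow> 0 \<le> p w"
    and pos: "\<And>w x. 0 \<le> w \<Longrightarrow> w \<le> 1 \<Longrightarrow>
        tangent_slope (p w) * (\<beta> * mean_removed_form N A x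
          + 2 * \<gamma> * field_sq N A x) \<le> (1 - \<epsilon>) * norm_sq N x"
    and q: "\<And>w \<sigma>. 0 \<le> w \<Longrightarrow> w \<le> 1 \<Longrightarrow> q \<sigma> \<le> \<gamma> *
        field_sq N A (\<lambda>j. \<sigma> j - tangent_slope (p w) * (\<beta> * w)) + r w"
  defines "S \<equiv> row_dev N A" and "\<rho> \<equiv> row_dev_sq N A"
    and "\<eta> \<equiv> \<lambda>w. tangent_slope (p w) * (\<beta> * w)"
    and "\<psi> \<equiv> \<lambda>w. ln (cosh (p w)) + tangent_slope (p w) * ((\<beta> * w)\<^sup>2 - (p w)\<^sup>2) / 2 - \<beta> * w\<^sup>2 / 2"
  shows "(\<Sum>\<sigma>\<in>{\<sigma>\<in>spin_configs N. 0 \<le> spin_mean N \<sigma>}. ising_weight N A \<beta> 0 \<sigma> * exp (q \<sigma>))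
    \<le> (\<Sum>k\<le>nat \<lfloor>sqrt N\<rfloor>. 2 ^ N * exp (\<beta> / 2 + N * \<psi> (grid_point N k) + \<beta> * (\<eta> (grid_point N k))\<^sup>2 / 2 * S
        + r (grid_point N k) + core_const \<beta> \<gamma> K \<epsilon> *
          (3 * (frobenius_norm N A)\<^sup>2 + 2 + \<beta>\<^sup>2 * (\<eta> (grid_point N k))\<^sup>2 * \<rho>)))"
proof -
  let ?w = "grid_point N" and ?n = "nat \<lfloor>sqrt N\<rfloor>" and ?F = "(frobenius_norm N A)\<^sup>2"
  define E where "E = (\<lambda>w \<sigma>. (\<beta> * w) * (\<Sum>i<N. \<sigma> i)
      + \<beta> / 2 * (\<Sum>i<N. \<Sum>j<N. mean_removed N A i j * (\<sigma> i - \<eta> w) * (\<sigma> j - \<eta> w))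
      + \<gamma> * field_sq N A (\<lambda>j. \<sigma> j - \<eta> w)
      + (\<Sum>i<N. \<beta> * \<eta> w * (row_sum N A i - 1) * (\<sigma> i - \<eta> w)))"
  define c where "c = (\<lambda>w. \<beta> * (\<eta> w)\<^sup>2 / 2 * S - \<beta> * N * w\<^sup>2 / 2 + \<beta> / 2 + r w)"
  have core: "(\<Sum>\<sigma>\<in>spin_configs N. exp (E w \<sigma>))
      \<le> (2 * exp (ln (cosh (p w)) + tangent_slope (p w) * ((\<beta> * w)\<^sup>2 - (p w)\<^sup>2) / 2)) ^ N
       * exp (core_const \<beta> \<gamma> K \<epsilon> * (3 * ?F + 2 + \<beta>\<^sup>2 * (\<eta> w)\<^sup>2 * \<rho>))"
    if w: "0 \<le> w" "w \<le> 1" for w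
  proof -
    have "(\<Sum>\<sigma>\<in>spin_configs N. exp (E w \<sigma>))
      \<le> (2 * exp (ln (cosh (p w)) + tangent_slope (p w) * ((\<beta> * w)\<^sup>2 - (p w)\<^sup>2) / 2)) ^ N
       * exp (core_const \<beta> \<gamma> K \<epsilon> * ((\<Sum>i<N. \<Sum>j<N. (mean_removed N A i j)\<^sup>2) + ?F
          + (\<Sum>i<N. (\<beta> * \<eta> w * (row_sum N A i - 1))\<^sup>2)))"
      unfolding E_def \<eta>_def
    proof (rule spin_quadratic_exp_le[OF A])
      show "mean_removed N A i i = 0" if "i < N" for i
        using A that by (simp add: coupling_matrix_def mean_removed_def)
      show "mean_removed N A i j = mean_removed N A j i" if "i < N" "j < N" for i j
        using coupling_matrix_symmetric[OF A that] by (simp add: mean_removed_def)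
    qed (use K \<beta> \<gamma> \<epsilon> p[OF w] pos[OF w] in auto)
    also have "\<dots> \<le> (2 * exp (ln (cosh (p w)) + tangent_slope (p w) * ((\<beta> * w)\<^sup>2 - (p w)\<^sup>2) / 2)) ^ N
       * exp (core_const \<beta> \<gamma> K \<epsilon> * (3 * ?F + 2 + \<beta>\<^sup>2 * (\<eta> w)\<^sup>2 * \<rho>))"
    proof -
      have "(\<Sum>i<N. (\<beta> * \<eta> w * (row_sum N A i - 1))\<^sup>2) = \<beta>\<^sup>2 * (\<eta> w)\<^sup>2 * \<rho>"
        by (simp add: \<rho>_def power_mult_distrib sum_distrib_left)
      then have "(\<Sum>i<N. \<Sum>j<N. (mean_removed N A i j)\<^sup>2) + ?F + (\<Sum>i<N. (\<beta> * \<eta> w * (row_sum N A i - 1))\<^sup>2)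
          \<le> 3 * ?F + 2 + \<beta>\<^sup>2 * (\<eta> w)\<^sup>2 * \<rho>"
        using mean_removed_sq_sum_le[OF N, of A] by simp
      then show ?thesis
        using core_const_nonneg[OF \<gamma> \<epsilon>, of \<beta> K] by (intro mult_left_mono) (auto intro!: mult_left_mono)
    qed
    finally show ?thesis .
  qed
  have point: "ising_weight N A \<beta> 0 \<sigma> * exp (q \<sigma>) \<le> exp (c (?w k)) * exp (E (?w k) \<sigma>)"
    if \<sigma>: "\<sigma> \<in> spin_configs N" "0 \<le> spin_mean N \<sigma>" and k: "k = grid_index N \<sigma>" for \<sigma> k
  proof -
    have w: "0 \<le> ?w k" "?w k \<le> 1"
      using grid_point_bounds[OF N] grid_index_le[OF N \<sigma>(1)] unfolding k by auto
    have 1: "\<beta> / 2 * (\<Sum>i<N. \<Sum>j<N. \<sigma> i * A $$ (i, j) * \<sigma> j)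
      \<le> \<beta> * ?w k * (\<Sum>i<N. \<sigma> i)
       + \<beta> / 2 * (\<Sum>i<N. \<Sum>j<N. mean_removed N A i j * (\<sigma> i - \<eta> (?w k)) * (\<sigma> j - \<eta> (?w k)))
      + (\<Sum>i<N. \<beta> * \<eta> (?w k) * (row_sum N A i - 1) * (\<sigma> i - \<eta> (?w k)))
      + (\<beta> * (\<eta> (?w k))\<^sup>2 / 2 * S - \<beta> * N * (?w k)\<^sup>2 / 2 + \<beta> / 2)"
      unfolding S_def
      by (rule ising_exponent_mean_removed_le[OF A N less_imp_le[OF \<beta>]])
        (use square_le_tangent_at_grid[OF N \<sigma>(2)] k in simp)
    have 2: "q \<sigma> \<le> \<gamma> * field_sq N A (\<lambda>j. \<sigma> j - \<eta> (?w k)) + r (?w k)"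
      unfolding \<eta>_def by (rule q[OF w])
    have "\<beta> / 2 * (\<Sum>i<N. \<Sum>j<N. \<sigma> i * A $$ (i, j) * \<sigma> j) + q \<sigma> \<le> c (?w k) + E (?w k) \<sigma>"
      using 1 2 unfolding c_def E_def by linarith
    then show ?thesis by (simp add: ising_weight_def mult_exp_exp)
  qed
  have "(\<Sum>\<sigma>\<in>{\<sigma>\<in>spin_configs N. 0 \<le> spin_mean N \<sigma>}. ising_weight N A \<beta> 0 \<sigma> * exp (q \<sigma>))
      \<le> (\<Sum>\<sigma>\<in>{\<sigma>\<in>spin_configs N. 0 \<le> spin_mean N \<sigma>}. \<Sum>k\<le>?n. exp (c (?w k)) * exp (E (?w k) \<sigma>))"
  proof (rule sum_mono)
    fix \<sigma> assume "\<sigma> \<in> {\<sigma>\<in>spin_configs N. 0 \<le> spin_mean N \<sigma>}"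
    then have \<sigma>: "\<sigma> \<in> spin_configs N" "0 \<le> spin_mean N \<sigma>" by auto
    have "ising_weight N A \<beta> 0 \<sigma> * exp (q \<sigma>)
        \<le> exp (c (?w (grid_index N \<sigma>))) * exp (E (?w (grid_index N \<sigma>)) \<sigma>)"
      by (rule point[OF \<sigma> refl])
    also have "\<dots> \<le> (\<Sum>k\<le>?n. exp (c (?w k)) * exp (E (?w k) \<sigma>))"
      using grid_index_le[OF N \<sigma>(1)]
      by (intro member_le_sum[of "grid_index N \<sigma>" _ "\<lambda>k. exp (c (?w k)) * exp (E (?w k) \<sigma>)"]) auto
    finally show "ising_weight N A \<beta> 0 \<sigma> * exp (q \<sigma>) \<le> (\<Sum>k\<le>?n. exp (c (?w k)) * exp (E (?w k) \<sigma>))" .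
  qed
  also have "\<dots> \<le> (\<Sum>\<sigma>\<in>spin_configs N. \<Sum>k\<le>?n. exp (c (?w k)) * exp (E (?w k) \<sigma>))"
    using finite_spin_configs by (intro sum_mono2) (auto intro!: sum_nonneg)
  also have "\<dots> = (\<Sum>k\<le>?n. exp (c (?w k)) * (\<Sum>\<sigma>\<in>spin_configs N. exp (E (?w k) \<sigma>)))"
    unfolding sum_distrib_left by (rule sum.swap)
  also have "\<dots> \<le> (\<Sum>k\<le>?n. 2 ^ N * exp (\<beta> / 2 + N * \<psi> (?w k) + \<beta> * (\<eta> (?w k))\<^sup>2 / 2 * S
        + r (?w k) + core_const \<beta> \<gamma> K \<epsilon> * (3 * ?F + 2 + \<beta>\<^sup>2 * (\<eta> (?w k))\<^sup>2 * \<rho>)))"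
  proof (rule sum_mono)
    fix k assume "k \<in> {..?n}"
    then have w: "0 \<le> ?w k" "?w k \<le> 1" using grid_point_bounds[OF N] by auto
    let ?C = "core_const \<beta> \<gamma> K \<epsilon> * (3 * ?F + 2 + \<beta>\<^sup>2 * (\<eta> (?w k))\<^sup>2 * \<rho>)"
    define a where "a = ln (cosh (p (?w k))) + tangent_slope (p (?w k)) * ((\<beta> * ?w k)\<^sup>2 - (p (?w k))\<^sup>2) / 2"
    have "exp (c (?w k)) * (\<Sum>\<sigma>\<in>spin_configs N. exp (E (?w k) \<sigma>)) \<le> exp (c (?w k)) * ((2 * exp a) ^ N * exp ?C)"
      using core[OF w] unfolding a_def by (intro mult_left_mono) auto
    also have "(2 * exp a) ^ N = 2 ^ N * exp (N * a)"
      by (simp add: power_mult_distrib exp_of_nat_mult)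
    also have "exp (c (?w k)) * (2 ^ N * exp (N * a) * exp ?C) = 2 ^ N * exp (c (?w k) + N * a + ?C)"
      by (simp add: exp_add)
    also have "c (?w k) + N * a + ?C = \<beta> / 2 + N * \<psi> (?w k) + \<beta> * (\<eta> (?w k))\<^sup>2 / 2 * S + r (?w k) + ?C"
      unfolding c_def \<psi>_def a_def by (simp add: algebra_simps)
    finally show "exp (c (?w k)) * (\<Sum>\<sigma>\<in>spin_configs N. exp (E (?w k) \<sigma>))
        \<le> 2 ^ N * exp (\<beta> / 2 + N * \<psi> (?w k) + \<beta> * (\<eta> (?w k))\<^sup>2 / 2 * S + r (?w k) + ?C)" .
  qed
  finally show ?thesis .
qed

section \<open>Exponential and Gaussian sums over the grid\<close>

text \<open>Two geometric series, one on each side of \<open>\<lfloor>x\<rfloor>\<close>; rounding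
  costs the factor \<open>exp c\<close>. The bound has to be uniform in \<open>n\<close> and
  \<open>x\<close>, which both grow like \<open>sqrt N\<close> in the application.\<close>

lemma sum_exp_neg_dist_le:
  fixes c x :: real
  assumes c: "0 < c"
  shows "(\<Sum>k\<le>n. exp (- c * \<bar>real k - x\<bar>)) \<le> 2 * exp c / (1 - exp (- c))"
proof -
  define z where "z = exp (- c)"
  have z: "0 < z" "z < 1" using c by (auto simp: z_def)
  define m where "m = nat \<lfloor>x\<rfloor>"
  have geo: "(\<Sum>k\<in>I. z ^ f k) \<le> 1 / (1 - z)" if "finite I" "inj_on f I" for I and f :: "nat \<Rightarrow> nat"
  proof -
    have "(\<Sum>k\<in>I. z ^ f k) = (\<Sum>j\<in>f ` I. z ^ j)" using that by (simp add: sum.reindex)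
    also have "\<dots> \<le> (\<Sum>j. z ^ j)"
      using z that by (intro sum_le_suminf summable_geometric) auto
    also have "\<dots> = 1 / (1 - z)" using z by (intro suminf_geometric) auto
    finally show ?thesis .
  qed
  have le: "exp (- c * \<bar>real k - x\<bar>) \<le> exp c * z ^ (if k \<le> m then m - k else k - m)" for k
  proof -
    have "real (if k \<le> m then m - k else k - m) - 1 \<le> \<bar>real k - x\<bar>"
    proof (cases "0 \<le> x")
      case True
      then have "real m = of_int \<lfloor>x\<rfloor>" by (simp add: m_def)
      then have "real m \<le> x" "x \<le> real m + 1" by linarith+
      then show ?thesis by (auto simp: of_nat_diff)
    next
      case False
      then have "m = 0" by (simp add: m_def)
      then show ?thesis using False by auto
    qed
    then have "c * (real (if k \<le> m then m - k else k - m) - 1) \<le> c * \<bar>real k - x\<bar>"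
      using c by (intro mult_left_mono) auto
    then have "- c * \<bar>real k - x\<bar> \<le> c + real (if k \<le> m then m - k else k - m) * (- c)"
      by (simp add: algebra_simps)
    then have "exp (- c * \<bar>real k - x\<bar>) \<le> exp (c + real (if k \<le> m then m - k else k - m) * (- c))" by simp
    also have "\<dots> = exp c * z ^ (if k \<le> m then m - k else k - m)"
      by (simp only: exp_add z_def exp_of_nat_mult)
    finally show ?thesis .
  qed
  have "(\<Sum>k\<le>n. exp (- c * \<bar>real k - x\<bar>)) \<le> (\<Sum>k\<le>n. exp c * z ^ (if k \<le> m then m - k else k - m))"
    by (intro sum_mono le)
  also have "\<dots> = exp c * ((\<Sum>k\<in>{..n} \<inter> {..m}. z ^ (m - k)) + (\<Sum>k\<in>{..n} - {..m}. z ^ (k - m)))"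
    unfolding sum_distrib_left[symmetric]
    by (subst sum.Int_Diff[of "{..n}" _ "{..m}"]) (auto intro!: arg_cong2[of _ _ _ _ "(+)"] sum.cong)
  also have "\<dots> \<le> exp c * (1 / (1 - z) + 1 / (1 - z))"
    by (intro mult_left_mono add_mono geo) (auto intro!: inj_onI)
  finally show ?thesis by (simp add: z_def mult.commute)
qed

lemma sum_gaussian_le:
  fixes c x :: real
  assumes c: "0 < c"
  shows "(\<Sum>k\<le>n. exp (- c * (real k - x)\<^sup>2)) \<le> exp c * (2 * exp c / (1 - exp (- c)))"
proof -
  have "exp (- c * (real k - x)\<^sup>2) \<le> exp c * exp (- c * \<bar>real k - x\<bar>)" for k
  proof -
    define d where "d = \<bar>real k - x\<bar>"
    \<comment> \<open>Equivalent to \<open>d - 1 \<le> d\<^sup>2\<close>, which reduces the Gaussian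
      sum to the exponential one.\<close>
    have "0 \<le> (d - 1)\<^sup>2 + d" by (intro add_nonneg_nonneg) (auto simp: d_def)
    then have "c * (d - 1) \<le> c * d\<^sup>2" using c by (intro mult_left_mono) (simp_all add: power2_diff)
    moreover have "d\<^sup>2 = (real k - x)\<^sup>2" by (simp add: d_def)
    ultimately show ?thesis unfolding mult_exp_exp d_def[symmetric] by (simp add: algebra_simps)
  qed
  then have "(\<Sum>k\<le>n. exp (- c * (real k - x)\<^sup>2)) \<le> (\<Sum>k\<le>n. exp c * exp (- c * \<bar>real k - x\<bar>))"
    by (intro sum_mono)
  also have "\<dots> = exp c * (\<Sum>k\<le>n. exp (- c * \<bar>real k - x\<bar>))" by (simp add: sum_distrib_left)
  also have "\<dots> \<le> exp c * (2 * exp c / (1 - exp (- c)))"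
    using sum_exp_neg_dist_le[OF c] by (intro mult_left_mono) auto
  finally show ?thesis .
qed

section \<open>The supercritical and critical regimes\<close>

lemma row_sum_deviation_sq_le:
  "(row_dev N A)\<^sup>2 \<le> N * row_dev_sq N A"
  using sum_mult_sq_le[of "\<lambda>_. 1" "\<lambda>i. row_sum N A i - 1" "{..<N}"] by simp

lemma young_le:
  fixes a b c :: real
  assumes "0 < c"
  shows "a * b \<le> c * a\<^sup>2 + b\<^sup>2 / (4 * c)"
proof -
  have "0 \<le> (2 * c * a - b)\<^sup>2 / (4 * c)" using assms by simp
  also have "\<dots> = c * a\<^sup>2 + b\<^sup>2 / (4 * c) - a * b"
    using assms by (simp add: power2_eq_square field_simps)
  finally show ?thesis by simp
qed

text \<open>The decay \<open>c * N * (w - t)\<^sup>2\<close> is split: a quarter absorbs the row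
  deviations, a quarter the shift of the centre of the local fields, and half is left for the
  Gaussian sum over the grid. The factor at \<open>w = t\<close> matches the lower bound of the
  partition function.\<close>

lemma (in ferromagnetic_root) ln_expectation_supercritical_le:
  fixes N :: nat
  assumes A: "coupling_matrix N A" and K: "\<And>i. i < N \<Longrightarrow> row_sum N A i \<le> K" and N: "0 < N"
    and \<delta>: "0 < \<delta>" and \<epsilon>: "0 < \<epsilon>"
    and pos: "\<And>w x. 0 \<le> w \<Longrightarrow> w \<le> 1 \<Longrightarrow>
        slope w * (\<beta> * mean_removed_form N A x
          + 2 * (2 * \<delta>) * field_sq N A x) \<le> (1 - \<epsilon>) * norm_sq N x"
    and c: "0 < c" and free: "\<And>w. 0 \<le> w \<Longrightarrow> w \<le> 1 \<Longrightarrow>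
        free_energy w \<le> ln (cosh (\<beta> * t)) - \<beta> * t\<^sup>2 / 2 - c * (w - t)\<^sup>2"
  defines "L \<equiv> max \<beta> (1 / (\<iota> * t))" and "\<rho> \<equiv> row_dev_sq N A"
  assumes \<delta>L: "\<delta> * L\<^sup>2 \<le> c / 4"
  shows "ln (measure_pmf.expectation (ising_pmf N A \<beta> 0)
      (\<lambda>\<sigma>. exp (\<delta> / 2 * (\<Sum>i<N. (local_field N A \<sigma> i - (if 0 \<le> spin_mean N \<sigma> then t else - t))\<^sup>2))))
    \<le> ln (2 * (exp (c / 2) * (2 * exp (c / 2) / (1 - exp (- (c / 2)))))) + (\<beta> / 2 + 2 * \<delta> * \<rho> + \<beta>\<^sup>2 * L\<^sup>2 / c * \<rho>
      + core_const \<beta> (2 * \<delta>) K \<epsilon> * (3 * (frobenius_norm N A)\<^sup>2 + 2 + \<beta>\<^sup>2 * \<rho>))"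
proof (rule ln_expectation_exp_le)
  define S where "S = row_dev N A"
  define cc where "cc = core_const \<beta> (2 * \<delta>) K \<epsilon>"
  define Gc where "Gc = exp (c / 2) * (2 * exp (c / 2) / (1 - exp (- (c / 2))))"
  define \<phi> where "\<phi> = ln (cosh (\<beta> * t)) - \<beta> * t\<^sup>2 / 2"
  define q where "q = (\<lambda>\<sigma>. \<delta> / 2 * (\<Sum>i<N. (local_field N A \<sigma> i - t)\<^sup>2))"
  define f where "f = (\<lambda>\<sigma>. \<delta> / 2 * (\<Sum>i<N. (local_field N A \<sigma> i
      - (if 0 \<le> spin_mean N \<sigma> then t else - t))\<^sup>2))"
  define r where "r = (\<lambda>w. 2 * \<delta> * (center w)\<^sup>2 * \<rho> + \<delta> * N * (center w - t)\<^sup>2)"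
  let ?F = "(frobenius_norm N A)\<^sup>2" and ?w = "grid_point N" and ?n = "nat \<lfloor>sqrt N\<rfloor>"
  define X where "X = \<beta> / 2 + 2 * \<delta> * \<rho> + \<beta>\<^sup>2 * L\<^sup>2 / c * \<rho> + cc * (3 * ?F + 2 + \<beta>\<^sup>2 * \<rho>)"
  have \<beta>0: "0 < \<beta>" using \<beta> by simp
  have \<rho>: "0 \<le> \<rho>" unfolding \<rho>_def by (intro sum_nonneg) auto
  have cc: "0 \<le> cc" unfolding cc_def using \<delta> \<epsilon> by (intro core_const_nonneg) auto
  have L0: "0 \<le> L" using \<beta> by (simp add: L_def le_max_iff_disj)
  have Gc: "0 < Gc" using c by (simp add: Gc_def)
  have S\<rho>: "S\<^sup>2 \<le> N * \<rho>" unfolding S_def \<rho>_def by (rule row_sum_deviation_sq_le)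
  have "(\<Sum>\<sigma>\<in>spin_configs N. ising_weight N A \<beta> 0 \<sigma> * exp (f \<sigma>))
     \<le> 2 * (\<Sum>\<sigma>\<in>{\<sigma>\<in>spin_configs N. 0 \<le> spin_mean N \<sigma>}. ising_weight N A \<beta> 0 \<sigma> * exp (q \<sigma>))"
  proof (rule sum_le_twice_positive_mean)
    fix \<sigma>
    show "ising_weight N A \<beta> 0 \<sigma> * exp (f \<sigma>) \<le> ising_weight N A \<beta> 0 \<sigma> * exp (q \<sigma>)"
      if "0 \<le> spin_mean N \<sigma>" using that by (simp add: f_def q_def)
    show "ising_weight N A \<beta> 0 \<sigma> * exp (f \<sigma>)
        \<le> ising_weight N A \<beta> 0 (spin_flip N \<sigma>) * exp (q (spin_flip N \<sigma>))" if "spin_mean N \<sigma> < 0"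
    proof -
      have "(local_field N A (spin_flip N \<sigma>) i - t)\<^sup>2 = (local_field N A \<sigma> i + t)\<^sup>2" for i
        unfolding spin_flip_local_field by (simp add: power2_eq_square algebra_simps)
      then show ?thesis using that by (simp add: f_def q_def spin_flip_weight)
    qed
    show "0 \<le> ising_weight N A \<beta> 0 \<sigma> * exp (q \<sigma>)"
      using ising_weight_pos[of N A \<beta> 0 \<sigma>] by simp
  qed
  also have "(\<Sum>\<sigma>\<in>{\<sigma>\<in>spin_configs N. 0 \<le> spin_mean N \<sigma>}. ising_weight N A \<beta> 0 \<sigma> * exp (q \<sigma>))
    \<le> (\<Sum>k\<le>?n. 2 ^ N * exp (\<beta> / 2 + N * free_energy (?w k) + \<beta> * (center (?w k))\<^sup>2 / 2 * S
        + r (?w k) + cc * (3 * ?F + 2 + \<beta>\<^sup>2 * (center (?w k))\<^sup>2 * \<rho>)))"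
    unfolding free_energy_def center_def slope_def S_def \<rho>_def cc_def
  proof (rule positive_mean_sum_le[OF A K N \<beta>0 _ \<epsilon>])
    show "0 \<le> \<beta> * max w q\<^sub>0" for w using \<beta>0 q\<^sub>0(1) by simp
    show "tangent_slope (\<beta> * max w q\<^sub>0) * (\<beta> * mean_removed_form N A x
          + 2 * (2 * \<delta>) * field_sq N A x) \<le> (1 - \<epsilon>) * norm_sq N x"
      if "0 \<le> w" "w \<le> 1" for w x using pos[OF that, of x] unfolding slope_def .
    \<comment> \<open>Squares are doubled twice, in passing from \<open>t\<close> to
      \<open>center w\<close> and in centring the spins; so \<open>\<delta> / 2\<close> becomes
      \<open>2 * \<delta>\<close>.\<close>
    show "q \<sigma> \<le> 2 * \<delta> *
        field_sq N A (\<lambda>j. \<sigma> j - tangent_slope (\<beta> * max w q\<^sub>0) * (\<beta> * w)) + r w" for w \<sigma>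
    proof -
      let ?Q = "\<Sum>i<N. (local_field N A (\<lambda>j. \<sigma> j - center w) i)\<^sup>2"
      have "(local_field N A \<sigma> i - t)\<^sup>2 \<le> 2 * (local_field N A \<sigma> i - center w)\<^sup>2 + 2 * (center w - t)\<^sup>2" for i
        using sum_squares_bound[of "local_field N A \<sigma> i - center w" "center w - t"]
        by (simp add: power2_eq_square algebra_simps)
      then have "(\<Sum>i<N. (local_field N A \<sigma> i - t)\<^sup>2)
          \<le> (\<Sum>i<N. 2 * (local_field N A \<sigma> i - center w)\<^sup>2 + 2 * (center w - t)\<^sup>2)"
        by (intro sum_mono)
      also have "\<dots> = 2 * (\<Sum>i<N. (local_field N A \<sigma> i - center w)\<^sup>2) + N * (2 * (center w - t)\<^sup>2)"
        by (simp add: sum.distrib sum_distrib_left)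
      also have "\<dots> \<le> 2 * (2 * ?Q + 2 * (center w)\<^sup>2 * \<rho>) + N * (2 * (center w - t)\<^sup>2)"
        unfolding \<rho>_def by (intro add_right_mono mult_left_mono local_field_center_sq_le) auto
      finally have "q \<sigma> \<le> \<delta> / 2 * (2 * (2 * ?Q + 2 * (center w)\<^sup>2 * \<rho>) + N * (2 * (center w - t)\<^sup>2))"
        unfolding q_def using \<delta> by (intro mult_left_mono) auto
      also have "\<dots> = 2 * \<delta> * ?Q + r w" by (simp add: r_def algebra_simps)
      finally show ?thesis unfolding center_def slope_def .
    qed
  qed (use \<delta> in auto)
  also have "\<dots> \<le> (\<Sum>k\<le>?n. 2 ^ N * exp (N * \<phi> + \<beta> * t\<^sup>2 / 2 * S) * exp X
      * exp (- (c / 2) * (real k - sqrt N * t)\<^sup>2))"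
  proof (rule sum_mono)
    fix k assume "k \<in> {..?n}"
    then have w: "0 \<le> ?w k" "?w k \<le> 1" using grid_point_bounds[OF N] by auto
    define \<eta> where "\<eta> = center (?w k)"
    define d where "d = \<bar>?w k - t\<bar>"
    have \<eta>: "0 \<le> \<eta>" "\<eta> \<le> 1" unfolding \<eta>_def using center_bounds[OF w(1)] by auto
    have \<eta>d: "\<bar>\<eta> - t\<bar> \<le> L * d" unfolding \<eta>_def L_def d_def by (rule center_diff_le[OF w(1)])
    have \<eta>2: "\<eta>\<^sup>2 \<le> 1" using \<eta> by (simp add: power_le_one)
    have d2: "d\<^sup>2 = (?w k - t)\<^sup>2" by (simp add: d_def)
    have 1: "N * free_energy (?w k) \<le> N * \<phi> - c * (N * d\<^sup>2)"
    proof -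
      have "free_energy (?w k) \<le> \<phi> - c * d\<^sup>2" unfolding \<phi>_def d2 by (rule free[OF w])
      then have "N * free_energy (?w k) \<le> N * (\<phi> - c * d\<^sup>2)" by (intro mult_left_mono) auto
      then show ?thesis by (simp add: algebra_simps)
    qed
    \<comment> \<open>Replacing \<open>\<eta>\<^sup>2\<close> by \<open>t\<^sup>2\<close> makes the
      \<open>S\<close> term match the partition function. The difference is split by Young's
      inequality, and \<open>S\<^sup>2 \<le> N * \<rho>\<close> by Cauchy-Schwarz.\<close>
    have 2: "\<beta> * \<eta>\<^sup>2 / 2 * S \<le> \<beta> * t\<^sup>2 / 2 * S + c / 4 * (N * d\<^sup>2) + \<beta>\<^sup>2 * L\<^sup>2 / c * \<rho>"
    proof -
      have "\<beta> / 2 * ((\<eta>\<^sup>2 - t\<^sup>2) * S) \<le> \<beta> / 2 * (2 * (L * d) * \<bar>S\<bar>)"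
      proof -
        have "(\<eta>\<^sup>2 - t\<^sup>2) * S \<le> \<bar>\<eta> - t\<bar> * (\<eta> + t) * \<bar>S\<bar>"
        proof -
          have "(\<eta>\<^sup>2 - t\<^sup>2) * S \<le> \<bar>(\<eta>\<^sup>2 - t\<^sup>2) * S\<bar>" by simp
          also have "\<dots> = \<bar>\<eta> - t\<bar> * (\<eta> + t) * \<bar>S\<bar>"
            using \<eta>(1) t(1) by (simp add: abs_mult power2_eq_square square_diff_square_factored)
          finally show ?thesis .
        qed
        also have "\<dots> \<le> (L * d) * 2 * \<bar>S\<bar>"
          using \<eta> t(1) t_less_1 \<eta>d L0 by (intro mult_right_mono mult_mono) (auto simp: d_def)
        finally show ?thesis using \<beta>0 by (intro mult_left_mono) (auto simp: mult_ac)
      qed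
      also have "\<dots> = d * (\<beta> * L * \<bar>S\<bar>)" by simp
      also have "\<dots> \<le> (c / 4 * N) * d\<^sup>2 + (\<beta> * L * \<bar>S\<bar>)\<^sup>2 / (4 * (c / 4 * N))"
        using c N by (intro young_le) auto
      also have "(\<beta> * L * \<bar>S\<bar>)\<^sup>2 / (4 * (c / 4 * N)) = \<beta>\<^sup>2 * L\<^sup>2 / c * (S\<^sup>2 / N)"
        by (simp add: power_mult_distrib)
      also have "\<dots> \<le> \<beta>\<^sup>2 * L\<^sup>2 / c * \<rho>"
        using S\<rho> N c by (intro mult_left_mono) (auto simp: divide_le_eq mult.commute)
      finally show ?thesis by (simp add: algebra_simps)
    qed
    have 3: "r (?w k) \<le> 2 * \<delta> * \<rho> + c / 4 * (N * d\<^sup>2)"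
    proof -
      have "2 * \<delta> * \<eta>\<^sup>2 * \<rho> \<le> 2 * \<delta> * 1 * \<rho>"
        using \<delta> \<rho> \<eta>2 by (intro mult_right_mono mult_left_mono) auto
      moreover have "\<delta> * N * (\<eta> - t)\<^sup>2 \<le> c / 4 * (N * d\<^sup>2)"
      proof -
        have "\<bar>\<eta> - t\<bar>\<^sup>2 \<le> (L * d)\<^sup>2" using \<eta>d by (intro power_mono) auto
        then have "\<delta> * N * (\<eta> - t)\<^sup>2 \<le> \<delta> * N * (L * d)\<^sup>2" using \<delta> by (intro mult_left_mono) auto
        also have "\<dots> = (\<delta> * L\<^sup>2) * (N * d\<^sup>2)" by (simp add: power_mult_distrib)
        also have "\<dots> \<le> c / 4 * (N * d\<^sup>2)" using \<delta>L by (intro mult_right_mono) auto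
        finally show ?thesis .
      qed
      ultimately show ?thesis unfolding r_def \<eta>_def[symmetric] by simp
    qed
    have 4: "cc * (3 * ?F + 2 + \<beta>\<^sup>2 * \<eta>\<^sup>2 * \<rho>) \<le> cc * (3 * ?F + 2 + \<beta>\<^sup>2 * \<rho>)"
    proof -
      have "\<beta>\<^sup>2 * \<eta>\<^sup>2 * \<rho> \<le> \<beta>\<^sup>2 * 1 * \<rho>" using \<rho> \<eta>2 by (intro mult_right_mono mult_left_mono) auto
      then show ?thesis using cc by (intro mult_left_mono) auto
    qed
    have 5: "N * d\<^sup>2 = (real k - sqrt N * t)\<^sup>2"
    proof -
      have "real k = sqrt N * ?w k" using N by (simp add: grid_point_def)
      then have "(real k - sqrt N * t)\<^sup>2 = (sqrt N * (?w k - t))\<^sup>2" by (simp add: algebra_simps)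
      then show ?thesis by (simp add: power_mult_distrib d2)
    qed
    have "\<beta> / 2 + N * free_energy (?w k) + \<beta> * \<eta>\<^sup>2 / 2 * S + r (?w k) + cc * (3 * ?F + 2 + \<beta>\<^sup>2 * \<eta>\<^sup>2 * \<rho>)
        \<le> (N * \<phi> + \<beta> * t\<^sup>2 / 2 * S) + X + - (c / 2) * (real k - sqrt N * t)\<^sup>2"
      using 1 2 3 4 unfolding 5[symmetric] X_def by linarith
    then have "exp (\<beta> / 2 + N * free_energy (?w k) + \<beta> * \<eta>\<^sup>2 / 2 * S + r (?w k) + cc * (3 * ?F + 2 + \<beta>\<^sup>2 * \<eta>\<^sup>2 * \<rho>))
        \<le> exp (N * \<phi> + \<beta> * t\<^sup>2 / 2 * S) * exp X * exp (- (c / 2) * (real k - sqrt N * t)\<^sup>2)"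
      unfolding mult_exp_exp by simp
    from mult_left_mono[OF this, of "2 ^ N"]
    show "2 ^ N * exp (\<beta> / 2 + N * free_energy (?w k) + \<beta> * (center (?w k))\<^sup>2 / 2 * S
        + r (?w k) + cc * (3 * ?F + 2 + \<beta>\<^sup>2 * (center (?w k))\<^sup>2 * \<rho>))
      \<le> 2 ^ N * exp (N * \<phi> + \<beta> * t\<^sup>2 / 2 * S) * exp X * exp (- (c / 2) * (real k - sqrt N * t)\<^sup>2)"
      unfolding \<eta>_def by (simp add: mult.assoc)
  qed
  also have "\<dots> = 2 ^ N * exp (N * \<phi> + \<beta> * t\<^sup>2 / 2 * S) * exp X
      * (\<Sum>k\<le>?n. exp (- (c / 2) * (real k - sqrt N * t)\<^sup>2))"
    by (rule sum_distrib_left[symmetric])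
  also have "\<dots> \<le> 2 ^ N * exp (N * \<phi> + \<beta> * t\<^sup>2 / 2 * S) * exp X * Gc"
    unfolding Gc_def using c by (intro mult_left_mono sum_gaussian_le) auto
  also have "2 ^ N * exp (N * \<phi> + \<beta> * t\<^sup>2 / 2 * S) = exp (\<beta> * t\<^sup>2 / 2 * (S - N)) * (2 * cosh (\<beta> * t)) ^ N"
  proof -
    have "(2 * cosh (\<beta> * t)) ^ N = 2 ^ N * exp (N * ln (cosh (\<beta> * t)))"
      by (simp add: power_mult_distrib exp_of_nat_mult)
    then have "exp (\<beta> * t\<^sup>2 / 2 * (S - N)) * (2 * cosh (\<beta> * t)) ^ N
        = 2 ^ N * (exp (\<beta> * t\<^sup>2 / 2 * (S - N)) * exp (N * ln (cosh (\<beta> * t))))" by simp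
    also have "\<dots> = 2 ^ N * exp (N * \<phi> + \<beta> * t\<^sup>2 / 2 * S)"
      unfolding mult_exp_exp \<phi>_def by (simp add: algebra_simps add_divide_distrib diff_divide_distrib)
    finally show ?thesis by simp
  qed
  finally have "(\<Sum>\<sigma>\<in>spin_configs N. ising_weight N A \<beta> 0 \<sigma> * exp (f \<sigma>))
      \<le> 2 * (exp (\<beta> * t\<^sup>2 / 2 * (S - N)) * (2 * cosh (\<beta> * t)) ^ N * exp X * Gc)" by simp
  also have "\<dots> = (2 * Gc * exp X) * (exp (\<beta> * t\<^sup>2 / 2 * (S - N)) * (2 * cosh (\<beta> * t)) ^ N)" by simp
  also have "\<dots> \<le> (2 * Gc * exp X) * ising_partition N A \<beta> 0"
    using ising_partition_ge[OF A, of t \<beta> 0] t(2) Gc unfolding S_def by (intro mult_left_mono) auto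
  also have "2 * Gc * exp X = exp (ln (2 * Gc) + X)" using Gc by (simp add: exp_add)
  finally show "(\<Sum>\<sigma>\<in>spin_configs N. ising_weight N A \<beta> 0 \<sigma> * exp (\<delta> / 2 * (\<Sum>i<N. (local_field N A \<sigma> i
      - (if 0 \<le> spin_mean N \<sigma> then t else - t))\<^sup>2)))
    \<le> exp (ln (2 * (exp (c / 2) * (2 * exp (c / 2) / (1 - exp (- (c / 2)))))) + (\<beta> / 2 + 2 * \<delta> * \<rho> + \<beta>\<^sup>2 * L\<^sup>2 / c * \<rho>
      + core_const \<beta> (2 * \<delta>) K \<epsilon> * (3 * (frobenius_norm N A)\<^sup>2 + 2 + \<beta>\<^sup>2 * \<rho>))) * ising_partition N A \<beta> 0"
    unfolding f_def Gc_def X_def cc_def .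
qed

text \<open>The mean minimizes the sum of squared deviations. This lets the random centre
  \<open>mean_local_field\<close> be replaced by a constant depending only on the grid
  point.\<close>

lemma sum_sq_mean_deviation_le:
  fixes f :: "nat \<Rightarrow> real"
  assumes "0 < N"
  shows "(\<Sum>i<N. (f i - (\<Sum>i<N. f i) / N)\<^sup>2) \<le> (\<Sum>i<N. (f i - a)\<^sup>2)"
proof -
  define m where "m = (\<Sum>i<N. f i) / N"
  have sf: "(\<Sum>i<N. f i) = N * m" using assms by (simp add: m_def)
  have "(\<Sum>i<N. (f i - a)\<^sup>2) = (\<Sum>i<N. (f i - m)\<^sup>2 + 2 * (m - a) * (f i - m) + (m - a)\<^sup>2)"
    by (intro sum.cong refl) (simp add: power2_eq_square algebra_simps)
  also have "\<dots> = (\<Sum>i<N. (f i - m)\<^sup>2) + 2 * (m - a) * (\<Sum>i<N. f i - m) + N * (m - a)\<^sup>2"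
    by (simp add: sum.distrib sum_distrib_left)
  also have "(\<Sum>i<N. f i - m) = 0" using sf by (simp add: sum_subtractf)
  finally show ?thesis unfolding m_def by simp
qed

text \<open>At \<open>\<beta> = 1\<close> the contact point can be \<open>w\<close> itself, since
  the slope is at most 1 and the spectral gap provides the margin. The row deviations carry the
  weight \<open>w\<^sup>2\<close>; against \<open>c * N * w ^ 4\<close>, Young's inequality in the
  variable \<open>w\<^sup>2\<close> leaves \<open>Y\<^sup>2 / (4 * (c * N))\<close> at every grid
  point.\<close>

lemma ln_expectation_critical_le:
  fixes N :: nat and c :: real
  assumes A: "coupling_matrix N A" and K: "\<And>i. i < N \<Longrightarrow> row_sum N A i \<le> K" and N: "0 < N"
    and \<delta>: "0 < \<delta>" and \<epsilon>: "0 < \<epsilon>"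
    and pos: "\<And>w x. 0 \<le> w \<Longrightarrow> w \<le> 1 \<Longrightarrow>
        tangent_slope w * (mean_removed_form N A x
          + 2 * \<delta> * field_sq N A x) \<le> (1 - \<epsilon>) * norm_sq N x"
    and c: "0 < c" and quartic: "\<And>w. 0 \<le> w \<Longrightarrow> w \<le> 1 \<Longrightarrow> ln (cosh w) - w\<^sup>2 / 2 \<le> - c * w ^ 4"
  defines "S \<equiv> row_dev N A" and "\<rho> \<equiv> row_dev_sq N A"
    and "cc \<equiv> core_const 1 \<delta> K \<epsilon>"
  shows "ln (measure_pmf.expectation (ising_pmf N A 1 0)
      (\<lambda>\<sigma>. exp (\<delta> / 2 * (\<Sum>i<N. (local_field N A \<sigma> i - mean_local_field N A \<sigma>)\<^sup>2))))
    \<le> ln (2 * (sqrt N + 1)) + (1 / 2 + (\<bar>S\<bar> / 2 + (\<delta> + cc) * \<rho>)\<^sup>2 / (4 * (c * N))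
        + cc * (3 * (frobenius_norm N A)\<^sup>2 + 2))"
proof (rule ln_expectation_exp_le)
  let ?F = "(frobenius_norm N A)\<^sup>2" and ?w = "grid_point N" and ?n = "nat \<lfloor>sqrt N\<rfloor>"
  define q where "q = (\<lambda>\<sigma>. \<delta> / 2 * (\<Sum>i<N. (local_field N A \<sigma> i - mean_local_field N A \<sigma>)\<^sup>2))"
  define r where "r = (\<lambda>w. \<delta> * (tangent_slope w * (1 * w))\<^sup>2 * \<rho>)"
  define Y where "Y = \<bar>S\<bar> / 2 + (\<delta> + cc) * \<rho>"
  define X where "X = 1 / 2 + Y\<^sup>2 / (4 * (c * N)) + cc * (3 * ?F + 2)"
  have \<rho>: "0 \<le> \<rho>" unfolding \<rho>_def by (intro sum_nonneg) auto
  have cc: "0 \<le> cc" unfolding cc_def using \<delta> \<epsilon> by (intro core_const_nonneg) auto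
  have "(\<Sum>\<sigma>\<in>spin_configs N. ising_weight N A 1 0 \<sigma> * exp (q \<sigma>))
     \<le> 2 * (\<Sum>\<sigma>\<in>{\<sigma>\<in>spin_configs N. 0 \<le> spin_mean N \<sigma>}. ising_weight N A 1 0 \<sigma> * exp (q \<sigma>))"
  proof (rule sum_le_twice_positive_mean)
    fix \<sigma>
    show "ising_weight N A 1 0 \<sigma> * exp (q \<sigma>)
        \<le> ising_weight N A 1 0 (spin_flip N \<sigma>) * exp (q (spin_flip N \<sigma>))"
    proof -
      have "mean_local_field N A (spin_flip N \<sigma>) = - mean_local_field N A \<sigma>"
        by (simp add: mean_local_field_def spin_flip_local_field sum_negf)
      then have "(local_field N A (spin_flip N \<sigma>) i - mean_local_field N A (spin_flip N \<sigma>))\<^sup>2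
          = (local_field N A \<sigma> i - mean_local_field N A \<sigma>)\<^sup>2" for i
        unfolding spin_flip_local_field by (simp add: power2_eq_square algebra_simps)
      then show ?thesis by (simp add: q_def spin_flip_weight)
    qed
    show "0 \<le> ising_weight N A 1 0 \<sigma> * exp (q \<sigma>)"
      using ising_weight_pos[of N A 1 0 \<sigma>] by simp
  qed simp
  also have "(\<Sum>\<sigma>\<in>{\<sigma>\<in>spin_configs N. 0 \<le> spin_mean N \<sigma>}. ising_weight N A 1 0 \<sigma> * exp (q \<sigma>))
    \<le> (\<Sum>k\<le>?n. 2 ^ N * exp (1 / 2 + N * (ln (cosh (?w k))
          + tangent_slope (?w k) * ((1 * ?w k)\<^sup>2 - (?w k)\<^sup>2) / 2 - 1 * (?w k)\<^sup>2 / 2)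
        + 1 * (tangent_slope (?w k) * (1 * ?w k))\<^sup>2 / 2 * S
        + r (?w k) + cc * (3 * ?F + 2 + 1\<^sup>2 * (tangent_slope (?w k) * (1 * ?w k))\<^sup>2 * \<rho>)))"
    unfolding S_def \<rho>_def cc_def
  proof (rule positive_mean_sum_le[OF A K N _ _ \<epsilon>])
    show "tangent_slope w * (1 * mean_removed_form N A x
          + 2 * \<delta> * field_sq N A x) \<le> (1 - \<epsilon>) * norm_sq N x"
      if "0 \<le> w" "w \<le> 1" for w x using pos[OF that, of x] by simp
    show "q \<sigma> \<le> \<delta> * field_sq N A (\<lambda>j. \<sigma> j - tangent_slope w * (1 * w)) + r w" for w \<sigma>
    proof -
      let ?e = "tangent_slope w * (1 * w)"
      have "(\<Sum>i<N. (local_field N A \<sigma> i - mean_local_field N A \<sigma>)\<^sup>2)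
          \<le> (\<Sum>i<N. (local_field N A \<sigma> i - ?e)\<^sup>2)"
        unfolding mean_local_field_def by (rule sum_sq_mean_deviation_le[OF N])
      also have "\<dots> \<le> 2 * field_sq N A (\<lambda>j. \<sigma> j - ?e) + 2 * ?e\<^sup>2 * \<rho>"
        unfolding \<rho>_def by (rule local_field_center_sq_le)
      finally have "q \<sigma> \<le> \<delta> / 2 * (2 * field_sq N A (\<lambda>j. \<sigma> j - ?e) + 2 * ?e\<^sup>2 * \<rho>)"
        unfolding q_def using \<delta> by (intro mult_left_mono) auto
      also have "\<dots> = \<delta> * field_sq N A (\<lambda>j. \<sigma> j - ?e) + r w"
        unfolding r_def by (simp add: distrib_left)
      finally show ?thesis .
    qed
  qed (use \<delta> in auto)
  also have "\<dots> \<le> (\<Sum>k\<le>?n. 2 ^ N * exp X)"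
  proof (rule sum_mono)
    fix k assume "k \<in> {..?n}"
    then have w: "0 \<le> ?w k" "?w k \<le> 1" using grid_point_bounds[OF N] by auto
    define \<eta> where "\<eta> = tangent_slope (?w k) * (1 * ?w k)"
    have "\<eta> = tanh (?w k)" by (simp add: \<eta>_def)
    then have "0 \<le> \<eta>" "\<eta> \<le> ?w k" using w tanh_le_self by auto
    then have \<eta>2: "\<eta>\<^sup>2 \<le> (?w k)\<^sup>2" by (intro power_mono) auto
    have 1: "N * (ln (cosh (?w k)) + tangent_slope (?w k) * ((1 * ?w k)\<^sup>2 - (?w k)\<^sup>2) / 2 - 1 * (?w k)\<^sup>2 / 2)
        \<le> - (c * N * ((?w k)\<^sup>2)\<^sup>2)"
    proof -
      have "N * (ln (cosh (?w k)) - (?w k)\<^sup>2 / 2) \<le> N * (- c * (?w k) ^ 4)"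
        using quartic[OF w] by (intro mult_left_mono) auto
      then show ?thesis by (simp add: mult_ac)
    qed
    have "1 * \<eta>\<^sup>2 / 2 * S + r (?w k) + cc * (1\<^sup>2 * \<eta>\<^sup>2 * \<rho>) = \<eta>\<^sup>2 * (S / 2 + (\<delta> + cc) * \<rho>)"
      unfolding r_def \<eta>_def[symmetric] by (simp add: algebra_simps)
    also have "\<dots> \<le> \<eta>\<^sup>2 * Y" unfolding Y_def by (intro mult_left_mono) auto
    also have "\<dots> \<le> (?w k)\<^sup>2 * Y"
      using \<eta>2 \<rho> cc \<delta> unfolding Y_def by (intro mult_right_mono) auto
    also have "\<dots> \<le> c * N * ((?w k)\<^sup>2)\<^sup>2 + Y\<^sup>2 / (4 * (c * N))"
      using c N by (intro young_le) auto
    finally have 2: "1 * \<eta>\<^sup>2 / 2 * S + r (?w k) + cc * (1\<^sup>2 * \<eta>\<^sup>2 * \<rho>)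
        \<le> c * N * ((?w k)\<^sup>2)\<^sup>2 + Y\<^sup>2 / (4 * (c * N))" .
    have 3: "cc * (3 * ?F + 2 + 1\<^sup>2 * \<eta>\<^sup>2 * \<rho>) = cc * (3 * ?F + 2) + cc * (1\<^sup>2 * \<eta>\<^sup>2 * \<rho>)"
      by (rule distrib_left)
    have "1 / 2 + N * (ln (cosh (?w k)) + tangent_slope (?w k) * ((1 * ?w k)\<^sup>2 - (?w k)\<^sup>2) / 2 - 1 * (?w k)\<^sup>2 / 2)
        + 1 * \<eta>\<^sup>2 / 2 * S + r (?w k) + cc * (3 * ?F + 2 + 1\<^sup>2 * \<eta>\<^sup>2 * \<rho>) \<le> X"
    proof -
      have "1 / 2 + a + b1 + b2 + (e + b3) \<le> 1 / 2 + y + e"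
        if "a \<le> - z" "b1 + b2 + b3 \<le> z + y" for a b1 b2 b3 e y z :: real
        using that by linarith
      from this[OF 1 2] show ?thesis unfolding 3 X_def .
    qed
    then show "2 ^ N * exp (1 / 2 + N * (ln (cosh (?w k))
          + tangent_slope (?w k) * ((1 * ?w k)\<^sup>2 - (?w k)\<^sup>2) / 2 - 1 * (?w k)\<^sup>2 / 2)
        + 1 * (tangent_slope (?w k) * (1 * ?w k))\<^sup>2 / 2 * S
        + r (?w k) + cc * (3 * ?F + 2 + 1\<^sup>2 * (tangent_slope (?w k) * (1 * ?w k))\<^sup>2 * \<rho>)) \<le> 2 ^ N * exp X"
      unfolding \<eta>_def by (intro mult_left_mono) auto
  qed
  also have "\<dots> = (real ?n + 1) * (2 ^ N * exp X)" by simp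
  also have "\<dots> \<le> (sqrt N + 1) * (2 ^ N * exp X)" by (intro mult_right_mono) auto
  finally have "(\<Sum>\<sigma>\<in>spin_configs N. ising_weight N A 1 0 \<sigma> * exp (q \<sigma>))
      \<le> (2 * (sqrt N + 1) * exp X) * 2 ^ N" by (simp only: mult_ac)
  \<comment> \<open>At \<open>t = 0\<close> the lower bound of the partition function is
    \<open>2 ^ N\<close>.\<close>
  also have "\<dots> \<le> (2 * (sqrt N + 1) * exp X) * ising_partition N A 1 0"
    using ising_partition_ge[OF A, of 0 1 0] by (intro mult_left_mono) auto
  also have "2 * (sqrt N + 1) * exp X = exp (ln (2 * (sqrt N + 1)) + X)"
    by (simp add: exp_add add_nonneg_pos)
  finally show "(\<Sum>\<sigma>\<in>spin_configs N. ising_weight N A 1 0 \<sigma> * exp (\<delta> / 2 *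
      (\<Sum>i<N. (local_field N A \<sigma> i - mean_local_field N A \<sigma>)\<^sup>2)))
    \<le> exp (ln (2 * (sqrt N + 1)) + (1 / 2 + (\<bar>S\<bar> / 2 + (\<delta> + cc) * \<rho>)\<^sup>2 / (4 * (c * N))
        + cc * (3 * (frobenius_norm N A)\<^sup>2 + 2))) * ising_partition N A 1 0"
    unfolding q_def X_def Y_def .
qed

section \<open>Crude bounds and the eventual spectral gap\<close>

lemma local_field_abs_le:
  assumes A: "coupling_matrix N A" and K: "\<And>i. i < N \<Longrightarrow> row_sum N A i \<le> K"
    and \<sigma>: "\<sigma> \<in> spin_configs N" and i: "i < N"
  shows "\<bar>local_field N A \<sigma> i\<bar> \<le> K"
proof -
  have "\<bar>local_field N A \<sigma> i\<bar> \<le> (\<Sum>j<N. \<bar>A $$ (i, j) * \<sigma> j\<bar>)"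
    unfolding local_field_def by (rule sum_abs)
  also have "\<dots> = row_sum N A i"
    unfolding row_sum_def
  proof (rule sum.cong[OF refl])
    fix j assume "j \<in> {..<N}"
    then have "0 \<le> A $$ (i, j)" "\<sigma> j \<in> {-1, 1}"
      using A \<sigma> i by (auto simp: coupling_matrix_def spin_configs_def PiE_def Pi_def)
    then show "\<bar>A $$ (i, j) * \<sigma> j\<bar> = A $$ (i, j)" by (auto simp: abs_mult)
  qed
  also have "\<dots> \<le> K" by (rule K[OF i])
  finally show ?thesis .
qed

lemma ln_expectation_crude_le:
  assumes A: "coupling_matrix N A" and K: "\<And>i. i < N \<Longrightarrow> row_sum N A i \<le> K"
    and \<delta>: "0 \<le> \<delta>" and c: "\<And>\<sigma>. \<sigma> \<in> spin_configs N \<Longrightarrow> \<bar>c \<sigma>\<bar> \<le> M"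
  shows "ln (measure_pmf.expectation (ising_pmf N A \<beta> B)
      (\<lambda>\<sigma>. exp (\<delta> / 2 * (\<Sum>i<N. (local_field N A \<sigma> i - c \<sigma>)\<^sup>2)))) \<le> \<delta> / 2 * (K + M)\<^sup>2 * N"
proof (rule ln_expectation_exp_le_sup)
  fix \<sigma> assume \<sigma>: "\<sigma> \<in> spin_configs N"
  have "(\<Sum>i<N. (local_field N A \<sigma> i - c \<sigma>)\<^sup>2) \<le> (\<Sum>i<N. (K + M)\<^sup>2)"
  proof (rule sum_mono)
    fix i assume "i \<in> {..<N}"
    then have "\<bar>local_field N A \<sigma> i - c \<sigma>\<bar> \<le> K + M"
      using local_field_abs_le[OF A K \<sigma>, of i] c[OF \<sigma>] by auto
    then have "\<bar>local_field N A \<sigma> i - c \<sigma>\<bar> \<le> \<bar>K + M\<bar>" by linarith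
    then show "(local_field N A \<sigma> i - c \<sigma>)\<^sup>2 \<le> (K + M)\<^sup>2" by (simp only: abs_le_square_iff)
  qed
  then have "\<delta> / 2 * (\<Sum>i<N. (local_field N A \<sigma> i - c \<sigma>)\<^sup>2) \<le> \<delta> / 2 * (\<Sum>i<N. (K + M)\<^sup>2)"
    using \<delta> by (intro mult_left_mono) auto
  then show "\<delta> / 2 * (\<Sum>i<N. (local_field N A \<sigma> i - c \<sigma>)\<^sup>2) \<le> \<delta> / 2 * (K + M)\<^sup>2 * N"
    by (simp add: mult_ac)
qed

text \<open>Cauchy-Schwarz twice, over the rows and within each row.\<close>

lemma frobenius_norm_sq_ge_row_sums:
  assumes N: "0 < N" and S: "\<bar>\<Sum>i<N. (row_sum N A i - 1)\<bar> \<le> N / 2"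
  shows "1 / 4 \<le> (frobenius_norm N A)\<^sup>2"
proof -
  have "row_dev N A = (\<Sum>i<N. row_sum N A i) - N" by (simp add: sum_subtractf)
  then have "N / 2 \<le> (\<Sum>i<N. row_sum N A i)" using S by linarith
  then have "(N / 2)\<^sup>2 \<le> (\<Sum>i<N. row_sum N A i)\<^sup>2" by (intro power_mono) auto
  also have "\<dots> \<le> N * (\<Sum>i<N. (row_sum N A i)\<^sup>2)"
    using sum_mult_sq_le[of "\<lambda>_. 1" "row_sum N A" "{..<N}"] by simp
  also have "\<dots> \<le> N * (\<Sum>i<N. N * (\<Sum>j<N. (A $$ (i, j))\<^sup>2))"
  proof (intro mult_left_mono sum_mono)
    show "(row_sum N A i)\<^sup>2 \<le> N * (\<Sum>j<N. (A $$ (i, j))\<^sup>2)" for i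
      using sum_mult_sq_le[of "\<lambda>_. 1" "\<lambda>j. A $$ (i, j)" "{..<N}"] by (simp add: row_sum_def)
  qed simp
  also have "\<dots> = (real N)\<^sup>2 * (frobenius_norm N A)\<^sup>2"
    unfolding frobenius_norm_sq by (simp add: sum_distrib_left[symmetric] power2_eq_square)
  finally have "(real N)\<^sup>2 * (1 / 4) \<le> (real N)\<^sup>2 * (frobenius_norm N A)\<^sup>2"
    by (simp add: power_divide)
  then show ?thesis using N by simp
qed

text \<open>The implication encodes a dichotomy: either the squared row deviations are a small
  multiple of \<open>N\<close>, and the gap is usable, or they are of order \<open>N\<close> and
  dominate the crude bound.\<close>

lemma eventually_spectral_gap:
  assumes A: "\<forall>N\<ge>2. coupling_matrix N (A N)"
    and ev1: "(\<lambda>N. eigenvalue_desc 1 (A N)) \<longlonglongrightarrow> 1"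
    and gap: "limsup (\<lambda>N. ereal (eigenvalue_desc 2 (A N) / eigenvalue_desc 1 (A N))) < 1"
  obtains \<kappa> where "0 < \<kappa>" "\<kappa> \<le> 1 / 4"
    "eventually (\<lambda>N. row_dev_sq N (A N) \<le> (\<kappa> / 16)\<^sup>2 * N \<longrightarrow>
        1 / 4 \<le> (frobenius_norm N (A N))\<^sup>2 \<and>
        (\<forall>x. mean_removed_form N (A N) x \<le> (1 - \<kappa> / 2) * norm_sq N x))
      sequentially"
proof -
  obtain z where z: "limsup (\<lambda>N. ereal (eigenvalue_desc 2 (A N) / eigenvalue_desc 1 (A N))) < ereal z"
      "ereal z < 1"
    using ereal_dense2[OF gap] by auto
  define \<kappa> where "\<kappa> = min (1 - z) (1 / 4)"
  have \<kappa>: "0 < \<kappa>" "\<kappa> \<le> 1 / 4" "z \<le> 1 - \<kappa>" 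
  proof -
    show "0 < \<kappa>" using z(2) by (simp add: \<kappa>_def)
    show "\<kappa> \<le> 1 / 4" unfolding \<kappa>_def by (rule min.cobounded2)
    show "z \<le> 1 - \<kappa>" using min.cobounded1[of "1 - z" "1 / 4"] unfolding \<kappa>_def by linarith
  qed
  have e1: "eventually (\<lambda>N. ereal (eigenvalue_desc 2 (A N) / eigenvalue_desc 1 (A N)) < ereal z) sequentially"
    by (rule Limsup_lessD[OF z(1)])
  have e2: "eventually (\<lambda>N. 0 < eigenvalue_desc 1 (A N)) sequentially"
    using ev1 by (rule order_tendstoD(1)) simp
  have e3: "eventually (\<lambda>N. eigenvalue_desc 1 (A N) < 1 + \<kappa> / 32) sequentially"
    using ev1 by (rule order_tendstoD(2)) (use \<kappa> in simp)
  have e4: "eventually (\<lambda>N. 1 / real N < \<kappa> / 4) sequentially"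
    using lim_1_over_n by (rule order_tendstoD(2)) (use \<kappa> in simp)
  have "eventually (\<lambda>N. row_dev_sq N (A N) \<le> (\<kappa> / 16)\<^sup>2 * N \<longrightarrow>
        1 / 4 \<le> (frobenius_norm N (A N))\<^sup>2 \<and>
        (\<forall>x. mean_removed_form N (A N) x \<le> (1 - \<kappa> / 2) * norm_sq N x))
      sequentially"
    using e1 e2 e3 e4 eventually_ge_at_top[of 2]
  proof eventually_elim
    case (elim N)
    let ?l1 = "eigenvalue_desc 1 (A N)" and ?l2 = "eigenvalue_desc 2 (A N)"
    let ?S = "row_dev N (A N)"
    have AN: "coupling_matrix N (A N)" and N: "0 < N" using A elim(5) by auto
    show ?case
    proof (rule impI)
      assume \<rho>: "row_dev_sq N (A N) \<le> (\<kappa> / 16)\<^sup>2 * N"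
      have "?S\<^sup>2 \<le> N * ((\<kappa> / 16)\<^sup>2 * N)"
        using row_sum_deviation_sq_le[where N = N and A = "A N"] mult_left_mono[OF \<rho>, of "real N"] by simp
      also have "\<dots> = (\<kappa> / 16 * N)\<^sup>2" by (simp add: power_mult_distrib power2_eq_square)
      finally have S: "\<bar>?S\<bar> \<le> \<kappa> / 16 * N" using \<kappa> by (simp add: abs_le_square_iff[symmetric])
      have "\<kappa> / 16 * N \<le> 1 / 2 * N" using \<kappa> by (intro mult_right_mono) auto
      then have F: "1 / 4 \<le> (frobenius_norm N (A N))\<^sup>2"
        using S by (intro frobenius_norm_sq_ge_row_sums N) simp
      have l2: "?l2 \<le> (1 - \<kappa>) * ?l1"
      proof -
        have "?l2 < z * ?l1" using elim(1,2) by (simp add: divide_less_eq)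
        also have "\<dots> \<le> (1 - \<kappa>) * ?l1" using \<kappa>(3) elim(2) by (intro mult_right_mono) auto
        finally show ?thesis by simp
      qed
      have l1: "?l1 \<le> 2" using elim(3) \<kappa> by simp
      \<comment> \<open>Losses: \<open>\<kappa> / 32\<close> from the top eigenvalue,
        \<open>\<kappa> / 16\<close> from twice its excess over 1, \<open>\<kappa> / 8\<close> from
        twice \<open>\<theta> = \<kappa> / 16\<close>; together \<open>7 * \<kappa> / 32\<close>,
        below \<open>\<kappa> / 4\<close>. Another \<open>\<kappa> / 4\<close> is reserved for the
        restored diagonal \<open>1 / N\<close>.\<close>
      have c: "(1 - \<kappa>) * ?l1 + 2 * (?l1 - 1 + \<kappa> / 16) \<le> 1 - 3 * \<kappa> / 4"
      proof -
        have "(1 - \<kappa>) * ?l1 \<le> (1 - \<kappa>) * (1 + \<kappa> / 32)" using elim(3) \<kappa> by (intro mult_left_mono) auto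
        also have "\<dots> \<le> 1 - \<kappa> + \<kappa> / 32" using \<kappa> by (simp add: algebra_simps)
        finally have "(1 - \<kappa>) * ?l1 \<le> 1 - \<kappa> + \<kappa> / 32" .
        moreover have "a + 2 * (l - 1 + k / 16) \<le> 1 - 3 * k / 4"
          if "a \<le> 1 - k + k / 32" "l < 1 + k / 32" "0 < k" for a l k :: real
          using that by (simp add: field_simps)
        ultimately show ?thesis using elim(3) \<kappa>(1) by blast
      qed
      have "mean_removed_form N (A N) x \<le> (1 - \<kappa> / 2) * norm_sq N x" for x
      proof -
        let ?X = "norm_sq N x"
        have X: "0 \<le> ?X" by (intro sum_nonneg) auto
        have "mat_form N (A N) x - (\<Sum>i<N. x i)\<^sup>2 / N \<le> (1 - 3 * \<kappa> / 4) * ?X"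
          using spectral_gap_off_constants[OF AN elim(5) \<kappa>(1,2) l2 elim(2) l1 S, of x]
            mult_right_mono[OF c X] by linarith
        moreover have "?X / N \<le> \<kappa> / 4 * ?X"
          using mult_right_mono[OF less_imp_le[OF elim(4)] X] by simp
        ultimately show ?thesis unfolding mean_removed_form_eq by (simp add: algebra_simps)
      qed
      then show "1 / 4 \<le> (frobenius_norm N (A N))\<^sup>2 \<and>
        (\<forall>x. mean_removed_form N (A N) x \<le> (1 - \<kappa> / 2) * norm_sq N x)"
        using F by blast
    qed
  qed
  then show ?thesis using that \<kappa> by blast
qed

lemma ln_expectation_lesssim_Theta2:
  assumes A: "\<forall>N\<ge>2. coupling_matrix N (A N)"
    and row: "lesssim (\<lambda>N. Max (row_sum N (A N) ` {..<N})) (\<lambda>_. 1)"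
    and ev1: "(\<lambda>N. eigenvalue_desc 1 (A N)) \<longlonglongrightarrow> 1"
    and \<beta>B: "(\<beta>, B) \<in> Theta2"
    and gap: "limsup (\<lambda>N. ereal (eigenvalue_desc 2 (A N) / eigenvalue_desc 1 (A N))) < 1"
  shows "\<exists>\<delta>>0. lesssim
          (\<lambda>N. ln (measure_pmf.expectation (ising_pmf N (A N) \<beta> B)
             (\<lambda>\<sigma>. exp (\<delta> / 2 * (\<Sum>i<N. (local_field N (A N) \<sigma> i - signed_root N \<beta> B \<sigma>)\<^sup>2)))))
          (\<lambda>N. (frobenius_norm N (A N))\<^sup>2
             + (mf_root \<beta> B)\<^sup>2 * row_dev_sq N (A N))"
proof -
  define t where "t = mf_root \<beta> B"
  have t: "0 < t" "t = tanh (\<beta> * t)" unfolding t_def using mf_root_Theta2[OF \<beta>B] by blast+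
  have \<beta>: "1 < \<beta>" and B: "B = 0" using \<beta>B by (auto simp: Theta2_def)
  obtain K where K0: "0 \<le> K" and K: "\<And>N i. 2 \<le> N \<Longrightarrow> i < N \<Longrightarrow> row_sum N (A N) i \<le> K"
    by (rule coupling_sequence_row_sum_bound[OF row]) (rule that)
  obtain \<kappa> where \<kappa>: "0 < \<kappa>" "\<kappa> \<le> 1 / 4" and ev: "eventually (\<lambda>N.
        row_dev_sq N (A N) \<le> (\<kappa> / 16)\<^sup>2 * N \<longrightarrow> 1 / 4 \<le> (frobenius_norm N (A N))\<^sup>2 \<and>
        (\<forall>x. mean_removed_form N (A N) x \<le> (1 - \<kappa> / 2) * norm_sq N x))
      sequentially"
    by (rule eventually_spectral_gap[OF A ev1 gap]) (rule that)
  \<comment> \<open>With this cutoff \<open>\<beta> * slope w \<le> 1 / (1 - \<kappa> / 4)\<close>.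
    As \<open>1 - \<kappa> / 2\<close> is at most \<open>(1 - \<kappa> / 4)\<^sup>2\<close>, the
    margin \<open>\<kappa> / 4\<close> remains: half for the squared local fields, half as
    \<open>\<epsilon>\<close>.\<close>
  interpret ferromagnetic_root \<beta> t "\<kappa> / 4"
    using \<beta> t \<kappa> by unfold_locales auto
  obtain c where c: "0 < c" and free: "\<And>w. 0 \<le> w \<Longrightarrow> w \<le> 1 \<Longrightarrow>
      free_energy w \<le> ln (cosh (\<beta> * t)) - \<beta> * t\<^sup>2 / 2 - c * (w - t)\<^sup>2"
    using free_energy_le by auto
  define L where "L = max \<beta> (1 / (\<kappa> / 4 * t))"
  define \<epsilon> where "\<epsilon> = \<kappa> / 8"
  \<comment> \<open>The first entry keeps the squared local fields within the spectral margin, the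
    second keeps the shift of the centre within a quarter of the free-energy decay.\<close>
  define \<delta> where "\<delta> = min (\<kappa> / (32 * (K\<^sup>2 + 1))) (c / (4 * (L\<^sup>2 + 1)))"
  have K1: "0 < K\<^sup>2 + 1" and L1: "0 < L\<^sup>2 + 1" by (auto simp: add_nonneg_pos)
  have \<epsilon>: "0 < \<epsilon>" using \<kappa> by (simp add: \<epsilon>_def)
  have \<delta>: "0 < \<delta>" using \<kappa> c K1 L1 by (simp add: \<delta>_def)
  have cancel: "x / (n * d) * d = x / n" if "0 < d" for x n d :: real using that by simp
  have \<delta>K: "4 * \<delta> * K\<^sup>2 \<le> \<kappa> / 8"
  proof -
    have "\<delta> * K\<^sup>2 \<le> \<kappa> / (32 * (K\<^sup>2 + 1)) * (K\<^sup>2 + 1)"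
      using \<delta> K1 by (intro mult_mono) (auto simp: \<delta>_def)
    also have "\<dots> = \<kappa> / 32" using K1 by (rule cancel)
    finally show ?thesis by simp
  qed
  have \<delta>L: "\<delta> * L\<^sup>2 \<le> c / 4"
  proof -
    have "\<delta> * L\<^sup>2 \<le> c / (4 * (L\<^sup>2 + 1)) * (L\<^sup>2 + 1)"
      using \<delta> L1 c by (intro mult_mono) (auto simp: \<delta>_def)
    also have "\<dots> = c / 4" using L1 by (rule cancel)
    finally show ?thesis .
  qed
  define cc where "cc = core_const \<beta> (2 * \<delta>) K \<epsilon>"
  have cc: "0 \<le> cc" unfolding cc_def using \<delta> \<epsilon> by (intro core_const_nonneg) auto
  define b where "b = ln (2 * (exp (c / 2) * (2 * exp (c / 2) / (1 - exp (- (c / 2)))))) + \<beta> / 2 + 2 * cc"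
  define a where "a = 2 * \<delta> + \<beta>\<^sup>2 * L\<^sup>2 / c + cc * \<beta>\<^sup>2"
  have a: "0 \<le> a" unfolding a_def using \<delta> c cc by (intro add_nonneg_nonneg) auto
  \<comment> \<open>The division by \<open>t\<^sup>2 > 0\<close> is there because the row deviations
    carry the factor \<open>t\<^sup>2\<close> in the target bound.\<close>
  define C1 where "C1 = 3 * cc + 4 * \<bar>b\<bar> + a / t\<^sup>2"
  define C2 where "C2 = \<delta> / 2 * (K + 1)\<^sup>2 * (16 / \<kappa>)\<^sup>2 / t\<^sup>2"
  have C12: "0 \<le> C1" "0 \<le> C2"
    unfolding C1_def C2_def using cc a \<delta> by (auto intro!: add_nonneg_nonneg divide_nonneg_nonneg)
  let ?f = "\<lambda>N. ln (measure_pmf.expectation (ising_pmf N (A N) \<beta> B)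
             (\<lambda>\<sigma>. exp (\<delta> / 2 * (\<Sum>i<N. (local_field N (A N) \<sigma> i - signed_root N \<beta> B \<sigma>)\<^sup>2))))"
  have "eventually (\<lambda>N. ?f N \<le> (C1 + C2) *
      ((frobenius_norm N (A N))\<^sup>2 + t\<^sup>2 * row_dev_sq N (A N))) sequentially"
    using ev eventually_ge_at_top[of 2]
  proof eventually_elim
    case (elim N)
    let ?F = "(frobenius_norm N (A N))\<^sup>2" and ?\<rho> = "row_dev_sq N (A N)"
    have AN: "coupling_matrix N (A N)" and N: "0 < N" using A elim(2) by auto
    have \<rho>: "0 \<le> ?\<rho>" by (intro sum_nonneg) auto
    have t2: "0 < t\<^sup>2" using t(1) by simp
    show ?case
    proof (cases "?\<rho> \<le> (\<kappa> / 16)\<^sup>2 * N")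
      case True
      then have F: "1 / 4 \<le> ?F" and mr: "\<And>x. mean_removed_form N (A N) x
          \<le> (1 - \<kappa> / 2) * norm_sq N x" using elim(1) by auto
      have pos: "slope w * (\<beta> * mean_removed_form N (A N) x
          + 2 * (2 * \<delta>) * field_sq N (A N) x) \<le> (1 - \<epsilon>) * norm_sq N x"
        if "0 \<le> w" "w \<le> 1" for w x
      proof -
        let ?X = "norm_sq N x"
        have X: "0 \<le> ?X" by (intro sum_nonneg) auto
        have "0 \<le> \<beta> * max w q\<^sub>0" using q\<^sub>0(1) \<beta> by simp
        then have s: "0 < slope w" "slope w \<le> 1"
          unfolding slope_def using tangent_slope_pos tangent_slope_le_1 by auto
        have "\<beta> * slope w * mean_removed_form N (A N) x
            \<le> \<beta> * slope w * ((1 - \<kappa> / 2) * ?X)"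
          using s \<beta> by (intro mult_left_mono mr) auto
        also have "\<dots> \<le> 1 / (1 - \<kappa> / 4) * ((1 - \<kappa> / 2) * ?X)"
          using slope_le[of w] \<kappa> X by (intro mult_right_mono) auto
        also have "\<dots> = (1 - \<kappa> / 2) / (1 - \<kappa> / 4) * ?X" by simp
        also have "\<dots> \<le> (1 - \<kappa> / 4) * ?X"
        proof (rule mult_right_mono[OF _ X])
          have "1 - \<kappa> / 2 \<le> (1 - \<kappa> / 4) * (1 - \<kappa> / 4)" by (simp add: algebra_simps)
          then show "(1 - \<kappa> / 2) / (1 - \<kappa> / 4) \<le> 1 - \<kappa> / 4" using \<kappa> by (subst pos_divide_le_eq) auto
        qed
        finally have 1: "\<beta> * slope w * mean_removed_form N (A N) x \<le> (1 - \<kappa> / 4) * ?X" .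
        have "slope w * (4 * \<delta> * field_sq N (A N) x) \<le> 1 * (4 * \<delta> * (K\<^sup>2 * ?X))"
          using s \<delta> X K[OF elim(2)]
          by (intro mult_mono mult_left_mono local_field_sq_sum_le AN mult_nonneg_nonneg sum_nonneg) auto
        also have "\<dots> \<le> \<kappa> / 8 * ?X" using mult_right_mono[OF \<delta>K X] by (simp add: mult.assoc)
        finally have 2: "slope w * (4 * \<delta> * field_sq N (A N) x) \<le> \<kappa> / 8 * ?X" .
        have "slope w * (\<beta> * mean_removed_form N (A N) x
          + 2 * (2 * \<delta>) * field_sq N (A N) x)
          = \<beta> * slope w * mean_removed_form N (A N) x
            + slope w * (4 * \<delta> * field_sq N (A N) x)"
          by (simp only: distrib_left mult_ac)
        also have "\<dots> \<le> (1 - \<epsilon>) * ?X" using 1 2 by (simp add: \<epsilon>_def left_diff_distrib)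
        finally show ?thesis .
      qed
      have "?f N \<le> ln (2 * (exp (c / 2) * (2 * exp (c / 2) / (1 - exp (- (c / 2))))))
        + (\<beta> / 2 + 2 * \<delta> * ?\<rho> + \<beta>\<^sup>2 * L\<^sup>2 / c * ?\<rho> + cc * (3 * ?F + 2 + \<beta>\<^sup>2 * ?\<rho>))"
        unfolding B signed_root_def t_def[symmetric, unfolded B] L_def cc_def
        using K[OF elim(2)] by (intro ln_expectation_supercritical_le[OF AN _ N \<delta> \<epsilon> pos c free]
          \<delta>L[unfolded L_def]) auto
      also have "\<dots> = 3 * cc * ?F + b + a * ?\<rho>" by (simp add: a_def b_def algebra_simps)
      also have "\<dots> \<le> 3 * cc * ?F + 4 * \<bar>b\<bar> * ?F + a / t\<^sup>2 * (t\<^sup>2 * ?\<rho>)"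
      proof -
        \<comment> \<open>The additive constant is charged to the squared Frobenius norm, which is
          at least 1/4 in this case.\<close>
        have "\<bar>b\<bar> * 1 \<le> \<bar>b\<bar> * (4 * ?F)" using F by (intro mult_left_mono) auto
        then have "b \<le> 4 * \<bar>b\<bar> * ?F" by (simp add: mult_ac) 
        moreover have "a / t\<^sup>2 * (t\<^sup>2 * ?\<rho>) = a * ?\<rho>" using t2 by simp
        ultimately show ?thesis by simp
      qed
      also have "\<dots> \<le> (C1 + C2) * (?F + t\<^sup>2 * ?\<rho>)"
      proof -
        have nn: "0 \<le> ?F" "0 \<le> t\<^sup>2 * ?\<rho>" using \<rho> by auto
        have "(3 * cc + 4 * \<bar>b\<bar>) * ?F \<le> C1 * ?F"
          using a nn by (intro mult_right_mono) (auto simp: C1_def)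
        moreover have "a / t\<^sup>2 * (t\<^sup>2 * ?\<rho>) \<le> C1 * (t\<^sup>2 * ?\<rho>)"
          using cc nn by (intro mult_right_mono) (auto simp: C1_def)
        moreover have "C1 * (?F + t\<^sup>2 * ?\<rho>) \<le> (C1 + C2) * (?F + t\<^sup>2 * ?\<rho>)"
          using C12 nn by (intro mult_right_mono) auto
        ultimately show ?thesis by (simp add: distrib_left distrib_right)
      qed
      finally show ?thesis .
    next
      case False
      then have N\<rho>: "N \<le> (16 / \<kappa>)\<^sup>2 * ?\<rho>" using \<kappa>(1) by (simp add: field_simps power_divide)
      have "?f N \<le> \<delta> / 2 * (K + 1)\<^sup>2 * N"
        using K[OF elim(2)] \<delta> t t_less_1
        by (intro ln_expectation_crude_le AN) (auto simp: signed_root_def t_def[symmetric])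
      also have "\<dots> \<le> \<delta> / 2 * (K + 1)\<^sup>2 * ((16 / \<kappa>)\<^sup>2 * ?\<rho>)"
        using N\<rho> \<delta> by (intro mult_left_mono) auto
      also have "\<dots> = C2 * (t\<^sup>2 * ?\<rho>)" using t2 by (simp add: C2_def)
      also have "\<dots> \<le> (C1 + C2) * (?F + t\<^sup>2 * ?\<rho>)"
        using C12 \<rho> by (intro mult_mono) auto
      finally show ?thesis .
    qed
  qed
  then have "lesssim ?f (\<lambda>N. (frobenius_norm N (A N))\<^sup>2 + t\<^sup>2 * row_dev_sq N (A N))"
    by (rule lesssimI) (rule theta_rhs_pos_or_trivial, use t(1) in auto)
  then show ?thesis using \<delta> unfolding t_def by blast
qed

lemma ln_expectation_lesssim_critical:
  assumes A: "\<forall>N\<ge>2. coupling_matrix N (A N)"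
    and row: "lesssim (\<lambda>N. Max (row_sum N (A N) ` {..<N})) (\<lambda>_. 1)"
    and ev1: "(\<lambda>N. eigenvalue_desc 1 (A N)) \<longlonglongrightarrow> 1"
    and gap: "limsup (\<lambda>N. ereal (eigenvalue_desc 2 (A N) / eigenvalue_desc 1 (A N))) < 1"
  shows "\<exists>\<delta>>0. lesssim
          (\<lambda>N. ln (measure_pmf.expectation (ising_pmf N (A N) 1 0)
             (\<lambda>\<sigma>. exp (\<delta> / 2 *
                (\<Sum>i<N. (local_field N (A N) \<sigma> i - mean_local_field N (A N) \<sigma>)\<^sup>2)))))
          (\<lambda>N. (frobenius_norm N (A N))\<^sup>2
             + 1 / real N * (row_dev_sq N (A N))\<^sup>2
             + 1 / real N * (row_dev N (A N))\<^sup>2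
             + ln (real N))"
proof -
  obtain K where K0: "0 \<le> K" and K: "\<And>N i. 2 \<le> N \<Longrightarrow> i < N \<Longrightarrow> row_sum N (A N) i \<le> K"
    by (rule coupling_sequence_row_sum_bound[OF row]) (rule that)
  obtain \<kappa> where \<kappa>: "0 < \<kappa>" "\<kappa> \<le> 1 / 4" and ev: "eventually (\<lambda>N.
        row_dev_sq N (A N) \<le> (\<kappa> / 16)\<^sup>2 * N \<longrightarrow> 1 / 4 \<le> (frobenius_norm N (A N))\<^sup>2 \<and>
        (\<forall>x. mean_removed_form N (A N) x \<le> (1 - \<kappa> / 2) * norm_sq N x))
      sequentially"
    by (rule eventually_spectral_gap[OF A ev1 gap]) (rule that)
  obtain c :: real where c: "0 < c" and quartic: "\<And>w. 0 \<le> w \<Longrightarrow> w \<le> 1 \<Longrightarrow> ln (cosh w) - w\<^sup>2 / 2 \<le> - c * w ^ 4"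
    using ln_cosh_quartic_bound by auto
  define \<epsilon> where "\<epsilon> = \<kappa> / 4"
  define \<delta> where "\<delta> = \<kappa> / (8 * (K\<^sup>2 + 1))"
  have K1: "0 < K\<^sup>2 + 1" by (simp add: add_nonneg_pos)
  have \<epsilon>: "0 < \<epsilon>" using \<kappa> by (simp add: \<epsilon>_def)
  have \<delta>: "0 < \<delta>" using \<kappa> K1 by (simp add: \<delta>_def)
  have cancel: "x / (n * d) * d = x / n" if "0 < d" for x n d :: real using that by simp
  have \<delta>K: "2 * \<delta> * K\<^sup>2 \<le> \<kappa> / 4"
  proof -
    have "\<delta> * K\<^sup>2 \<le> \<kappa> / (8 * (K\<^sup>2 + 1)) * (K\<^sup>2 + 1)"
      using \<delta> K1 by (intro mult_mono) (auto simp: \<delta>_def)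
    also have "\<dots> = \<kappa> / 8" using K1 by (rule cancel)
    finally show ?thesis by simp
  qed
  define cc where "cc = core_const 1 \<delta> K \<epsilon>"
  have cc: "0 \<le> cc" unfolding cc_def using \<delta> \<epsilon> by (intro core_const_nonneg) auto
  \<comment> \<open>Additive constants are charged to \<open>ln (real N)\<close>, which is at least
    \<open>ln 2\<close>.\<close>
  define C0 where "C0 = (1 / 2 + 2 * cc) / ln 2"
  define C1 where "C1 = 1 / (8 * c) + (\<delta> + cc)\<^sup>2 / (2 * c)"
  define C2 where "C2 = \<delta> / 2 * (K + K)\<^sup>2 * (16 / \<kappa>) ^ 4"
  define C where "C = 3 * cc + (3 + C0) + C1 + C2"
  have nnC: "0 \<le> C0" "0 \<le> C1" "0 \<le> C2"
    unfolding C0_def C1_def C2_def using cc c \<delta>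
    by (auto intro!: add_nonneg_nonneg divide_nonneg_nonneg)
  let ?f = "\<lambda>N. ln (measure_pmf.expectation (ising_pmf N (A N) 1 0)
             (\<lambda>\<sigma>. exp (\<delta> / 2 *
                (\<Sum>i<N. (local_field N (A N) \<sigma> i - mean_local_field N (A N) \<sigma>)\<^sup>2))))"
  let ?g = "\<lambda>N. (frobenius_norm N (A N))\<^sup>2
             + 1 / real N * (row_dev_sq N (A N))\<^sup>2
             + 1 / real N * (row_dev N (A N))\<^sup>2
             + ln (real N)"
  have "eventually (\<lambda>N. ?f N \<le> C * ?g N) sequentially"
    using ev eventually_ge_at_top[of 2]
  proof eventually_elim
    case (elim N)
    let ?F = "(frobenius_norm N (A N))\<^sup>2" and ?\<rho> = "row_dev_sq N (A N)"
    let ?S = "row_dev N (A N)"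
    have AN: "coupling_matrix N (A N)" and N: "0 < N" using A elim(2) by auto
    have \<rho>: "0 \<le> ?\<rho>" by (intro sum_nonneg) auto
    have ln2: "0 < ln (2::real)" "ln 2 \<le> ln (real N)" using elim(2) by auto
    define R where "R = 1 / real N * ?\<rho>\<^sup>2"
    define T where "T = 1 / real N * ?S\<^sup>2"
    have nn: "0 \<le> ?F" "0 \<le> R" "0 \<le> T" "0 \<le> ln (real N)"
      using order_trans[OF less_imp_le[OF ln2(1)] ln2(2)] by (simp_all add: R_def T_def)
    have C_ge: "3 * cc * ?F + C1 * (R + T) + (3 + C0) * ln (real N) + C2 * R \<le> C * ?g N"
    proof -
      have "3 * cc * ?F \<le> C * ?F" "(3 + C0) * ln (real N) \<le> C * ln (real N)"
          "(C1 + C2) * R \<le> C * R" "C1 * T \<le> C * T"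
        using nn nnC cc by (intro mult_right_mono; simp add: C_def)+
      then show ?thesis unfolding R_def[symmetric] T_def[symmetric]
        by (simp add: distrib_left distrib_right)
    qed
    show ?case
    proof (cases "?\<rho> \<le> (\<kappa> / 16)\<^sup>2 * N")
      case True
      then have mr: "\<And>x. mean_removed_form N (A N) x
          \<le> (1 - \<kappa> / 2) * norm_sq N x" using elim(1) by auto
      have pos: "tangent_slope w * (mean_removed_form N (A N) x
          + 2 * \<delta> * field_sq N (A N) x) \<le> (1 - \<epsilon>) * norm_sq N x"
        if w: "0 \<le> w" "w \<le> 1" for w x
      proof -
        let ?X = "norm_sq N x"
        have X: "0 \<le> ?X" by (intro sum_nonneg) auto
        have s: "0 < tangent_slope w" "tangent_slope w \<le> 1"
          using tangent_slope_pos tangent_slope_le_1 w by auto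
        have "2 * \<delta> * field_sq N (A N) x \<le> 2 * \<delta> * (K\<^sup>2 * ?X)"
          using \<delta> K[OF elim(2)] by (intro mult_left_mono local_field_sq_sum_le AN) auto
        also have "\<dots> \<le> \<kappa> / 4 * ?X" using mult_right_mono[OF \<delta>K X] by (simp add: mult.assoc)
        finally have "mean_removed_form N (A N) x
          + 2 * \<delta> * field_sq N (A N) x \<le> (1 - \<epsilon>) * ?X"
          using mr[of x] by (simp add: \<epsilon>_def algebra_simps)
        then have "tangent_slope w * (mean_removed_form N (A N) x
          + 2 * \<delta> * field_sq N (A N) x) \<le> tangent_slope w * ((1 - \<epsilon>) * ?X)"
          using s by (intro mult_left_mono) auto
        also have "\<dots> \<le> 1 * ((1 - \<epsilon>) * ?X)"
          using s X \<kappa> by (intro mult_right_mono) (auto simp: \<epsilon>_def)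
        finally show ?thesis by simp
      qed
      have "?f N \<le> ln (2 * (sqrt N + 1)) + (1 / 2 + (\<bar>?S\<bar> / 2 + (\<delta> + cc) * ?\<rho>)\<^sup>2 / (4 * (c * N))
          + cc * (3 * ?F + 2))"
        unfolding cc_def using K[OF elim(2)]
        by (intro ln_expectation_critical_le[OF AN _ N \<delta> \<epsilon> pos c quartic]) auto
      also have "\<dots> \<le> (2 * ln (real N) + ln (real N)) + (C0 * ln (real N) + C1 * (R + T) + 3 * cc * ?F)"
      proof -
        have "ln (2 * (sqrt N + 1)) \<le> 2 * ln (real N) + ln (real N)"
        proof -
          have "sqrt N \<le> real N" using N by (simp add: sqrt_le_D real_le_lsqrt power2_eq_square)
          then have "2 * (sqrt N + 1) \<le> 4 * real N" using N by simp
          then have "ln (2 * (sqrt N + 1)) \<le> ln (4 * real N)" using N by (subst ln_le_cancel_iff) (auto simp: add_nonneg_pos)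
          also have "\<dots> = ln 4 + ln (real N)" using N by (simp add: ln_mult)
          also have "ln (4::real) = 2 * ln 2" using ln_realpow[of "2::real" 2] by simp
          finally show ?thesis using ln2 by simp
        qed
        moreover have "1 / 2 + 2 * cc \<le> C0 * ln (real N)"
        proof -
          have "1 / 2 + 2 * cc = C0 * ln 2" using ln2 by (simp add: C0_def)
          also have "\<dots> \<le> C0 * ln (real N)" using ln2 nnC by (intro mult_left_mono) auto
          finally show ?thesis .
        qed
        moreover have "(\<bar>?S\<bar> / 2 + (\<delta> + cc) * ?\<rho>)\<^sup>2 / (4 * (c * N)) \<le> C1 * (R + T)"
        proof -
          have "(\<bar>?S\<bar> / 2 + (\<delta> + cc) * ?\<rho>)\<^sup>2 \<le> 2 * (\<bar>?S\<bar> / 2)\<^sup>2 + 2 * ((\<delta> + cc) * ?\<rho>)\<^sup>2"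
            using sum_squares_bound[of "\<bar>?S\<bar> / 2" "(\<delta> + cc) * ?\<rho>"] by (simp add: power2_sum)
          also have "\<dots> = ?S\<^sup>2 / 2 + 2 * (\<delta> + cc)\<^sup>2 * ?\<rho>\<^sup>2"
            by (simp add: power_mult_distrib power_divide)
          finally have "(\<bar>?S\<bar> / 2 + (\<delta> + cc) * ?\<rho>)\<^sup>2 / (4 * (c * N))
              \<le> (?S\<^sup>2 / 2 + 2 * (\<delta> + cc)\<^sup>2 * ?\<rho>\<^sup>2) / (4 * (c * N))"
            using c by (intro divide_right_mono) auto
          also have "\<dots> = 1 / (8 * c) * T + (\<delta> + cc)\<^sup>2 / (2 * c) * R"
            using c N by (simp add: R_def T_def field_simps)
          also have "\<dots> \<le> C1 * T + C1 * R"
            using nn c by (intro add_mono mult_right_mono) (auto simp: C1_def)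
          finally show ?thesis by (simp add: algebra_simps)
        qed
        ultimately show ?thesis by (simp add: algebra_simps)
      qed
      also have "\<dots> = 3 * cc * ?F + C1 * (R + T) + (3 + C0) * ln (real N)" by (simp add: algebra_simps)
      also have "\<dots> \<le> C * ?g N" using C_ge mult_nonneg_nonneg[OF nnC(3) nn(2)] by linarith
      finally show ?thesis .
    next
      case False
      then have N\<rho>: "N \<le> (16 / \<kappa>)\<^sup>2 * ?\<rho>" using \<kappa>(1) by (simp add: field_simps power_divide)
      \<comment> \<open>The target offers the squared row deviations only in the form of their
        square over \<open>N\<close>, so the inequality is squared and divided by \<open>N\<close>;
        hence the fourth power in \<open>C2\<close>.\<close>
      then have "(real N)\<^sup>2 \<le> ((16 / \<kappa>)\<^sup>2 * ?\<rho>)\<^sup>2" by (intro power_mono) auto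
      also have "\<dots> = (16 / \<kappa>) ^ 4 * ?\<rho>\<^sup>2" by (simp only: power_mult_distrib power_mult[symmetric]) simp
      finally have sq: "(real N)\<^sup>2 \<le> (16 / \<kappa>) ^ 4 * ?\<rho>\<^sup>2" .
      have "real N \<le> k * (1 / real N * P)" if "(real N)\<^sup>2 \<le> k * P" for k P :: real
        using that N by (simp add: power2_eq_square pos_le_divide_eq)
      from this[OF sq] have "N \<le> (16 / \<kappa>) ^ 4 * R" by (simp only: R_def)
      then have "\<delta> / 2 * (K + K)\<^sup>2 * N \<le> \<delta> / 2 * (K + K)\<^sup>2 * ((16 / \<kappa>) ^ 4 * R)"
        using \<delta> by (intro mult_left_mono) auto
      moreover have "?f N \<le> \<delta> / 2 * (K + K)\<^sup>2 * N"
      proof (rule ln_expectation_crude_le[OF AN])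
        show "\<bar>mean_local_field N (A N) \<sigma>\<bar> \<le> K" if \<sigma>: "\<sigma> \<in> spin_configs N" for \<sigma>
        proof -
          have "\<bar>\<Sum>i<N. local_field N (A N) \<sigma> i\<bar> \<le> (\<Sum>i<N. \<bar>local_field N (A N) \<sigma> i\<bar>)" by (rule sum_abs)
          also have "\<dots> \<le> (\<Sum>i<N. K)"
            using K[OF elim(2)] by (intro sum_mono local_field_abs_le[OF AN _ \<sigma>]) auto
          finally show ?thesis using N by (simp add: mean_local_field_def divide_le_eq mult.commute)
        qed
      qed (use K[OF elim(2)] \<delta> in auto)
      ultimately have "?f N \<le> C2 * R" by (simp add: C2_def mult.assoc)
      also have "\<dots> \<le> C * ?g N"
      proof -
        have "0 \<le> 3 * cc * ?F" "0 \<le> C1 * (R + T)" "0 \<le> (3 + C0) * ln (real N)"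
          using cc nnC nn by (auto intro!: mult_nonneg_nonneg)
        then show ?thesis using C_ge by linarith
      qed
      finally show ?thesis .
    qed
  qed
  then have "lesssim ?f ?g"
  proof (rule lesssimI)
    fix N :: nat assume "2 \<le> N"
    then have "0 < ln (real N)" by simp
    then show "0 < ?g N \<or> (0 \<le> ?g N \<and> ?f N \<le> 0)" by (intro disjI1 add_nonneg_pos add_nonneg_nonneg) auto
  qed
  then show ?thesis using \<delta> by blast
qed

theorem lemma2p1:
  fixes A :: "nat \<Rightarrow> real mat" and \<beta> B :: real
  assumes "\<forall>N\<ge>2. coupling_matrix N (A N)"
    and "lesssim (\<lambda>N. Max (row_sum N (A N) ` {..<N})) (\<lambda>_. 1)"
    and "(\<lambda>N. eigenvalue_desc 1 (A N)) \<longlonglongrightarrow> 1"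
  shows
    "((\<beta>, B) \<in> Theta1 \<longrightarrow>
       (\<exists>\<delta>>0. lesssim
          (\<lambda>N. ln (measure_pmf.expectation (ising_pmf N (A N) \<beta> B)
             (\<lambda>\<sigma>. exp (\<delta> / 2 * (\<Sum>i<N. (local_field N (A N) \<sigma> i - mf_root \<beta> B)\<^sup>2)))))
          (\<lambda>N. (frobenius_norm N (A N))\<^sup>2
             + (mf_root \<beta> B)\<^sup>2 * (\<Sum>i<N. (row_sum N (A N) i - 1)\<^sup>2))))
     \<and>
     ((\<beta>, B) \<in> Theta2 \<and>
       limsup (\<lambda>N. ereal (eigenvalue_desc 2 (A N) / eigenvalue_desc 1 (A N))) < 1 \<longrightarrow>
       (\<exists>\<delta>>0. lesssim
          (\<lambda>N. ln (measure_pmf.expectation (ising_pmf N (A N) \<beta> B)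
             (\<lambda>\<sigma>. exp (\<delta> / 2 * (\<Sum>i<N. (local_field N (A N) \<sigma> i - signed_root N \<beta> B \<sigma>)\<^sup>2)))))
          (\<lambda>N. (frobenius_norm N (A N))\<^sup>2
             + (mf_root \<beta> B)\<^sup>2 * (\<Sum>i<N. (row_sum N (A N) i - 1)\<^sup>2))))
     \<and>
     ((\<beta>, B) \<in> Theta3 \<and>
       limsup (\<lambda>N. ereal (eigenvalue_desc 2 (A N) / eigenvalue_desc 1 (A N))) < 1 \<longrightarrow>
       (\<exists>\<delta>>0. lesssim
          (\<lambda>N. ln (measure_pmf.expectation (ising_pmf N (A N) \<beta> B)
             (\<lambda>\<sigma>. exp (\<delta> / 2 *
                (\<Sum>i<N. (local_field N (A N) \<sigma> i - mean_local_field N (A N) \<sigma>)\<^sup>2)))))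
          (\<lambda>N. (frobenius_norm N (A N))\<^sup>2
             + 1 / real N * (\<Sum>i<N. (row_sum N (A N) i - 1)\<^sup>2)\<^sup>2
             + 1 / real N * (\<Sum>i<N. (row_sum N (A N) i - 1))\<^sup>2
             + ln (real N))))"
proof (intro conjI impI)
  assume "(\<beta>, B) \<in> Theta3 \<and>
       limsup (\<lambda>N. ereal (eigenvalue_desc 2 (A N) / eigenvalue_desc 1 (A N))) < 1"
  then have "\<beta> = 1" "B = 0"
    and gap: "limsup (\<lambda>N. ereal (eigenvalue_desc 2 (A N) / eigenvalue_desc 1 (A N))) < 1"
    by (auto simp: Theta3_def)
  show "\<exists>\<delta>>0. lesssim
          (\<lambda>N. ln (measure_pmf.expectation (ising_pmf N (A N) \<beta> B)
             (\<lambda>\<sigma>. exp (\<delta> / 2 *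
                (\<Sum>i<N. (local_field N (A N) \<sigma> i - mean_local_field N (A N) \<sigma>)\<^sup>2)))))
          (\<lambda>N. (frobenius_norm N (A N))\<^sup>2
             + 1 / real N * (\<Sum>i<N. (row_sum N (A N) i - 1)\<^sup>2)\<^sup>2
             + 1 / real N * (\<Sum>i<N. (row_sum N (A N) i - 1))\<^sup>2
             + ln (real N))"
    unfolding \<open>\<beta> = 1\<close> \<open>B = 0\<close> by (rule ln_expectation_lesssim_critical[OF assms gap])
qed (use ln_expectation_lesssim_Theta1[OF assms] ln_expectation_lesssim_Theta2[OF assms] in blast)+

end
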